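(* For $z_0,z_0'\in\mathbb H$, $m,n\in\mathbb Z_{\ge0}$ and any orthonormal basis $\mathcal F$ of $S_k(\Gamma)$, $$\sum_{f\in\mathcal F}\overline{c_{z_0}(f,m)}\,c_{z_0'}(f,n)=\frac{2^{k-3}(m+k-1)!\,(z_0'-\overline{z_0'})^{n+k/2}}{\pi\,m!\,(k-2)!}\sum_{j=0}^n\binom mj\binom{n+k-1}{n-j}G_{k+2n}(z_0',z_0;m-j,n-j).$$
   Context: $\Gamma\subset\mathrm{SL}(2,\mathbb R)$ is discrete, finitely generated, of finite covolume, with a cusp of width $1$ at $\infty$; $k\ge4$ even; $j(\gamma,z)=cz+d$. $S_k(\Gamma)$ is the space of weight $k$ cusp forms with Petersson inner product $\langle f,g\rangle=\int_{\Gamma\backslash\mathbb H}f\overline g\,y^k\frac{dx\,dy}{y^2}$. For $z_0=\alpha+i\beta\in\mathbb H$ let $\sigma_{z_0}=\frac1{2i\beta}\begin{pmatrix}-\overline{z_0}&z_0\\-1&1\end{pmatrix}$ (so $\sigma_{z_0}^{-1}=\begin{pmatrix}1&-z_0\\1&-\overline{z_0}\end{pmatrix}$), $(f|_k\gamma)(z)=\det(\gamma)^{k/2}f(\gamma z)j(\gamma,z)^{-k}$, and define $c_{z_0}(f,m)$ by $(f|_k\sigma_{z_0})(w)=\sum_{m\ge0}c_{z_0}(f,m)w^m$. For integers $m\ge0$, $l\ge0$ and weight $k'$, $$G_{k'}(z,z_0;m,l)=(2i\beta)^{k'/2}\sum_{\gamma\in\Gamma}\frac{w_\gamma^{\,m-l}}{j(\sigma_{z_0}^{-1}\gamma,z)^{k'}}\Big(\frac{|w_\gamma|^2}{|w_\gamma|^2-1}\Big)^l,\qquad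 w_\gamma=\sigma_{z_0}^{-1}\gamma z,$$ i.e. $G_{k'}(z,z_0;m,l)=\sum_{\gamma\in\Gamma}(Q_{m,l}|_{k'}\sigma_{z_0}^{-1}\gamma)(z)$ with $Q_{m,l}(w)=w^m(\overline w/(|w|^2-1))^l$; terms with $\binom mj=0$ are zero.
   Formalization: The group Γ is assumed to contain −I (the stabiliser of ∞ is all ±(1 b; 0 1), b an integer); if −I is not in Γ, sums over Γ count each Moebius map once and the constant 2^{k−3} is off by a factor 2 (e.g. Γ_1(4), k=6). *)

theory Defs
  imports "HOL-Complex_Analysis.Complex_Analysis" "HOL-Algebra.Generated_Groups"
begin

section \<open>Matrices acting on the complex plane\<close>

abbreviation mat2 :: "'a::zero \<Rightarrow> 'a \<Rightarrow> 'a \<Rightarrow> 'a \<Rightarrow> 'a^2^2" where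
  "mat2 a b c d \<equiv> vector [vector [a, b], vector [c, d]]"

abbreviation cmat :: "real^2^2 \<Rightarrow> complex^2^2" where
  "cmat \<equiv> map_matrix complex_of_real"

abbreviation upper_half_plane :: "complex set" (\<open>\<H>\<close>) where
  "\<H> \<equiv> {z. 0 < Im z}"

definition act :: "complex^2^2 \<Rightarrow> complex \<Rightarrow> complex" where
  "act A z = moebius (A$1$1) (A$1$2) (A$2$1) (A$2$2) z"

definition j_factor :: "complex^2^2 \<Rightarrow> complex \<Rightarrow> complex" where
  "j_factor A z = A$2$1 * z + A$2$2"

text \<open>Only even weights are used, so \<open>k div 2\<close> is the exact exponent \<open>k / 2\<close>.\<close>

definition slash :: "nat \<Rightarrow> (complex \<Rightarrow> complex) \<Rightarrow> complex^2^2 \<Rightarrow> complex \<Rightarrow> complex" where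
  "slash k f A z = det A ^ (k div 2) * f (act A z) / j_factor A z ^ k"

section \<open>Fuchsian groups\<close>

definition SL2R :: "(real^2^2) monoid" where
  "SL2R = \<lparr>carrier = {A. det A = 1}, mult = (**), one = mat 1\<rparr>"

definition finitely_generated :: "(real^2^2) set \<Rightarrow> bool" where
  "finitely_generated \<Gamma> \<longleftrightarrow> (\<exists>S. finite S \<and> S \<subseteq> \<Gamma> \<and> generate SL2R S = \<Gamma>)"

text \<open>
  The stabiliser of infinity is the full group of matrices \<open>\<plusminus>(1 b; 0 1)\<close> with integral \<open>b\<close>.
  In particular \<open>-I\<close> belongs to \<open>\<Gamma>\<close>, so that sums over \<open>\<Gamma>\<close> (as opposed to its image
  in PSL(2,R)) count every Moebius transformation twice.
\<close>

definition cusp_width_one_at_infinity :: "(real^2^2) set \<Rightarrow> bool" where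
  "cusp_width_one_at_infinity \<Gamma> \<longleftrightarrow>
     {\<gamma> \<in> \<Gamma>. \<gamma>$2$1 = 0} = {s *\<^sub>R mat2 1 (of_int b) 0 1 | s (b::int). s \<in> {1, -1}}"

definition hyperbolic_measure :: "complex measure" where
  "hyperbolic_measure = density lborel (\<lambda>z. ennreal (indicator \<H> z / (Im z)\<^sup>2))"

text \<open>
  Translates of \<open>D\<close> cover the upper half-plane and overlap in null sets only (boundary
  identifications are allowed).  Integration over the quotient of \<open>\<H>\<close> by \<open>\<Gamma>\<close> is integration
  over any such \<open>D\<close>; invariant integrands give a value independent of \<open>D\<close>.
\<close>

definition fundamental_domain :: "(real^2^2) set \<Rightarrow> complex set \<Rightarrow> bool" where
  "fundamental_domain \<Gamma> D \<longleftrightarrow>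
     D \<in> sets borel \<and> D \<subseteq> \<H> \<and>
     (\<forall>z\<in>\<H>. \<exists>\<gamma>\<in>\<Gamma>. act (cmat \<gamma>) z \<in> D) \<and>
     (\<forall>\<gamma>\<in>\<Gamma> - {mat 1, - mat 1}. emeasure hyperbolic_measure {z \<in> D. act (cmat \<gamma>) z \<in> D} = 0)"

section \<open>Cusp forms and the Petersson inner product\<close>

text \<open>
  For \<open>A\<close> in SL(2,R), the point \<open>A \<infinity>\<close> is a cusp of \<open>\<Gamma>\<close> iff \<open>A (1 h; 0 1) A\<inverse> \<in> \<Gamma>\<close> for some
  \<open>h \<noteq> 0\<close> (a parabolic \<open>-A (1 h; 0 1) A\<inverse>\<close> has a square of this form).  Vanishing at that cusp
  means that \<open>f|A\<close> tends to 0 as the imaginary part tends to infinity, uniformly in the real part.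
\<close>

definition vanishes_at_cusps :: "(real^2^2) set \<Rightarrow> nat \<Rightarrow> (complex \<Rightarrow> complex) \<Rightarrow> bool" where
  "vanishes_at_cusps \<Gamma> k f \<longleftrightarrow>
     (\<forall>A. det A = 1 \<and> (\<exists>h. h \<noteq> 0 \<and> A ** mat2 1 h 0 1 ** matrix_inv A \<in> \<Gamma>) \<longrightarrow>
        (slash k f (cmat A) \<longlongrightarrow> 0) (filtercomap Im at_top))"

text \<open>
  Functions on the upper half-plane are represented by total functions vanishing outside of it,
  so that equality of functions is equality on the upper half-plane.
\<close>

definition cusp_forms :: "(real^2^2) set \<Rightarrow> nat \<Rightarrow> (complex \<Rightarrow> complex) set" where
  "cusp_forms \<Gamma> k = {f. f holomorphic_on \<H> \<and> (\<forall>z. z \<notin> \<H> \<longrightarrow> f z = 0) \<and>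
     (\<forall>\<gamma>\<in>\<Gamma>. \<forall>z\<in>\<H>. slash k f (cmat \<gamma>) z = f z) \<and> vanishes_at_cusps \<Gamma> k f}"

definition petersson ::
  "complex set \<Rightarrow> nat \<Rightarrow> (complex \<Rightarrow> complex) \<Rightarrow> (complex \<Rightarrow> complex) \<Rightarrow> complex" where
  "petersson D k f g =
     set_lebesgue_integral hyperbolic_measure D (\<lambda>z. f z * cnj (g z) * of_real (Im z ^ k))"

text \<open>
  Linear independence is implied by orthonormality.  Finiteness of \<open>F\<close> is not assumed; it is a
  consequence of finite dimension when \<open>V\<close> is a space of cusp forms.  Sums over \<open>F\<close> can be
  written as unordered sums \<open>\<Sum>\<^sub>\<infinity>\<close>, which agree with the ordinary ones for finite \<open>F\<close>.
\<close>

definition orthonormal_basis ::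
  "complex set \<Rightarrow> nat \<Rightarrow> (complex \<Rightarrow> complex) set \<Rightarrow> (complex \<Rightarrow> complex) set \<Rightarrow> bool" where
  "orthonormal_basis D k V F \<longleftrightarrow> F \<subseteq> V \<and>
     (\<forall>f\<in>F. \<forall>g\<in>F. petersson D k f g = (if f = g then 1 else 0)) \<and>
     (\<forall>g\<in>V. \<exists>T c. finite T \<and> T \<subseteq> F \<and> g = (\<lambda>z. \<Sum>f\<in>T. c f * f z))"

section \<open>Elliptic expansions and elliptic Poincare series\<close>

text \<open>\<open>sigma z0\<close> maps the unit disc onto the upper half-plane and 0 to \<open>z0\<close>; its determinant
  is \<open>1 / (2 i Im z0)\<close>.\<close>

definition sigma :: "complex \<Rightarrow> complex^2^2" where
  "sigma z0 = map_matrix (\<lambda>a. a / (2 * \<i> * of_real (Im z0))) (mat2 (- cnj z0) z0 (-1) 1)"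

definition elliptic_coeff :: "nat \<Rightarrow> complex \<Rightarrow> (complex \<Rightarrow> complex) \<Rightarrow> nat \<Rightarrow> complex" where
  "elliptic_coeff k z0 f =
     (THE c. \<forall>w\<in>ball 0 1. (\<lambda>m. c m * w ^ m) sums slash k f (sigma z0) w)"

text \<open>
  For \<open>\<gamma>\<close> in SL(2,R), with \<open>w = \<sigma>\<inverse> \<gamma> z\<close>, the summand of \<open>G_series\<close> is
  \<open>(2 i Im z0)^(k/2) * w^(m - l) * (|w|^2 / (|w|^2 - 1))^l / j(\<sigma>\<inverse> \<gamma>, z)^k\<close>; the form with
  \<open>Q_fun\<close> also makes sense for \<open>w = 0\<close> and \<open>m < l\<close>.
\<close>

definition Q_fun :: "nat \<Rightarrow> nat \<Rightarrow> complex \<Rightarrow> complex" where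
  "Q_fun m l w = w ^ m * (cnj w / (of_real ((cmod w)\<^sup>2) - 1)) ^ l"

definition G_series ::
  "(real^2^2) set \<Rightarrow> nat \<Rightarrow> complex \<Rightarrow> complex \<Rightarrow> nat \<Rightarrow> nat \<Rightarrow> complex" where
  "G_series \<Gamma> k z z0 m l =
     (\<Sum>\<^sub>\<infinity>\<gamma>\<in>\<Gamma>. slash k (Q_fun m l) (matrix_inv (sigma z0) ** cmat \<gamma>) z)"

lemma matrix_inv_sigma:
  assumes "z0 \<in> \<H>"
  shows "matrix_inv (sigma z0) = mat2 1 (- z0) 1 (- cnj z0)"
proof -
  define d where "d = 2 * \<i> * complex_of_real (Im z0)"
  have d: "d \<noteq> 0" "z0 - cnj z0 = d"
    using assms by (auto simp: d_def complex_eq_iff)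
  have "z0 = d + cnj z0" using d by (simp add: algebra_simps)
  have e: "z0 / d = cnj z0 / d + 1"
    using d by (simp add: field_simps)
  have r: "sigma z0 ** mat2 1 (- z0) 1 (- cnj z0) = mat 1"
    using d unfolding sigma_def d_def[symmetric]
    by (auto simp: vec_eq_iff matrix_matrix_mult_def sum_2 forall_2 mat_def map_matrix_def
        vector_2 e field_simps)
  then have l: "mat2 1 (- z0) 1 (- cnj z0) ** sigma z0 = mat 1"
    using matrix_left_right_inverse by blast
  have "\<exists>B. sigma z0 ** B = mat 1 \<and> B ** sigma z0 = mat 1"
    using r l by blast
  then have i: "matrix_inv (sigma z0) ** sigma z0 = mat 1"
    unfolding matrix_inv_def by (rule someI2_ex) simp
  have "matrix_inv (sigma z0) = matrix_inv (sigma z0) ** (sigma z0 ** mat2 1 (- z0) 1 (- cnj z0))"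
    by (simp add: r)
  also have "\<dots> = mat2 1 (- z0) 1 (- cnj z0)"
    by (simp only: matrix_mul_assoc i matrix_mul_lid)
  finally show ?thesis .
qed

end

theory Submission
  imports Defs
begin

text \<open>
  The holomorphic elliptic Poincare series \<open>P = \<Sum>\<^sub>\<gamma> (w\<^bsup>m\<^esup>)|\<sigma>\<^sub>u\<inverse>\<gamma>\<close> represents, up to a constant, the
  functional \<open>f \<mapsto> c\<^sub>u(f, m)\<close> with respect to the Petersson product: unfolding turns \<open>\<langle>f, P\<rangle>\<close> into
  an integral over the half-plane, which in the disc model picks out the \<open>m\<close>-th Taylor coefficient
  by orthogonality of the monomials.  Expanding \<open>P\<close> in an orthonormal basis, the left-hand side
  becomes a multiple of \<open>c\<^sub>v(P, n)\<close>, which is computed termwise, as each \<open>(w\<^bsup>m\<^esup>)|\<sigma>\<^sub>u\<inverse>\<gamma>\<sigma>\<^sub>v\<close> is an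
  explicit rational function.

  No reduction theory is needed.  The sum \<open>\<Sum>\<^sub>\<gamma> |(w\<^bsup>m\<^esup>)|\<sigma>\<^sub>u\<inverse>\<gamma>| y\<^bsup>k/2\<^esup>\<close> is bounded on the whole
  half-plane, which gives both the vanishing of \<open>P\<close> at all cusps and, together with finite covolume
  and the square integrability implied by \<open>\<langle>f, f\<rangle> = 1\<close>, the absolute convergence behind the
  unfolding.  Moreover only the finitely many basis elements that occur in \<open>P\<close> contribute, so that
  finite dimensionality is not used either.
\<close>

text \<open>Everything is controlled by \<open>sech2\<close>, which in the disc coordinate w centred
  at u is 1 - |w|^2. A summand of P has |(w^m)|\<sigma>^-1\<gamma>| y^(k/2) at most
  \<open>sech2\<close>^(k/2), hence at most \<open>sech2\<close>^2 when k \<ge> 4. As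
  \<open>sech2\<close>^2 has the finite integral 4 pi over the half-plane, its sum over a discrete
  group can be compared with an integral.

  The non-holomorphic factor of G has an elementary origin. Each map \<sigma>_u^-1 \<gamma>
  \<sigma>_v of the disc has the form w0 + a w / (1 - R a w), and the determinant relation forces R
  = cnj w0 / (|w0|^2 - 1). The n-th Taylor coefficient at 0 carries a^n, and a contains the square
  of an automorphy factor; this raises the weight from k to k + 2n.

  The constant is the inverse of \<langle>f, P\<rangle> / c_u(f, m) = 2 * 4 * 2^(-k) * pi * m!
  (k-2)! / (m+k-1)!. Here 2 counts \<gamma> and -\<gamma>, 4 is the normalisation of the hyperbolic
  measure on the disc, 2^(-k) comes from writing y in the disc coordinate, and the rest is pi times
  the Beta value B(m+1, k-1).\<close>

unbundle no fps_syntax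

section \<open>Change of variables under holomorphic maps of the plane\<close>

text \<open>Coordinates in which the real derivative of a holomorphic map is a matrix with a
  determinant. The Jacobian formula is applied in \<open>real^2\<close> and transported back to the
  complex plane.\<close>

definition to_complex :: "real^2 \<Rightarrow> complex" where
  "to_complex v = Complex (v $ 1) (v $ 2)"

definition from_complex :: "complex \<Rightarrow> real^2" where
  "from_complex z = vector [Re z, Im z]"

lemma to_from_complex [simp]: "to_complex (from_complex z) = z"
  by (simp add: to_complex_def from_complex_def)

lemma from_to_complex [simp]: "from_complex (to_complex v) = v"
  by (simp add: to_complex_def from_complex_def vec_eq_iff forall_2)

lemma bounded_linear_to_complex: "bounded_linear to_complex"
  by (auto simp: linear_conv_bounded_linear[symmetric] to_complex_def complex_eq_iff intro!: linearI)

lemma bounded_linear_from_complex: "bounded_linear from_complex"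
  by (auto simp: linear_conv_bounded_linear[symmetric] from_complex_def vec_eq_iff forall_2 intro!: linearI)

lemma to_complex_measurable [measurable]: "to_complex \<in> borel_measurable borel"
  using bounded_linear_to_complex by (intro borel_measurable_continuous_onI linear_continuous_on)

lemma lborel_complex_eq: "lborel = distr lborel borel to_complex"
proof (rule lborel_eqI)
  fix l u :: complex assume le: "\<And>b. b \<in> Basis \<Longrightarrow> l \<bullet> b \<le> u \<bullet> b"
  have "to_complex -` box l u = box (from_complex l) (from_complex u)"
    by (auto simp: to_complex_def from_complex_def box_def Basis_complex_def Basis_vec_def
        inner_axis forall_2 inner_complex_def vector_2)
  moreover have "Re l \<le> Re u" "Im l \<le> Im u"
    using le[of 1] le[of \<i>] by (auto simp: Basis_complex_def inner_complex_def)
  moreover have "(\<Prod>b\<in>Basis. (from_complex u - from_complex l) \<bullet> b) = (\<Prod>i\<in>UNIV. (from_complex u - from_complex l) $ i)"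
    unfolding Basis_vec_def
    by (subst UNION_singleton_eq_range | simp add: image_image)+
       (subst prod.reindex, auto simp: inj_on_def axis_eq_axis inner_axis)
  ultimately show "emeasure (distr lborel borel to_complex) (box l u) = (\<Prod>b\<in>Basis. (u - l) \<bullet> b)"
    by (auto simp: emeasure_distr emeasure_lborel_box_eq Basis_vec_def forall_2 inner_axis from_complex_def
       vector_2 UNIV_2 prod_2 Basis_complex_def inner_complex_def)
qed simp

lemma det_complex_mult:
  "det (matrix (\<lambda>v. from_complex (c * to_complex v))) = (cmod c)\<^sup>2"
  by (simp add: det_2 matrix_def from_complex_def to_complex_def axis_def cmod_power2)
    (simp add: power2_eq_square)

lemma has_derivative_conj_complex:
  assumes "(g has_field_derivative d) (at (to_complex v))"
  shows "((\<lambda>v. from_complex (g (to_complex v))) has_derivative (\<lambda>v. from_complex (d * to_complex v))) (at v)"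
proof -
  have "((\<lambda>v. g (to_complex v)) has_derivative (\<lambda>h. d * to_complex h)) (at v)"
    using has_derivative_compose[OF bounded_linear_imp_has_derivative[OF bounded_linear_to_complex]
      has_field_derivative_imp_has_derivative[OF assms]] by simp
  from bounded_linear.has_derivative[OF bounded_linear_from_complex this]
  show ?thesis .
qed

text \<open>By the Cauchy-Riemann equations the real derivative of g is multiplication by g', which
  has determinant |g'|^2. The value infinity is allowed on both sides, whereas the equivalence
  \<open>main\<close> compares finite values; hence the case distinction.\<close>

lemma emeasure_holomorphic_image:
  fixes g :: "complex \<Rightarrow> complex"
  assumes S: "S \<in> sets borel" and gS: "g ` S \<in> sets borel" and inj: "inj_on g S"
    and g': "\<And>z. z \<in> S \<Longrightarrow> (g has_field_derivative g' z) (at z)"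
    and [measurable]: "g' \<in> borel_measurable borel"
  shows "emeasure lborel (g ` S) = (\<integral>\<^sup>+z. ennreal ((cmod (g' z))\<^sup>2) * indicator S z \<partial>lborel)"
proof -
  define G where "G = (\<lambda>v. from_complex (g (to_complex v)))"
  define T where "T = to_complex -` S"
  define h where "h = (\<lambda>v. (cmod (g' (to_complex v)))\<^sup>2)"
  have [measurable]: "h \<in> borel_measurable borel" by (simp add: h_def)
  have T: "T \<in> sets borel"
    using S measurable_sets[OF to_complex_measurable S] by (simp add: T_def)
  have img: "to_complex -` (g ` S) = G ` T"
  proof (intro equalityI subsetI)
    fix v assume "v \<in> to_complex -` (g ` S)"
    then obtain z where "z \<in> S" "to_complex v = g z" by auto
    then have "v = G (from_complex z)" "from_complex z \<in> T"
      unfolding G_def T_def by (metis from_to_complex to_from_complex, simp)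
    then show "v \<in> G ` T" by blast
  qed (auto simp: G_def T_def)
  have GT: "G ` T \<in> sets borel"
    using measurable_sets[OF to_complex_measurable gS] by (simp add: img)
  have 1: "inj_on G T"
    using inj by (auto simp: inj_on_def G_def T_def) (metis from_to_complex to_from_complex)
  have main: "G ` T \<in> lmeasurable \<and> measure lebesgue (G ` T) = m \<longleftrightarrow> (h has_integral m) T" for m
    using has_measure_differentiable_image[of T G "\<lambda>x v. from_complex (g' (to_complex x) * to_complex v)" m]
      T 1 has_derivative_at_withinI[OF has_derivative_conj_complex[OF g']]
    by (auto simp: det_complex_mult h_def G_def T_def)
  have lhs: "emeasure lborel (g ` S) = emeasure lborel (G ` T)"
    by (subst lborel_complex_eq) (simp add: emeasure_distr gS img)
  have "(\<integral>\<^sup>+z. ennreal ((cmod (g' z))\<^sup>2) * indicator S z \<partial>lborel)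
      = (\<integral>\<^sup>+v. ennreal ((cmod (g' (to_complex v)))\<^sup>2) * indicator S (to_complex v) \<partial>lborel)"
    by (subst lborel_complex_eq, subst nn_integral_distr) (use S in auto)
  also have "\<dots> = (\<integral>\<^sup>+v. ennreal (h v) * indicator T v \<partial>lborel)"
    by (simp add: h_def T_def indicator_def)
  also have "\<dots> = emeasure lborel (G ` T)"
  proof (cases "(\<integral>\<^sup>+v. ennreal (h v) * indicator T v \<partial>lborel) < \<infinity>")
    case True
    define m where "m = enn2real (\<integral>\<^sup>+v. ennreal (h v) * indicator T v \<partial>lborel)"
    have m: "(\<integral>\<^sup>+v. ennreal (h v * indicator T v) \<partial>lborel) = ennreal m"
      using True by (simp add: m_def ennreal_mult' ennreal_indicator h_def flip: ennreal_indicator)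
    have "((\<lambda>v. h v * indicator T v) has_integral m) UNIV"
      by (rule nn_integral_has_integral) (use m T in \<open>auto simp: h_def m_def\<close>)
    then have "(h has_integral m) T"
      by (subst has_integral_restrict_UNIV[symmetric])
        (erule has_integral_eq[rotated], auto simp: indicator_def)
    with main have "G ` T \<in> lmeasurable" "measure lebesgue (G ` T) = m" by auto
    then have "emeasure lebesgue (G ` T) = ennreal m"
      by (metis emeasure_eq_measure2)
    then show ?thesis using m GT by (simp add: ennreal_mult' ennreal_indicator h_def flip: ennreal_indicator)
  next
    case False
    \<comment> \<open>A finite measure would make h integrable over T by the other direction of
      \<open>main\<close>, against the assumption of this case.\<close>
    have "emeasure lborel (G ` T) = \<infinity>"
    proof (rule ccontr)
      assume "emeasure lborel (G ` T) \<noteq> \<infinity>"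
      then have "G ` T \<in> lmeasurable"
        using GT by (auto simp: fmeasurable_def less_top)
      with main have "(h has_integral measure lebesgue (G ` T)) T" by blast
      from nn_integral_has_integral_lebesgue[OF _ this]
      have "(\<integral>\<^sup>+v. ennreal (h v * indicator T v) \<partial>lborel) = ennreal (measure lebesgue (G ` T))"
        using T by (simp add: h_def nn_integral_completion mult.commute)
      with False show False by (simp add: ennreal_mult' ennreal_indicator h_def flip: ennreal_indicator)
    qed
    with False show ?thesis by (metis infinity_ennreal_def top.not_eq_extremum)
  qed
  finally show ?thesis using lhs by simp
qed

text \<open>Common source of three invariance statements: for isometries of the half-plane, for
  \<open>sigma\<close> from the disc to the half-plane, and for rotations. In each case it only
  remains to recognise the source density as |g'|^2 times the pullback of
  \<open>\<rho>\<close>.\<close>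

lemma distr_holomorphic:
  fixes g g' h :: "complex \<Rightarrow> complex" and \<rho> :: "complex \<Rightarrow> ennreal"
  assumes S: "S \<in> sets borel" and T: "T \<in> sets borel"
    and gS: "\<And>z. z \<in> S \<Longrightarrow> g z \<in> T" and hT: "\<And>z. z \<in> T \<Longrightarrow> h z \<in> S"
    and hg: "\<And>z. z \<in> S \<Longrightarrow> h (g z) = z" and gh: "\<And>z. z \<in> T \<Longrightarrow> g (h z) = z"
    and g': "\<And>z. z \<in> S \<Longrightarrow> (g has_field_derivative g' z) (at z)"
    and [measurable]: "g' \<in> borel_measurable borel" "g \<in> borel_measurable borel" "\<rho> \<in> borel_measurable borel"
  shows "distr (density lborel (\<lambda>z. indicator S z * (ennreal ((cmod (g' z))\<^sup>2) * \<rho> (g z)))) borel g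
     = density lborel (\<lambda>z. indicator T z * \<rho> z)"
proof -
  note [measurable] = S T
  have eq: "distr (density lborel (\<lambda>z. indicator S z * ennreal ((cmod (g' z))\<^sup>2))) borel g
     = density lborel (indicator T)"
  proof (rule measure_eqI)
    fix X assume "X \<in> sets (distr (density lborel (\<lambda>z. indicator S z * ennreal ((cmod (g' z))\<^sup>2))) borel g)"
    then have X [measurable]: "X \<in> sets borel" by simp
    define S' where "S' = S \<inter> g -` X"
    have S' [measurable]: "S' \<in> sets borel"
      using measurable_sets[OF \<open>g \<in> borel_measurable borel\<close> X] S by (auto simp: S'_def)
    have img: "g ` S' = T \<inter> X"
    proof (intro equalityI subsetI)
      fix z assume "z \<in> T \<inter> X"
      then have "z = g (h z)" "h z \<in> S'" using hT gh by (auto simp: S'_def)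
      then show "z \<in> g ` S'" by blast
    qed (auto simp: S'_def gS)
    have inj: "inj_on g S'" using hg by (metis S'_def IntE inj_onI)
    have gS': "g ` S' \<in> sets borel" using T X by (simp add: img)
    have "emeasure lborel (T \<inter> X) = (\<integral>\<^sup>+z. ennreal ((cmod (g' z))\<^sup>2) * indicator S' z \<partial>lborel)"
      unfolding img[symmetric]
      by (rule emeasure_holomorphic_image[OF S' gS' inj]) (auto simp: S'_def intro: g')
    also have "\<dots> = (\<integral>\<^sup>+z. (indicator S z * ennreal ((cmod (g' z))\<^sup>2)) * indicator (g -` X) z \<partial>lborel)"
      by (intro nn_integral_cong) (auto simp: S'_def indicator_def)
    also have "\<dots> = emeasure (distr (density lborel (\<lambda>z. indicator S z * ennreal ((cmod (g' z))\<^sup>2))) borel g) X"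
      using measurable_sets[OF \<open>g \<in> borel_measurable borel\<close> X]
      by (simp add: emeasure_distr emeasure_density)
    finally have "emeasure (distr (density lborel (\<lambda>z. indicator S z * ennreal ((cmod (g' z))\<^sup>2))) borel g) X
       = emeasure lborel (T \<inter> X)" by simp
    also have "\<dots> = (\<integral>\<^sup>+z. indicator (T \<inter> X) z \<partial>lborel)"
      by (rule nn_integral_indicator[symmetric]) simp
    also have "\<dots> = (\<integral>\<^sup>+z. indicator T z * indicator X z \<partial>lborel)"
      by (simp add: indicator_inter_arith)
    also have "\<dots> = emeasure (density lborel (indicator T)) X"
      by (simp add: emeasure_density)
    finally show "emeasure (distr (density lborel (\<lambda>z. indicator S z * ennreal ((cmod (g' z))\<^sup>2))) borel g) X
       = emeasure (density lborel (indicator T)) X" .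
  qed simp
  have "density lborel (\<lambda>z. indicator T z * \<rho> z) = density (density lborel (indicator T)) \<rho>"
    by (simp add: density_density_eq)
  also have "\<dots> = distr (density (density lborel (\<lambda>z. indicator S z * ennreal ((cmod (g' z))\<^sup>2))) (\<lambda>z. \<rho> (g z))) borel g"
    by (subst eq[symmetric], subst density_distr) auto
  also have "density (density lborel (\<lambda>z. indicator S z * ennreal ((cmod (g' z))\<^sup>2))) (\<lambda>z. \<rho> (g z)) =
     density lborel (\<lambda>z. indicator S z * (ennreal ((cmod (g' z))\<^sup>2) * \<rho> (g z)))"
    by (subst density_density_eq) (auto simp: mult_ac)
  finally show ?thesis by simp
qed

section \<open>Moebius transformations and the hyperbolic measure\<close>

lemma j_factor_mult:
  assumes "j_factor B z \<noteq> 0"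
  shows "j_factor (A ** B) z = j_factor A (act B z) * j_factor B z"
  using assms by (simp add: j_factor_def act_def moebius_def matrix_matrix_mult_def sum_2 field_simps)

lemma act_mult:
  assumes "j_factor B z \<noteq> 0"
  shows "act (A ** B) z = act A (act B z)"
proof -
  define N where "N = A$1$1 * (B$1$1 * z + B$1$2) + A$1$2 * (B$2$1 * z + B$2$2)"
  have "act (A ** B) z = N / j_factor (A ** B) z"
    by (simp add: N_def j_factor_def act_def moebius_def matrix_matrix_mult_def sum_2 field_simps)
  moreover have "A$1$1 * act B z + A$1$2 = N / j_factor B z"
    using assms by (simp add: N_def j_factor_def act_def moebius_def field_simps)
  ultimately show ?thesis
    using assms by (simp add: j_factor_mult[OF assms]) (simp add: act_def[of A] moebius_def flip: j_factor_def)
qed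

lemma slash_mult:
  assumes "j_factor B z \<noteq> 0" "even k"
  shows "slash k f (A ** B) z = slash k (slash k f A) B z"
  using assms by (simp add: slash_def act_mult j_factor_mult det_mul power_mult_distrib)

lemma cmat_mult: "cmat (A ** B) = cmat A ** cmat B"
  by (simp add: vec_eq_iff map_matrix_def matrix_matrix_mult_def)

lemma cmat_one: "cmat (mat 1) = mat 1"
  by (simp add: vec_eq_iff map_matrix_def mat_def)

lemma det_cmat: "det (cmat A) = of_real (det A)"
  by (simp add: det_2 map_matrix_def)

lemma j_factor_cmat: "j_factor (cmat A) z = of_real (A$2$1) * z + of_real (A$2$2)"
  by (simp add: j_factor_def map_matrix_def)

lemma act_cmat: "act (cmat A) z = (of_real (A$1$1) * z + of_real (A$1$2)) / j_factor (cmat A) z"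
  by (simp add: act_def moebius_def j_factor_def map_matrix_def)

lemma act_uminus: "act (- A) z = act A z"
proof -
  have "act (- A) z = (- (A$1$1 * z + A$1$2)) / (- (A$2$1 * z + A$2$2))"
    by (simp add: act_def moebius_def)
  also have "\<dots> = (A$1$1 * z + A$1$2) / (A$2$1 * z + A$2$2)"
    by (rule minus_divide_divide)
  finally show ?thesis by (simp add: act_def moebius_def)
qed

lemma cmat_uminus: "cmat (- A) = - cmat A"
  by (simp add: vec_eq_iff map_matrix_def)

lemma act_one: "act (mat 1) z = z"
  by (simp add: act_def moebius_def mat_def)

lemma j_factor_one: "j_factor (mat 1) z = 1"
  by (simp add: j_factor_def mat_def)

lemma j_factor_nz:
  assumes "det A = 1" "z \<in> \<H>"
  shows "j_factor (cmat A) z \<noteq> 0"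
proof
  assume "j_factor (cmat A) z = 0"
  then have "A$2$1 * Im z = 0" "A$2$1 * Re z + A$2$2 = 0"
    by (auto simp: j_factor_cmat complex_eq_iff)
  with assms show False by (auto simp: det_2)
qed

text \<open>Polarised transformation law of the imaginary part: u = z yields \<open>Im_act\<close>,
  and general u yields the invariance of \<open>sech2\<close>.\<close>

lemma act_diff_cnj:
  assumes "det A = 1" "z \<in> \<H>" "u \<in> \<H>"
  shows "act (cmat A) z - cnj (act (cmat A) u) =
    (z - cnj u) / (j_factor (cmat A) z * cnj (j_factor (cmat A) u))"
proof -
  define a b c d where "a = complex_of_real (A$1$1)" "b = complex_of_real (A$1$2)"
    "c = complex_of_real (A$2$1)" "d = complex_of_real (A$2$2)"
  note abcd = this
  have "a * d - b * c = of_real (det A)" by (simp add: abcd det_2)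
  then have det: "a * d = 1 + b * c" using assms by (simp add: algebra_simps)
  have nz: "c * z + d \<noteq> 0" "c * cnj u + d \<noteq> 0"
    using j_factor_nz[OF assms(1,2)] j_factor_nz[OF assms(1,3)]
     complex_cnj_zero_iff[of "c * u + d"]
    by (auto simp: j_factor_cmat abcd simp del: complex_cnj_zero_iff)
  have "act (cmat A) z - cnj (act (cmat A) u) = (a * z + b) / (c * z + d) - (a * cnj u + b) / (c * cnj u + d)"
    by (simp add: act_cmat j_factor_cmat abcd)
  also have "\<dots> = ((a * z + b) * (c * cnj u + d) - (a * cnj u + b) * (c * z + d)) / ((c * z + d) * (c * cnj u + d))"
    using nz by (simp add: diff_frac_eq)
  also have "(a * z + b) * (c * cnj u + d) - (a * cnj u + b) * (c * z + d) = (a * d - b * c) * (z - cnj u)"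
    by (simp add: algebra_simps)
  finally show ?thesis using det by (simp add: j_factor_cmat abcd)
qed

lemma Im_act:
  assumes "det A = 1" "z \<in> \<H>"
  shows "Im (act (cmat A) z) = Im z / (cmod (j_factor (cmat A) z))\<^sup>2"
proof -
  have "complex_of_real (2 * Im (act (cmat A) z)) * \<i> = of_real (2 * Im z) * \<i> / (of_real (cmod (j_factor (cmat A) z)))\<^sup>2"
    using act_diff_cnj[OF assms assms(2)] unfolding complex_diff_cnj complex_norm_square[symmetric] by simp
  then have "2 * \<i> * complex_of_real (Im (act (cmat A) z)) = 2 * \<i> * of_real (Im z / (cmod (j_factor (cmat A) z))\<^sup>2)"
    by (simp add: mult_ac)
  then have "complex_of_real (Im (act (cmat A) z)) = of_real (Im z / (cmod (j_factor (cmat A) z))\<^sup>2)"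
    by (subst (asm) mult_left_cancel) auto
  then show ?thesis using of_real_eq_iff by blast
qed

lemma act_in_H:
  assumes "det A = 1" "z \<in> \<H>"
  shows "act (cmat A) z \<in> \<H>"
  using assms by (simp add: Im_act j_factor_nz)

lemma act_cmat_mult:
  assumes "det B = 1" "z \<in> \<H>"
  shows "act (cmat (A ** B)) z = act (cmat A) (act (cmat B) z)"
  using assms by (simp add: cmat_mult act_mult j_factor_nz)

lemma group_SL2R: "group SL2R"
proof (rule groupI)
  fix A assume "A \<in> carrier SL2R"
  then have "det A = 1" by (simp add: SL2R_def)
  then have "invertible A" by (simp add: invertible_det_nz)
  then obtain B where B: "A ** B = mat 1" "B ** A = mat 1" by (auto simp: invertible_def)
  have "det (B ** A) = 1" by (simp add: B)
  then have "det B = 1" using \<open>det A = 1\<close> by (simp add: det_mul)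
  then show "\<exists>B\<in>carrier SL2R. B \<otimes>\<^bsub>SL2R\<^esub> A = \<one>\<^bsub>SL2R\<^esub>"
    using B by (auto simp: SL2R_def)
qed (auto simp: SL2R_def det_mul matrix_mul_assoc)

section \<open>The invariant \<open>sech2\<close> and its variation over small balls\<close>

text \<open>\<open>sech\<^sup>2 (d(z, u) / 2)\<close>, where \<open>d\<close> is the hyperbolic distance.\<close>

definition sech2 :: "complex \<Rightarrow> complex \<Rightarrow> real" where
  "sech2 z u = 4 * Im z * Im u / (cmod (z - cnj u))\<^sup>2"

lemma sech2_sym: "sech2 z u = sech2 u z"
proof -
  have "cmod (z - cnj u) = cmod (cnj (z - cnj u))" by (rule complex_mod_cnj[symmetric])
  also have "\<dots> = cmod (u - cnj z)" by (simp add: norm_minus_commute)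
  finally show ?thesis by (simp add: sech2_def)
qed

lemma diff_cnj_nz:
  assumes "z \<in> \<H>" "u \<in> \<H>" shows "z - cnj u \<noteq> 0"
  using assms by (auto simp: complex_eq_iff)

lemma sech2_pos: assumes "z \<in> \<H>" "u \<in> \<H>" shows "0 < sech2 z u"
  using assms diff_cnj_nz[OF assms] by (auto simp: sech2_def intro!: divide_pos_pos)

text \<open>The quotient is the disc coordinate of z centred at u, and |z - cnj u|^2 exceeds |z -
  u|^2 by 4 Im z Im u.\<close>

lemma sech2_eq: assumes "z \<in> \<H>" "u \<in> \<H>"
  shows "sech2 z u = 1 - (cmod ((z - u) / (z - cnj u)))\<^sup>2"
proof -
  have "(cmod (z - cnj u))\<^sup>2 = (cmod (z - u))\<^sup>2 + 4 * Im z * Im u"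
    unfolding cmod_power2 by (simp add: power2_eq_square algebra_simps)
  moreover have "(cmod (z - cnj u))\<^sup>2 \<noteq> 0" using diff_cnj_nz[OF assms] by simp
  ultimately show ?thesis by (simp add: sech2_def norm_divide power_divide field_simps)
qed

lemma sech2_le1: assumes "z \<in> \<H>" "u \<in> \<H>" shows "sech2 z u \<le> 1"
  by (simp add: sech2_eq[OF assms])

lemma sech2_act:
  assumes "det A = 1" "z \<in> \<H>" "u \<in> \<H>"
  shows "sech2 (act (cmat A) z) (act (cmat A) u) = sech2 z u"
  using assms j_factor_nz[OF assms(1,2)] j_factor_nz[OF assms(1,3)]
  by (simp add: sech2_def act_diff_cnj Im_act norm_divide norm_mult power_divide power_mult_distrib)

text \<open>Of the factor 8, a 2 comes from Im u \<le> 2 Im v and a 4 from |z - cnj v| \<le> 2 |z -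
  cnj u|. The latter holds because |z - cnj u| is at least Im u, while v is within Im u / 2 of
  u.\<close>

lemma sech2_harnack:
  assumes "z \<in> \<H>" "u \<in> \<H>" "v \<in> ball u (Im u / 2)"
  shows "v \<in> \<H>" "sech2 z u \<le> 8 * sech2 z v"
proof -
  have d: "cmod (u - v) < Im u / 2" using assms(3) by (simp add: dist_norm)
  have "\<bar>Im (u - v)\<bar> \<le> cmod (u - v)" by (rule abs_Im_le_cmod)
  with d have v: "Im v > Im u / 2" by simp
  then show vH: "v \<in> \<H>" using assms(2) by simp
  have "Im u \<le> \<bar>Im (z - cnj u)\<bar>" using assms by simp
  also have "\<dots> \<le> cmod (z - cnj u)" by (rule abs_Im_le_cmod)
  finally have 1: "Im u \<le> cmod (z - cnj u)" .
  have "cmod (z - cnj v) \<le> cmod (z - cnj u) + cmod (cnj (u - v))"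
    using norm_triangle_ineq[of "z - cnj u" "cnj (u - v)"] by simp
  also have "\<dots> \<le> 2 * cmod (z - cnj u)" using d 1 by (simp del: complex_cnj_diff) (use assms in simp)
  finally have "(cmod (z - cnj v))\<^sup>2 \<le> (2 * cmod (z - cnj u))\<^sup>2" by (intro power_mono) auto
  then have 2: "(cmod (z - cnj v))\<^sup>2 \<le> 4 * (cmod (z - cnj u))\<^sup>2" by (simp add: power_mult_distrib)
  have p: "0 < (cmod (z - cnj u))\<^sup>2" "0 < (cmod (z - cnj v))\<^sup>2"
    using diff_cnj_nz[OF assms(1,2)] diff_cnj_nz[OF assms(1) vH] by auto
  have "(4 * Im z * Im u) * (cmod (z - cnj v))\<^sup>2 \<le> (4 * Im z * Im u) * (4 * (cmod (z - cnj u))\<^sup>2)"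
    using 2 assms by (intro mult_left_mono) auto
  also have "\<dots> \<le> (8 * (4 * Im z * Im v)) * (cmod (z - cnj u))\<^sup>2"
    using v assms p by (auto intro!: mult_right_mono)
  finally show "sech2 z u \<le> 8 * sech2 z v"
    using p by (simp add: sech2_def field_simps)
qed

section \<open>Invariance of the hyperbolic measure under SL(2,R)\<close>

lemma act_has_derivative:
  assumes "det A = 1" "z \<in> \<H>"
  shows "(act (cmat A) has_field_derivative 1 / (j_factor (cmat A) z)\<^sup>2) (at z)"
proof -
  have nz: "complex_of_real (A$2$1) * z + of_real (A$2$2) \<noteq> 0"
    using j_factor_nz[OF assms] by (simp add: j_factor_cmat)
  have det: "complex_of_real (A$1$1) * of_real (A$2$2) = 1 + of_real (A$1$2) * of_real (A$2$1)"
  proof -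
    have "A$1$1 * A$2$2 = 1 + A$1$2 * A$2$1" using assms(1) by (simp add: det_2)
    then have "complex_of_real (A$1$1 * A$2$2) = of_real (1 + A$1$2 * A$2$1)" by (simp only:)
    then show ?thesis by (simp only: of_real_mult of_real_add of_real_1)
  qed
  have [abs_def]: "act (cmat A) z = (of_real (A$1$1) * z + of_real (A$1$2)) / (of_real (A$2$1) * z + of_real (A$2$2))" for z
    by (simp add: act_cmat j_factor_cmat)
  note this [simp]
  show ?thesis
    by (auto intro!: derivative_eq_intros simp: nz j_factor_cmat power2_eq_square)
       (simp add: algebra_simps det)
qed

lemma act_measurable [measurable]: "act A \<in> borel_measurable borel"
  unfolding act_def[abs_def] moebius_def by measurable

lemma j_factor_measurable [measurable]: "j_factor A \<in> borel_measurable borel"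
  unfolding j_factor_def[abs_def] by measurable

lemma H_measurable [measurable]: "\<H> \<in> sets borel"
  using open_halfspace_Im_gt[of 0] by simp

lemma sets_hyperbolic_measure [simp, measurable_cong]: "sets hyperbolic_measure = sets borel"
  by (simp add: hyperbolic_measure_def)

lemma space_hyperbolic_measure [simp]: "space hyperbolic_measure = UNIV"
  by (simp add: hyperbolic_measure_def)

lemma hyperbolic_measure_eq:
  "hyperbolic_measure = density lborel (\<lambda>z. indicator \<H> z * ennreal (1 / (Im z)\<^sup>2))"
  unfolding hyperbolic_measure_def by (intro density_cong AE_I2) (auto simp: indicator_def)

lemma AE_hyperbolic_H: "AE z in hyperbolic_measure. z \<in> \<H>"
  by (subst hyperbolic_measure_eq, subst AE_density) (auto simp: indicator_def)

lemma inverse_SL2R: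
  assumes "det A = (1::real)"
  obtains B where "det B = 1" "A ** B = mat 1" "B ** A = mat 1"
proof -
  have "invertible A" using assms by (simp add: invertible_det_nz)
  then obtain B where B: "A ** B = mat 1" "B ** A = mat 1" by (auto simp: invertible_def)
  then have "det (B ** A) = 1" by simp
  then have "det B = 1" using assms by (simp add: det_mul)
  with B that show ?thesis by blast
qed

text \<open>The Jacobian is |j|^-4, and y^-2 picks up the factor |j|^4; the two cancel.\<close>

lemma distr_hyperbolic_act:
  assumes "det A = 1"
  shows "distr hyperbolic_measure borel (act (cmat A)) = hyperbolic_measure"
proof -
  obtain B where B: "det B = 1" "A ** B = mat 1" "B ** A = mat 1"
    using inverse_SL2R[OF assms] .
  have inv: "act (cmat A) (act (cmat B) z) = z" "act (cmat B) (act (cmat A) z) = z" if "z \<in> \<H>" for z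
    using that assms B(1) by (simp_all add: act_cmat_mult[symmetric] B cmat_one act_one)
  have "indicator \<H> z * ennreal (1 / (Im z)\<^sup>2) =
     indicator \<H> z * (ennreal ((cmod (1 / (j_factor (cmat A) z)\<^sup>2))\<^sup>2) * ennreal (1 / (Im (act (cmat A) z))\<^sup>2))" for z
    using j_factor_nz[OF assms, of z]
    by (auto simp: indicator_def Im_act assms norm_divide norm_power power_divide simp flip: ennreal_mult)
  then have "distr hyperbolic_measure borel (act (cmat A)) = distr (density lborel (\<lambda>z. indicator \<H> z *
     (ennreal ((cmod (1 / (j_factor (cmat A) z)\<^sup>2))\<^sup>2) * ennreal (1 / (Im (act (cmat A) z))\<^sup>2)))) borel (act (cmat A))"
    unfolding hyperbolic_measure_eq by (simp only:)
  also have "\<dots> = hyperbolic_measure"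
    unfolding hyperbolic_measure_eq
    by (rule distr_holomorphic[where h = "act (cmat B)"])
       (use assms B act_in_H inv act_has_derivative in auto)
  finally show ?thesis .
qed

section \<open>The disc model of the half-plane\<close>

definition disc_measure :: "complex measure" where
  "disc_measure = density lborel (\<lambda>w. indicator (ball 0 1) w * ennreal (4 / (1 - (cmod w)\<^sup>2)\<^sup>2))"

lemma sets_disc_measure [simp, measurable_cong]: "sets disc_measure = sets borel"
  by (simp add: disc_measure_def)

lemma det_matrix_inv_sigma:
  assumes "z0 \<in> \<H>" shows "det (matrix_inv (sigma z0)) = z0 - cnj z0"
  by (simp add: matrix_inv_sigma[OF assms] det_2)

lemma j_factor_matrix_inv_sigma:
  assumes "z0 \<in> \<H>" shows "j_factor (matrix_inv (sigma z0)) z = z - cnj z0"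
  by (simp add: matrix_inv_sigma[OF assms] j_factor_def)

lemma act_matrix_inv_sigma:
  assumes "z0 \<in> \<H>" shows "act (matrix_inv (sigma z0)) z = (z - z0) / (z - cnj z0)"
  by (simp add: matrix_inv_sigma[OF assms] act_def moebius_def)

lemma H_diff_cnj: "z0 \<in> \<H> \<Longrightarrow> z0 - cnj z0 \<noteq> 0"
  by (auto simp: complex_eq_iff)

lemma diff_cnj_eq: "z0 - cnj z0 = 2 * \<i> * of_real (Im z0)"
  by (simp add: complex_eq_iff)

lemma det_sigma:
  assumes "z0 \<in> \<H>" shows "det (sigma z0) = 1 / (z0 - cnj z0)"
  using assms by (simp add: sigma_def map_matrix_def det_2 diff_cnj_eq field_simps power2_eq_square)
    (simp add: complex_eq_iff)

lemma j_factor_sigma: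
  assumes "z0 \<in> \<H>" shows "j_factor (sigma z0) w = (1 - w) / (z0 - cnj z0)"
  using assms by (simp add: sigma_def map_matrix_def j_factor_def diff_cnj_eq field_simps)

lemma act_sigma:
  assumes "z0 \<in> \<H>" shows "act (sigma z0) w = (z0 - cnj z0 * w) / (1 - w)"
proof -
  define d where "d = 2 * \<i> * complex_of_real (Im z0)"
  have "d \<noteq> 0" using assms by (simp add: d_def)
  have "act (sigma z0) w = (- cnj z0 / d * w + z0 / d) / (- 1 / d * w + 1 / d)"
    by (simp add: act_def sigma_def map_matrix_def moebius_def d_def)
  also have "\<dots> = ((z0 - cnj z0 * w) / d) / ((1 - w) / d)"
    by (simp add: diff_divide_distrib)
  finally show ?thesis using \<open>d \<noteq> 0\<close> by simp
qed

lemma disc_ne1: "w \<in> ball 0 1 \<Longrightarrow> 1 - w \<noteq> (0::complex)"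
  by auto

lemma Im_act_sigma:
  assumes "z0 \<in> \<H>" "w \<in> ball 0 1"
  shows "Im (act (sigma z0) w) = Im z0 * (1 - (cmod w)\<^sup>2) / (cmod (1 - w))\<^sup>2"
proof -
  have "act (sigma z0) w = (z0 - cnj z0 * w) * cnj (1 - w) / of_real ((cmod (1 - w))\<^sup>2)"
    using disc_ne1[OF assms(2)] unfolding act_sigma[OF assms(1)]
    by (subst complex_div_cnj) simp
  also have "Im \<dots> = Im ((z0 - cnj z0 * w) * cnj (1 - w)) / (cmod (1 - w))\<^sup>2"
    by (rule Im_divide_of_real)
  also have "Im ((z0 - cnj z0 * w) * cnj (1 - w)) = Im z0 * (1 - (cmod w)\<^sup>2)"
    by (simp add: cmod_power2) (simp add: algebra_simps power2_eq_square)
  finally show ?thesis .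
qed

lemma act_sigma_in_H:
  assumes "z0 \<in> \<H>" "w \<in> ball 0 1" shows "act (sigma z0) w \<in> \<H>"
proof -
  have "(cmod w)\<^sup>2 < 1" using assms(2) by (simp add: power_less_one_iff abs_square_less_1)
  then show ?thesis using assms disc_ne1[OF assms(2)] by (simp add: Im_act_sigma)
qed

lemma act_inv_sigma_in_disc:
  assumes "z0 \<in> \<H>" "z \<in> \<H>" shows "act (matrix_inv (sigma z0)) z \<in> ball 0 1"
proof -
  have "(cmod (act (matrix_inv (sigma z0)) z))\<^sup>2 < 1"
    using sech2_pos[OF assms(2,1)] sech2_eq[OF assms(2,1)] by (simp add: act_matrix_inv_sigma[OF assms(1)])
  then show ?thesis by (simp add: abs_square_less_1)
qed

lemma sigma_inv1:
  assumes "z0 \<in> \<H>" "w \<in> ball 0 1"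
  shows "act (matrix_inv (sigma z0)) (act (sigma z0) w) = w"
proof -
  have nz: "1 - w \<noteq> 0" "z0 - cnj z0 \<noteq> 0" using assms disc_ne1 H_diff_cnj by auto
  have "act (sigma z0) w - z0 = (z0 - cnj z0) * w / (1 - w)"
    "act (sigma z0) w - cnj z0 = (z0 - cnj z0) / (1 - w)"
    using nz by (simp_all add: act_sigma[OF assms(1)] field_simps)
  then show ?thesis using nz by (simp add: act_matrix_inv_sigma[OF assms(1)])
qed

lemma sigma_inv2:
  assumes "z0 \<in> \<H>" "z \<in> \<H>"
  shows "act (sigma z0) (act (matrix_inv (sigma z0)) z) = z"
proof -
  have nz: "z - cnj z0 \<noteq> 0" "z0 - cnj z0 \<noteq> 0" using assms diff_cnj_nz by auto
  define w where "w = (z - z0) / (z - cnj z0)"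
  have "z0 - cnj z0 * w = (z0 - cnj z0) * z / (z - cnj z0)"
    "1 - w = (z0 - cnj z0) / (z - cnj z0)"
    using nz by (simp_all add: w_def field_simps)
  then have "(z0 - cnj z0 * w) / (1 - w) = z" using nz by simp
  then show ?thesis by (simp add: act_matrix_inv_sigma[OF assms(1)] act_sigma[OF assms(1)] w_def)
qed

lemma act_sigma_has_derivative:
  assumes "z0 \<in> \<H>" "w \<in> ball 0 1"
  shows "(act (sigma z0) has_field_derivative (z0 - cnj z0) / (1 - w)\<^sup>2) (at w)"
  unfolding act_sigma[OF assms(1), abs_def]
  using disc_ne1[OF assms(2)]
  by (auto intro!: derivative_eq_intros simp: power2_eq_square divide_simps) (simp add: algebra_simps)

text \<open>The 4 in the density of \<open>disc_measure\<close> is |z0 - cnj z0|^2 / (Im z0)^2. The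
  other factors of the Jacobian cancel against \<open>Im_act_sigma\<close>, so the same measure on
  the disc serves every centre z0.\<close>

lemma distr_disc_sigma:
  assumes "z0 \<in> \<H>"
  shows "distr disc_measure borel (act (sigma z0)) = hyperbolic_measure"
proof -
  have "indicator (ball 0 1) w * ennreal (4 / (1 - (cmod w)\<^sup>2)\<^sup>2) =
     indicator (ball 0 1) w * (ennreal ((cmod ((z0 - cnj z0) / (1 - w)\<^sup>2))\<^sup>2) * ennreal (1 / (Im (act (sigma z0) w))\<^sup>2))" for w
  proof (cases "w \<in> ball 0 1")
    case True
    then have "(cmod w)\<^sup>2 < 1" by (simp add: abs_square_less_1)
    then have "1 - (cmod w)\<^sup>2 \<noteq> 0" by simp
    have "cmod (z0 - cnj z0) = 2 * Im z0"
      using assms by (simp add: diff_cnj_eq norm_mult)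
    then have "4 / (1 - (cmod w)\<^sup>2)\<^sup>2 = (cmod ((z0 - cnj z0) / (1 - w)\<^sup>2))\<^sup>2 * (1 / (Im (act (sigma z0) w))\<^sup>2)"
      using assms disc_ne1[OF True]
      by (simp add: Im_act_sigma[OF assms True] norm_divide norm_power power_divide power_mult_distrib)
    then show ?thesis by (simp only: ennreal_mult[symmetric] zero_le_power2 zero_le_divide_1_iff)
  qed simp
  then have "distr disc_measure borel (act (sigma z0)) = distr (density lborel (\<lambda>w. indicator (ball 0 1) w *
     (ennreal ((cmod ((z0 - cnj z0) / (1 - w)\<^sup>2))\<^sup>2) * ennreal (1 / (Im (act (sigma z0) w))\<^sup>2)))) borel (act (sigma z0))"
    unfolding disc_measure_def by (simp only:)
  also have "\<dots> = hyperbolic_measure"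
    unfolding hyperbolic_measure_eq
    by (rule distr_holomorphic[where h = "act (matrix_inv (sigma z0))"])
       (use assms act_sigma_in_H act_inv_sigma_in_disc sigma_inv1 sigma_inv2 act_sigma_has_derivative in auto)
  finally show ?thesis .
qed

section \<open>Uniform bound for sums over a discrete group\<close>

text \<open>The inequality opposite to \<open>sech2_harnack\<close>, with the same factors 2 and 4.
  That one serves to average over a ball around u; this one gives a majorant for the summands that
  is uniform near a given point.\<close>

lemma sech2_harnack':
  assumes "z \<in> \<H>" "u \<in> \<H>" "v \<in> ball u (Im u / 2)"
  shows "sech2 z v \<le> 8 * sech2 z u"
proof -
  have d: "cmod (u - v) < Im u / 2" using assms(3) by (simp add: dist_norm)
  have "\<bar>Im (u - v)\<bar> \<le> cmod (u - v)" by (rule abs_Im_le_cmod)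
  with d have v: "Im v > Im u / 2" "Im v < 2 * Im u" by simp_all
  then have vH: "v \<in> \<H>" using assms(2) by simp
  have "Im v \<le> \<bar>Im (z - cnj v)\<bar>" using assms vH by simp
  also have "\<dots> \<le> cmod (z - cnj v)" by (rule abs_Im_le_cmod)
  finally have 1: "Im v \<le> cmod (z - cnj v)" .
  have "cmod (z - cnj u) \<le> cmod (z - cnj v) + cmod (cnj (v - u))"
    using norm_triangle_ineq[of "z - cnj v" "cnj (v - u)"] by simp
  also have "cmod (cnj (v - u)) = cmod (u - v)" by (metis complex_mod_cnj norm_minus_commute)
  finally have "cmod (z - cnj u) \<le> 2 * cmod (z - cnj v)" using d 1 v by linarith
  then have "(cmod (z - cnj u))\<^sup>2 \<le> (2 * cmod (z - cnj v))\<^sup>2" by (intro power_mono) auto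
  then have 2: "(cmod (z - cnj u))\<^sup>2 \<le> 4 * (cmod (z - cnj v))\<^sup>2" by (simp add: power_mult_distrib)
  have p: "0 < (cmod (z - cnj u))\<^sup>2" "0 < (cmod (z - cnj v))\<^sup>2"
    using diff_cnj_nz[OF assms(1,2)] diff_cnj_nz[OF assms(1) vH] by auto
  have "(4 * Im z * Im v) * (cmod (z - cnj u))\<^sup>2 \<le> (4 * Im z * Im v) * (4 * (cmod (z - cnj v))\<^sup>2)"
    using 2 assms vH by (intro mult_left_mono) auto
  also have "\<dots> \<le> (8 * (4 * Im z * Im u)) * (cmod (z - cnj v))\<^sup>2"
    using v assms p by (auto intro!: mult_right_mono)
  finally show "sech2 z v \<le> 8 * sech2 z u"
    using p by (simp add: sech2_def field_simps)
qed

text \<open>The inverse of a matrix of determinant 1. Its entries are those of A up to order and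
  sign, so bounds on entries carry over at once.\<close>

definition adj2 :: "real^2^2 \<Rightarrow> real^2^2" where
  "adj2 A = mat2 (A$2$2) (- A$1$2) (- A$2$1) (A$1$1)"

lemma adj2_mult: "det A = 1 \<Longrightarrow> adj2 A ** A = mat 1" "det A = 1 \<Longrightarrow> A ** adj2 A = mat 1"
  by (simp_all add: adj2_def vec_eq_iff matrix_matrix_mult_def sum_2 forall_2 mat_def det_2 algebra_simps)

lemma matrix_sub_ldistrib: "A ** (B - C) = A ** B - A ** (C :: real^2^2)"
  by (simp add: vec_eq_iff matrix_matrix_mult_def right_diff_distrib sum_subtractf)

lemma norm_matrix_le:
  fixes A :: "real^2^2"
  assumes "\<And>i j. \<bar>A$i$j\<bar> \<le> R"
  shows "norm A \<le> 4 * R"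
proof -
  have 1: "norm (A$i) \<le> 2 * R" for i
  proof -
    have "norm (A$i) \<le> (\<Sum>j\<in>UNIV. \<bar>A$i$j\<bar>)" by (rule norm_le_l1_cart)
    also have "\<dots> \<le> 2 * R" using assms[of i 1] assms[of i 2] by (simp add: sum_2)
    finally show ?thesis .
  qed
  have "norm A \<le> (\<Sum>i\<in>UNIV. norm (A$i))"
    unfolding norm_vec_def[of A] by (rule L2_set_le_sum) simp
  also have "\<dots> \<le> 4 * R" using 1[of 1] 1[of 2] by (simp add: sum_2)
  finally show ?thesis .
qed

lemma entry_le_norm: "\<bar>(A::real^2^2)$i$j\<bar> \<le> norm A"
proof -
  have "\<bar>A$i$j\<bar> \<le> norm (A$i)" by (rule component_le_norm_cart)
  also have "\<dots> \<le> norm A" by (rule Finite_Cartesian_Product.norm_nth_le)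
  finally show ?thesis .
qed

lemma ball_measurable [measurable]: "ball u r \<in> sets borel"
  by simp

lemma cnj_measurable [measurable]: "cnj \<in> borel_measurable borel"
  by (intro borel_measurable_continuous_onI continuous_intros)

lemma measurable_hyperbolic_eq [simp]: "measurable hyperbolic_measure M = measurable borel M"
  by (rule measurable_cong_sets) simp_all

lemma measurable_disc_eq [simp]: "measurable disc_measure M = measurable borel M"
  by (rule measurable_cong_sets) simp_all

lemma sech2_measurable [measurable]: "sech2 z \<in> borel_measurable borel"
  unfolding sech2_def by measurable

section \<open>The integral of the squared invariant, and volumes of balls\<close>

definition disc_area :: ennreal where
  "disc_area = 4 * emeasure lborel (ball (0::complex) 1)"

lemma disc_area_finite: "disc_area < \<infinity>"
  using emeasure_lborel_ball_finite[of "0::complex" 1]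
  by (simp add: disc_area_def ennreal_mult_less_top)

text \<open>In the disc centred at z the invariant is 1 - |w|^2, and its square cancels the
  denominator of the density. What remains is 4 times the area of the disc, whatever z is.\<close>

lemma nn_integral_sech2:
  assumes "z \<in> \<H>"
  shows "(\<integral>\<^sup>+v. ennreal ((sech2 z v)\<^sup>2) \<partial>hyperbolic_measure) = disc_area"
proof -
  have "(\<integral>\<^sup>+v. ennreal ((sech2 z v)\<^sup>2) \<partial>hyperbolic_measure) =
    (\<integral>\<^sup>+w. ennreal ((sech2 z (act (sigma z) w))\<^sup>2) \<partial>disc_measure)"
    by (subst distr_disc_sigma[OF assms, symmetric], subst nn_integral_distr) auto
  also have "\<dots> = (\<integral>\<^sup>+w. indicator (ball 0 1) w * ennreal (4 / (1 - (cmod w)\<^sup>2)\<^sup>2) * ennreal ((sech2 z (act (sigma z) w))\<^sup>2) \<partial>lborel)"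
    unfolding disc_measure_def by (rule nn_integral_density; measurable)
  also have "\<dots> = (\<integral>\<^sup>+w. 4 * indicator (ball (0::complex) 1) w \<partial>lborel)"
  proof (intro nn_integral_cong)
    fix w :: complex
    show "indicator (ball 0 1) w * ennreal (4 / (1 - (cmod w)\<^sup>2)\<^sup>2) * ennreal ((sech2 z (act (sigma z) w))\<^sup>2) =
      4 * indicator (ball 0 1) w"
    proof (cases "w \<in> ball 0 1")
      case True
      have "(cmod w)\<^sup>2 < 1" using True by (simp add: abs_square_less_1)
      then have nz: "1 - (cmod w)\<^sup>2 \<noteq> 0" by simp
      have "sech2 z (act (sigma z) w) = 1 - (cmod w)\<^sup>2"
        using sech2_eq[OF act_sigma_in_H[OF assms True] assms] sigma_inv1[OF assms True]
        by (simp add: sech2_sym[of z] act_matrix_inv_sigma[OF assms])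
      with True nz show ?thesis
        by (simp add: ennreal_mult[symmetric])
    qed simp
  qed
  also have "\<dots> = disc_area"
    by (subst nn_integral_cmult_indicator) (simp_all add: disc_area_def)
  finally show ?thesis .
qed

lemma hyperbolic_ball_pos:
  assumes "u \<in> \<H>"
  shows "0 < emeasure hyperbolic_measure (ball u (Im u / 2))"
proof -
  let ?B = "ball u (Im u / 2)"
  \<comment> \<open>On the ball Im z is at most 2 Im u, so the density is bounded below by
    c.\<close>
  define c where "c = 1 / (2 * Im u)\<^sup>2"
  have c: "c > 0" using assms by (simp add: c_def)
  have ge: "c \<le> 1 / (Im z)\<^sup>2 \<and> z \<in> \<H>" if "z \<in> ?B" for z
  proof -
    have "cmod (u - z) < Im u / 2" using that by (simp add: dist_norm)
    moreover have "\<bar>Im (u - z)\<bar> \<le> cmod (u - z)" by (rule abs_Im_le_cmod)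
    ultimately have "0 < Im z" "Im z \<le> 2 * Im u" by auto
    moreover from this have "(Im z)\<^sup>2 \<le> (2 * Im u)\<^sup>2" by (intro power_mono) auto
    ultimately show ?thesis unfolding c_def by (auto intro!: divide_left_mono)
  qed
  have "0 < ennreal c * emeasure lborel ?B"
    using assms c by (subst emeasure_ball) (auto simp: unit_ball_vol_2 ennreal_zero_less_mult_iff)
  also have "\<dots> = (\<integral>\<^sup>+z. ennreal c * indicator ?B z \<partial>lborel)"
    by (simp add: nn_integral_cmult_indicator)
  also have "\<dots> \<le> (\<integral>\<^sup>+z. indicator \<H> z * ennreal (1 / (Im z)\<^sup>2) * indicator ?B z \<partial>lborel)"
    using ge by (intro nn_integral_mono) (auto simp: indicator_def intro!: ennreal_leI)
  also have "\<dots> = emeasure hyperbolic_measure ?B"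
    unfolding hyperbolic_measure_eq by (subst emeasure_density) auto
  finally show ?thesis .
qed

section \<open>Discrete subgroups of SL(2,R) and overlaps of translates of a ball\<close>

locale fuchsian =
  fixes \<Gamma> :: "(real^2^2) set"
  assumes subgrp: "subgroup \<Gamma> SL2R" and discr: "discrete \<Gamma>"
begin

lemma det1: "\<gamma> \<in> \<Gamma> \<Longrightarrow> det \<gamma> = 1"
  using subgroup.subset[OF subgrp] by (auto simp: SL2R_def)

lemma one_mem: "mat 1 \<in> \<Gamma>"
  using subgroup.one_closed[OF subgrp] by (simp add: SL2R_def)

lemma mult_mem: "\<gamma> \<in> \<Gamma> \<Longrightarrow> \<delta> \<in> \<Gamma> \<Longrightarrow> \<gamma> ** \<delta> \<in> \<Gamma>"
  using subgroup.m_closed[OF subgrp] by (simp add: SL2R_def)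

lemma adj2_mem:
  assumes "\<gamma> \<in> \<Gamma>"
  shows "adj2 \<gamma> \<in> \<Gamma>"
proof -
  interpret S: group SL2R by (rule group_SL2R)
  define \<delta> where "\<delta> = inv\<^bsub>SL2R\<^esub> \<gamma>"
  have d: "\<delta> \<in> \<Gamma>" unfolding \<delta>_def using subgroup.m_inv_closed[OF subgrp assms] .
  have "\<gamma> \<in> carrier SL2R" using assms det1 by (simp add: SL2R_def)
  then have "\<gamma> ** \<delta> = mat 1"
    using S.r_inv[of \<gamma>] by (simp add: SL2R_def \<delta>_def)
  then have "adj2 \<gamma> = adj2 \<gamma> ** (\<gamma> ** \<delta>)" by simp
  also have "\<dots> = \<delta>" by (simp add: matrix_mul_assoc adj2_mult(1)[OF det1[OF assms]])
  finally show ?thesis using d by simp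
qed

lemma act_adj2:
  assumes "\<gamma> \<in> \<Gamma>" "z \<in> \<H>"
  shows "act (cmat (adj2 \<gamma>)) (act (cmat \<gamma>) z) = z" "act (cmat \<gamma>) (act (cmat (adj2 \<gamma>)) z) = z"
  using assms det1[OF assms(1)] det1[OF adj2_mem[OF assms(1)]]
  by (simp_all add: act_cmat_mult[symmetric] adj2_mult cmat_one act_one)

lemma bij_mult_right:
  assumes "\<delta> \<in> \<Gamma>"
  shows "bij_betw (\<lambda>\<gamma>. \<gamma> ** \<delta>) \<Gamma> \<Gamma>"
proof (rule bij_betw_byWitness[where f' = "\<lambda>\<gamma>. \<gamma> ** adj2 \<delta>"])
  show "\<forall>a\<in>\<Gamma>. a ** \<delta> ** adj2 \<delta> = a" "\<forall>a\<in>\<Gamma>. a ** adj2 \<delta> ** \<delta> = a"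
    using det1[OF assms] by (simp_all add: matrix_mul_assoc[symmetric] adj2_mult)
qed (use assms mult_mem adj2_mem in auto)

text \<open>Discreteness by itself only isolates each point; the group structure makes the gap
  uniform on bounded parts. If x and y are bounded and close, then x^-1 y - 1 = x^-1 (y - x) is
  small, so x^-1 y = 1 because the identity is isolated. A bounded, uniformly discrete set is
  finite.\<close>

lemma finite_bounded:
  fixes T :: "(real^2^2) set"
  assumes "\<And>\<gamma> i j. \<gamma> \<in> T \<Longrightarrow> \<bar>\<gamma>$i$j\<bar> \<le> R" "T \<subseteq> \<Gamma>"
  shows "finite T"
proof -
  obtain e where e: "e > 0" "\<And>\<gamma>. \<gamma> \<in> \<Gamma> \<Longrightarrow> dist (mat 1) \<gamma> < e \<Longrightarrow> \<gamma> = mat 1"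
    using discreteD[OF discr one_mem] by (auto simp: isolated_in_dist_Ex_iff)
  define R' where "R' = \<bar>R\<bar> + 1"
  have R: "R' > 0" "\<bar>\<gamma>$i$j\<bar> \<le> R'" if "\<gamma> \<in> T" for \<gamma> :: "real^2^2" and i j
    using assms(1)[OF that, of i j] by (auto simp: R'_def)
  have R0: "R' > 0" by (simp add: R'_def)
  \<comment> \<open>The 8 is the 4 of \<open>norm_matrix_le\<close> times the two summands in each
    entry of a matrix product.\<close>
  have "x = y" if xy: "x \<in> T" "y \<in> T" "dist x y < e / (8 * R')" for x y
  proof -
    have [simp]: "det x = 1" "det y = 1" using xy assms(2) det1 by auto
    have "adj2 x ** y - mat 1 = adj2 x ** (y - x)"
      by (simp add: matrix_sub_ldistrib adj2_mult)
    moreover have "norm (adj2 x ** (y - x)) \<le> 4 * (2 * R' * dist x y)"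
    proof (rule norm_matrix_le)
      fix i j
      have b: "\<bar>adj2 x $ i $ k\<bar> \<le> R'" for i k
        using R(2)[OF xy(1)] exhaust_2[of i] exhaust_2[of k] by (auto simp: adj2_def)
      have "\<bar>(adj2 x ** (y - x)) $ i $ j\<bar> = \<bar>\<Sum>k\<in>UNIV. adj2 x $ i $ k * (y - x) $ k $ j\<bar>"
        by (simp add: matrix_matrix_mult_def)
      also have "\<dots> \<le> (\<Sum>k\<in>(UNIV::2 set). R' * dist x y)"
      proof (rule order.trans[OF sum_abs], rule sum_mono)
        fix k
        have "\<bar>(y - x) $ k $ j\<bar> \<le> dist x y"
          using entry_le_norm[of "y - x" k j] by (simp only: dist_norm norm_minus_commute)
        then show "\<bar>adj2 x $ i $ k * (y - x) $ k $ j\<bar> \<le> R' * dist x y"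
          unfolding abs_mult using b R0 by (intro mult_mono) auto
      qed
      finally show "\<bar>(adj2 x ** (y - x)) $ i $ j\<bar> \<le> 2 * R' * dist x y" by simp
    qed
    moreover have "4 * (2 * R' * dist x y) < e"
      using xy(3) R0 by (simp add: field_simps)
    ultimately have "norm (adj2 x ** y - mat 1) < e" by simp
    then have "dist (mat 1) (adj2 x ** y) < e"
      by (simp only: dist_norm norm_minus_commute[of "mat 1"])
    moreover have "adj2 x ** y \<in> \<Gamma>" using xy assms(2) by (auto intro!: mult_mem adj2_mem)
    ultimately have "adj2 x ** y = mat 1" using e by blast
    then have "x ** (adj2 x ** y) = x" by simp
    then show "x = y" by (simp add: matrix_mul_assoc adj2_mult)
  qed
  moreover have "e / (8 * R') > 0" using e R0 by simp
  ultimately have "uniform_discrete T"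
    unfolding uniform_discrete_def by blast
  moreover have "bounded T"
    unfolding bounded_iff using norm_matrix_le[OF assms(1)] by blast
  ultimately show ?thesis using uniform_discrete_finite_iff by blast
qed

lemma countable_group: "countable \<Gamma>"
proof -
  have "\<Gamma> = (\<Union>n::nat. {\<gamma> \<in> \<Gamma>. norm \<gamma> \<le> real n})"
    using real_arch_simple by auto
  moreover have fin: "finite {\<gamma> \<in> \<Gamma>. norm \<gamma> \<le> real n}" for n
    by (rule finite_bounded[where R = "real n"]) (use entry_le_norm order.trans in \<open>blast+\<close>)
  then have "countable (\<Union>n::nat. {\<gamma> \<in> \<Gamma>. norm \<gamma> \<le> real n})"
    by (intro countable_UN countableI_type countable_finite)
  ultimately show ?thesis by (simp only:)
qed

text \<open>All entries of \<gamma> are bounded. Both v and \<gamma>v have imaginary part between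
  b/2 and 2b, so the automorphy factor J = c v + d has |J| < 2. Its imaginary part bounds c, and
  then J itself bounds d. The numerator \<gamma>v J is bounded as well and yields the other two
  entries in the same way.\<close>

lemma finite_overlap:
  assumes "u \<in> \<H>"
  shows "finite {\<gamma> \<in> \<Gamma>. \<exists>v \<in> ball u (Im u / 2). act (cmat \<gamma>) v \<in> ball u (Im u / 2)}"
proof -
  define b where "b = Im u"
  define M where "M = cmod u + b"
  have b: "b > 0" using assms by (simp add: b_def)
  have bnd: "b / 2 < Im v" "Im v < 2 * b" "cmod v \<le> M" if "v \<in> ball u (Im u / 2)" for v
  proof -
    have "cmod (u - v) < b / 2" using that by (simp add: dist_norm b_def)
    moreover have "\<bar>Im (u - v)\<bar> \<le> cmod (u - v)" by (rule abs_Im_le_cmod)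
    moreover have "cmod v \<le> cmod u + cmod (u - v)" by norm
    ultimately show "b / 2 < Im v" "Im v < 2 * b" "cmod v \<le> M" using b by (auto simp: b_def M_def)
  qed
  have M: "M > 0" using b by (simp add: M_def add_nonneg_pos)
  \<comment> \<open>The sum of the bounds obtained below for the entries c, d, a and b of \<gamma>,
    in this order.\<close>
  define R where "R = 4 / b + (2 + 4 / b * M) + 4 * M / b + (2 * M + 4 * M / b * M)"
  show ?thesis
  proof (rule finite_bounded[where R = R])
    fix \<gamma> :: "real^2^2" and i j :: 2
    assume "\<gamma> \<in> {\<gamma> \<in> \<Gamma>. \<exists>v \<in> ball u (Im u / 2). act (cmat \<gamma>) v \<in> ball u (Im u / 2)}"
    then obtain v where \<gamma>: "\<gamma> \<in> \<Gamma>" and v: "v \<in> ball u (Im u / 2)" "act (cmat \<gamma>) v \<in> ball u (Im u / 2)"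
      by auto
    define J where "J = j_factor (cmat \<gamma>) v"
    have vH: "v \<in> \<H>" using bnd(1)[OF v(1)] b by simp
    have J0: "J \<noteq> 0" unfolding J_def by (rule j_factor_nz[OF det1[OF \<gamma>] vH])
    have "Im (act (cmat \<gamma>) v) = Im v / (cmod J)\<^sup>2"
      unfolding J_def by (rule Im_act[OF det1[OF \<gamma>] vH])
    then have "b / 2 < Im v / (cmod J)\<^sup>2" using bnd(1)[OF v(2)] by simp
    then have "b / 2 * (cmod J)\<^sup>2 < 2 * b" using bnd(2)[OF v(1)] J0
      by (simp add: field_simps)
    then have "(cmod J)\<^sup>2 < 2\<^sup>2" using b by (simp add: field_simps)
    then have J: "cmod J < 2" by (rule power_less_imp_less_base) simp
    have Jeq: "J = of_real (\<gamma>$2$1) * v + of_real (\<gamma>$2$2)" by (simp add: J_def j_factor_cmat)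
    have "\<bar>\<gamma>$2$1\<bar> * Im v = \<bar>Im J\<bar>" using vH by (simp add: Jeq abs_mult)
    also have "\<dots> < 2" using abs_Im_le_cmod[of J] J by linarith
    finally have "\<bar>\<gamma>$2$1\<bar> * (b / 2) \<le> 2"
      using mult_left_mono[OF less_imp_le[OF bnd(1)[OF v(1)]], of "\<bar>\<gamma>$2$1\<bar>"] by simp
    then have c: "\<bar>\<gamma>$2$1\<bar> \<le> 4 / b" using b by (simp add: field_simps)
    have "\<bar>\<gamma>$2$2\<bar> = cmod (J - of_real (\<gamma>$2$1) * v)" by (simp add: Jeq)
    also have "\<dots> \<le> cmod J + \<bar>\<gamma>$2$1\<bar> * cmod v"
      by (rule order.trans[OF norm_triangle_ineq4]) (simp add: norm_mult)
    also have "\<dots> \<le> 2 + 4 / b * M"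
      using J c bnd(3)[OF v(1)] b by (intro add_mono mult_mono) auto
    finally have d: "\<bar>\<gamma>$2$2\<bar> \<le> 2 + 4 / b * M" .
    define N where "N = of_real (\<gamma>$1$1) * v + of_real (\<gamma>$1$2)"
    have "N = act (cmat \<gamma>) v * J" using J0 by (simp add: N_def act_cmat J_def)
    then have "cmod N \<le> M * 2" using J bnd(3)[OF v(2)] M by (auto simp: norm_mult intro!: mult_mono)
    have "\<bar>\<gamma>$1$1\<bar> * Im v = \<bar>Im N\<bar>" using vH by (simp add: N_def abs_mult)
    also have "\<dots> \<le> M * 2" using abs_Im_le_cmod[of N] \<open>cmod N \<le> M * 2\<close> by linarith
    finally have "\<bar>\<gamma>$1$1\<bar> * (b / 2) \<le> M * 2"
      using mult_left_mono[OF less_imp_le[OF bnd(1)[OF v(1)]], of "\<bar>\<gamma>$1$1\<bar>"] by simp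
    then have a: "\<bar>\<gamma>$1$1\<bar> \<le> 4 * M / b" using b by (simp add: field_simps)
    have "\<bar>\<gamma>$1$2\<bar> = cmod (N - of_real (\<gamma>$1$1) * v)" by (simp add: N_def)
    also have "\<dots> \<le> cmod N + \<bar>\<gamma>$1$1\<bar> * cmod v"
      by (rule order.trans[OF norm_triangle_ineq4]) (simp add: norm_mult)
    also have "\<dots> \<le> 2 * M + 4 * M / b * M"
      using \<open>cmod N \<le> M * 2\<close> a bnd(3)[OF v(1)] b M by (intro add_mono mult_mono) auto
    finally have b': "\<bar>\<gamma>$1$2\<bar> \<le> 2 * M + 4 * M / b * M" .
    have nn: "0 \<le> 4 / b" "0 \<le> 2 + 4 / b * M" "0 \<le> 4 * M / b" "0 \<le> 2 * M + 4 * M / b * M"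
      using b M by (auto intro!: add_nonneg_nonneg)
    have "\<bar>\<gamma>$1$1\<bar> \<le> R" "\<bar>\<gamma>$1$2\<bar> \<le> R" "\<bar>\<gamma>$2$1\<bar> \<le> R" "\<bar>\<gamma>$2$2\<bar> \<le> R"
      unfolding R_def using a b' c d nn by linarith+
    then show "\<bar>\<gamma>$i$j\<bar> \<le> R"
      using exhaust_2[of i] exhaust_2[of j] by auto
  qed auto
qed

text \<open>Fix some \<open>\<gamma>0\<close> in T that takes v into the ball. Right multiplication
  by its inverse injects the counted set into the finite set of \<open>finite_overlap\<close>, with
  the point \<open>\<gamma>0\<close> v of the ball as witness. The resulting bound is the same for
  all v and T.\<close>

lemma overlap_card:
  assumes "u \<in> \<H>"
  obtains N where "\<And>T v. finite T \<Longrightarrow> T \<subseteq> \<Gamma> \<Longrightarrow> v \<in> \<H> \<Longrightarrow> card {\<gamma> \<in> T. act (cmat \<gamma>) v \<in> ball u (Im u / 2)} \<le> N"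
proof
  let ?B = "ball u (Im u / 2)"
  let ?S = "{\<gamma> \<in> \<Gamma>. \<exists>v \<in> ?B. act (cmat \<gamma>) v \<in> ?B}"
  fix T v assume T: "finite T" "T \<subseteq> \<Gamma>" and v: "v \<in> \<H>"
  let ?X = "{\<gamma> \<in> T. act (cmat \<gamma>) v \<in> ?B}"
  show "card ?X \<le> card ?S"
  proof (cases "?X = {}")
    case False
    then obtain \<gamma>0 where g0: "\<gamma>0 \<in> T" "act (cmat \<gamma>0) v \<in> ?B" by auto
    have g0': "\<gamma>0 \<in> \<Gamma>" using g0 T by auto
    have "inj_on (\<lambda>\<gamma>. \<gamma> ** adj2 \<gamma>0) ?X"
      using bij_mult_right[OF adj2_mem[OF g0']] T(2) by (auto simp: bij_betw_def intro: inj_on_subset)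
    moreover have "(\<lambda>\<gamma>. \<gamma> ** adj2 \<gamma>0) ` ?X \<subseteq> ?S"
    proof (rule image_subsetI)
      fix \<gamma> assume "\<gamma> \<in> ?X"
      then have g: "\<gamma> \<in> T" "act (cmat \<gamma>) v \<in> ?B" by auto
      have "act (cmat (\<gamma> ** adj2 \<gamma>0)) (act (cmat \<gamma>0) v) = act (cmat \<gamma>) v"
        using act_in_H[OF det1[OF g0'] v] act_adj2[OF g0' v] det1[OF adj2_mem[OF g0']]
        by (simp add: act_cmat_mult)
      moreover have "\<gamma> ** adj2 \<gamma>0 \<in> \<Gamma>" using g g0' T mult_mem adj2_mem by auto
      ultimately show "\<gamma> ** adj2 \<gamma>0 \<in> ?S"
        using g g0(2) by (intro CollectI conjI bexI[of _ "act (cmat \<gamma>0) v"]) simp_all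
    qed
    ultimately show ?thesis
      using card_inj_on_le finite_overlap[OF assms] by blast
  next
    case True
    then show ?thesis by (simp only: card.empty)
  qed
qed

text \<open>
  Averaging over a ball around \<open>u\<close> and moving the integration variable by \<open>\<gamma>\<close> replaces the sum
  over \<open>\<Gamma>\<close> by finitely many copies of an integral that does not depend on \<open>z\<close>.
\<close>

lemma sech2_sum_bound:
  assumes u: "u \<in> \<H>"
  obtains C where "\<And>T z. finite T \<Longrightarrow> T \<subseteq> \<Gamma> \<Longrightarrow> z \<in> \<H> \<Longrightarrow> (\<Sum>\<gamma>\<in>T. (sech2 (act (cmat \<gamma>) z) u)\<^sup>2) \<le> C"
proof -
  let ?B = "ball u (Im u / 2)" and ?\<mu> = hyperbolic_measure
  obtain N where N: "\<And>T v. finite T \<Longrightarrow> T \<subseteq> \<Gamma> \<Longrightarrow> v \<in> \<H> \<Longrightarrow> card {\<gamma> \<in> T. act (cmat \<gamma>) v \<in> ?B} \<le> N"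
    using overlap_card[OF u] by blast
  \<comment> \<open>N bounds the overlaps, 64 = 8^2 comes from \<open>sech2_harnack\<close>, and
    \<open>disc_area\<close> is the integral of the squared invariant.\<close>
  define K where "K = of_nat N * (64 * disc_area)"
  have K: "K < \<infinity>" using disc_area_finite by (simp add: K_def ennreal_mult_less_top of_nat_less_top)
  have bound: "ennreal (\<Sum>\<gamma>\<in>T. (sech2 (act (cmat \<gamma>) z) u)\<^sup>2) * emeasure ?\<mu> ?B \<le> K"
    if T: "finite T" "T \<subseteq> \<Gamma>" and z: "z \<in> \<H>" for T z
  proof -
    have "ennreal ((sech2 (act (cmat \<gamma>) z) u)\<^sup>2) * emeasure ?\<mu> ?B \<le>
        (\<integral>\<^sup>+v. 64 * ennreal ((sech2 z v)\<^sup>2) * indicator ?B (act (cmat \<gamma>) v) \<partial>?\<mu>)" if g: "\<gamma> \<in> T" for \<gamma>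
    proof -
      have g': "\<gamma> \<in> \<Gamma>" "det \<gamma> = 1" using T g det1 by auto
      have gz: "act (cmat \<gamma>) z \<in> \<H>" by (rule act_in_H[OF g'(2) z])
      have "ennreal ((sech2 (act (cmat \<gamma>) z) u)\<^sup>2) * emeasure ?\<mu> ?B =
        (\<integral>\<^sup>+v. ennreal ((sech2 (act (cmat \<gamma>) z) u)\<^sup>2) * indicator ?B v \<partial>?\<mu>)"
        by (simp add: nn_integral_cmult_indicator)
      also have "\<dots> \<le> (\<integral>\<^sup>+v. 64 * ennreal ((sech2 (act (cmat \<gamma>) z) v)\<^sup>2) * indicator ?B v \<partial>?\<mu>)"
      proof (intro nn_integral_mono)
        fix v
        show "ennreal ((sech2 (act (cmat \<gamma>) z) u)\<^sup>2) * indicator ?B v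
          \<le> 64 * ennreal ((sech2 (act (cmat \<gamma>) z) v)\<^sup>2) * indicator ?B v"
        proof (cases "v \<in> ?B")
          case True
          have "(sech2 (act (cmat \<gamma>) z) u)\<^sup>2 \<le> (8 * sech2 (act (cmat \<gamma>) z) v)\<^sup>2"
            using sech2_harnack(2)[OF gz u True] sech2_pos[OF gz u] by (intro power_mono) auto
          then have "ennreal ((sech2 (act (cmat \<gamma>) z) u)\<^sup>2) \<le> ennreal (64 * (sech2 (act (cmat \<gamma>) z) v)\<^sup>2)"
            by (intro ennreal_leI) (simp add: power_mult_distrib)
          with True show ?thesis by (simp add: ennreal_mult)
        qed simp
      qed
      \<comment> \<open>Replacing v by \<gamma>v and using the invariance of \<open>sech2\<close>
        leaves \<gamma> in the indicator alone, where the sum over \<gamma> merely counts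
        overlaps.\<close>
      also have "\<dots> = (\<integral>\<^sup>+v. 64 * ennreal ((sech2 (act (cmat \<gamma>) z) (act (cmat \<gamma>) v))\<^sup>2) * indicator ?B (act (cmat \<gamma>) v) \<partial>?\<mu>)"
        by (subst (1) distr_hyperbolic_act[OF g'(2), symmetric], rule nn_integral_distr; measurable)
      also have "\<dots> = (\<integral>\<^sup>+v. 64 * ennreal ((sech2 z v)\<^sup>2) * indicator ?B (act (cmat \<gamma>) v) \<partial>?\<mu>)"
        using AE_hyperbolic_H by (intro nn_integral_cong_AE) (auto simp: sech2_act[OF g'(2) z])
      finally show ?thesis .
    qed
    then have "(\<Sum>\<gamma>\<in>T. ennreal ((sech2 (act (cmat \<gamma>) z) u)\<^sup>2) * emeasure ?\<mu> ?B) \<le>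
      (\<Sum>\<gamma>\<in>T. \<integral>\<^sup>+v. 64 * ennreal ((sech2 z v)\<^sup>2) * indicator ?B (act (cmat \<gamma>) v) \<partial>?\<mu>)"
      by (rule sum_mono)
    also have "\<dots> = (\<integral>\<^sup>+v. (\<Sum>\<gamma>\<in>T. 64 * ennreal ((sech2 z v)\<^sup>2) * indicator ?B (act (cmat \<gamma>) v)) \<partial>?\<mu>)"
      by (rule nn_integral_sum[symmetric]) measurable
    also have "\<dots> \<le> (\<integral>\<^sup>+v. (of_nat N * 64) * ennreal ((sech2 z v)\<^sup>2) \<partial>?\<mu>)"
    proof (intro nn_integral_mono_AE, use AE_hyperbolic_H in eventually_elim)
      fix v :: complex assume v: "v \<in> \<H>"
      have "(\<Sum>\<gamma>\<in>T. indicator ?B (act (cmat \<gamma>) v)) = (of_nat (card {\<gamma> \<in> T. act (cmat \<gamma>) v \<in> ?B}) :: ennreal)"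
        using T(1) by (simp add: indicator_def sum.If_cases Int_def)
      also have "\<dots> \<le> of_nat N" using N[OF T v] by simp
      finally have "(64 * ennreal ((sech2 z v)\<^sup>2)) * (\<Sum>\<gamma>\<in>T. indicator ?B (act (cmat \<gamma>) v)) \<le> (64 * ennreal ((sech2 z v)\<^sup>2)) * of_nat N"
        by (intro mult_left_mono) auto
      then show "(\<Sum>\<gamma>\<in>T. 64 * ennreal ((sech2 z v)\<^sup>2) * indicator ?B (act (cmat \<gamma>) v)) \<le> (of_nat N * 64) * ennreal ((sech2 z v)\<^sup>2)"
        by (simp add: sum_distrib_left mult_ac)
    qed
    also have "\<dots> = K"
      by (subst nn_integral_cmult) (auto simp: nn_integral_sech2[OF z] K_def mult_ac)
    finally have "(\<Sum>\<gamma>\<in>T. ennreal ((sech2 (act (cmat \<gamma>) z) u)\<^sup>2)) * emeasure ?\<mu> ?B \<le> K"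
      by (simp only: sum_distrib_right)
    then show ?thesis by (subst (asm) sum_ennreal) simp_all
  qed
  obtain c where c: "c > 0" "ennreal c \<le> emeasure ?\<mu> ?B"
  proof (cases "emeasure ?\<mu> ?B = \<infinity>")
    case True
    then show ?thesis using that[of 1] by simp
  next
    case False
    then show ?thesis using that[of "enn2real (emeasure ?\<mu> ?B)"] hyperbolic_ball_pos[OF u]
      by (auto simp: enn2real_positive_iff less_top top.not_eq_extremum)
  qed
  show ?thesis
  proof (rule that)
    fix T z assume *: "finite T" "T \<subseteq> \<Gamma>" "z \<in> \<H>"
    let ?s = "\<Sum>\<gamma>\<in>T. (sech2 (act (cmat \<gamma>) z) u)\<^sup>2"
    have s: "?s \<ge> 0" by (intro sum_nonneg) auto
    have "ennreal (?s * c) = ennreal ?s * ennreal c" using s c by (simp add: ennreal_mult)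
    also have "\<dots> \<le> ennreal ?s * emeasure ?\<mu> ?B" using c by (intro mult_left_mono) auto
    also have "\<dots> \<le> K" by (rule bound[OF *])
    also have "\<dots> = ennreal (enn2real K)" using K by simp
    finally have "?s * c \<le> enn2real K" by (simp add: ennreal_le_iff)
    then show "?s \<le> enn2real K / c" using c by (simp add: field_simps)
  qed
qed

end

section \<open>Elliptic Poincare series are cusp forms\<close>

lemma higher_deriv_sum:
  assumes "finite T" "open S" "z \<in> S" "\<And>x. x \<in> T \<Longrightarrow> f x holomorphic_on S"
  shows "(deriv ^^ n) (\<lambda>w. \<Sum>x\<in>T. f x w) z = (\<Sum>x\<in>T. (deriv ^^ n) (f x) z)"
  using assms(1,4)
proof (induction T rule: finite_induct)
  case empty
  then show ?case by simp
next
  case (insert x T)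
  have "(deriv ^^ n) (\<lambda>w. \<Sum>x\<in>insert x T. f x w) z = (deriv ^^ n) (\<lambda>w. f x w + (\<Sum>x\<in>T. f x w)) z"
    using insert by simp
  also have "\<dots> = (deriv ^^ n) (f x) z + (deriv ^^ n) (\<lambda>w. \<Sum>x\<in>T. f x w) z"
    using insert assms by (intro higher_deriv_add[where S = S] holomorphic_on_sum) auto
  finally show ?case using insert by simp
qed

text \<open>By the M-test the finite partial sums converge uniformly along the filter of finite
  subsets, and holomorphy and higher derivatives pass to uniform limits along any nontrivial filter.
  An ordering of the index set plays no part.\<close>

lemma holomorphic_infsum:
  fixes t :: "'a \<Rightarrow> complex \<Rightarrow> complex"
  assumes "r > 0" and hol: "\<And>x. x \<in> X \<Longrightarrow> t x holomorphic_on ball z r"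
    and bound: "\<And>x w. x \<in> X \<Longrightarrow> w \<in> ball z r \<Longrightarrow> norm (t x w) \<le> M x" and M: "M summable_on X"
  shows "(\<lambda>w. \<Sum>\<^sub>\<infinity>x\<in>X. t x w) holomorphic_on ball z r"
    and "((\<lambda>x. (deriv ^^ n) (t x) z) has_sum (deriv ^^ n) (\<lambda>w. \<Sum>\<^sub>\<infinity>x\<in>X. t x w) z) X"
proof -
  have u: "uniform_limit (ball z r) (\<lambda>T w. \<Sum>x\<in>T. t x w) (\<lambda>w. \<Sum>\<^sub>\<infinity>x\<in>X. t x w) (finite_subsets_at_top X)"
    using bound M by (rule Weierstrass_m_test_general)
  have ev: "\<forall>\<^sub>F T in finite_subsets_at_top X. finite T \<and> T \<subseteq> X"
    by (intro eventually_finite_subsets_at_top_weakI) auto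
  have hol': "\<forall>\<^sub>F T in finite_subsets_at_top X. (\<lambda>w. \<Sum>x\<in>T. t x w) holomorphic_on ball z r"
    using ev by eventually_elim (auto intro!: holomorphic_on_sum hol)
  show "(\<lambda>w. \<Sum>\<^sub>\<infinity>x\<in>X. t x w) holomorphic_on ball z r"
    unfolding holomorphic_on_open[OF open_ball]
  proof
    fix w assume w: "w \<in> ball z r"
    obtain s where s: "s > 0" "cball w s \<subseteq> ball z r"
      using w open_contains_cball[of "ball z r"] open_ball by blast
    have "\<forall>\<^sub>F T in finite_subsets_at_top X. continuous_on (cball w s) (\<lambda>w. \<Sum>x\<in>T. t x w) \<and>
        (\<lambda>w. \<Sum>x\<in>T. t x w) holomorphic_on ball w s"
      using hol' by eventually_elim
        (use s ball_subset_cball in \<open>blast intro: holomorphic_on_imp_continuous_on holomorphic_on_subset\<close>)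
    moreover have "uniform_limit (cball w s) (\<lambda>T w. \<Sum>x\<in>T. t x w) (\<lambda>w. \<Sum>\<^sub>\<infinity>x\<in>X. t x w) (finite_subsets_at_top X)"
      using u s(2) by (rule uniform_limit_on_subset)
    ultimately have "(\<lambda>w. \<Sum>\<^sub>\<infinity>x\<in>X. t x w) holomorphic_on ball w s"
      by (rule holomorphic_uniform_limit[OF _ _ finite_subsets_at_top_neq_bot])
    then show "\<exists>f'. ((\<lambda>w. \<Sum>\<^sub>\<infinity>x\<in>X. t x w) has_field_derivative f') (at w)"
      using s(1) by (auto simp: holomorphic_on_open)
  qed
  have "((\<lambda>T. (deriv ^^ n) (\<lambda>w. \<Sum>x\<in>T. t x w) z) \<longlongrightarrow> (deriv ^^ n) (\<lambda>w. \<Sum>\<^sub>\<infinity>x\<in>X. t x w) z) (finite_subsets_at_top X)"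
    by (rule higher_deriv_complex_uniform_limit[OF u hol' finite_subsets_at_top_neq_bot open_ball]) (use assms(1) in simp)
  also have "?this \<longleftrightarrow> ((\<lambda>T. \<Sum>x\<in>T. (deriv ^^ n) (t x) z) \<longlongrightarrow> (deriv ^^ n) (\<lambda>w. \<Sum>\<^sub>\<infinity>x\<in>X. t x w) z) (finite_subsets_at_top X)"
  proof (rule tendsto_cong, use ev in eventually_elim)
    fix T assume T: "finite T \<and> T \<subseteq> X"
    show "(deriv ^^ n) (\<lambda>w. \<Sum>x\<in>T. t x w) z = (\<Sum>x\<in>T. (deriv ^^ n) (t x) z)"
      using T assms(1) by (intro higher_deriv_sum[where S = "ball z r"]) (auto intro: hol)
  qed
  finally show "((\<lambda>x. (deriv ^^ n) (t x) z) has_sum (deriv ^^ n) (\<lambda>w. \<Sum>\<^sub>\<infinity>x\<in>X. t x w) z) X"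
    unfolding has_sum_def .
qed

text \<open>One notation for the summands of two kinds of series: f = w^m gives the Poincare series,
  f = \<open>Q_fun\<close> gives \<open>G_series\<close>.\<close>

definition pterm :: "nat \<Rightarrow> (complex \<Rightarrow> complex) \<Rightarrow> complex \<Rightarrow> real^2^2 \<Rightarrow> complex \<Rightarrow> complex" where
  "pterm k f u \<gamma> = slash k f (matrix_inv (sigma u) ** cmat \<gamma>)"

lemma pterm_eq:
  assumes "det \<gamma> = 1" "u \<in> \<H>" "z \<in> \<H>"
  shows "pterm k f u \<gamma> z = (u - cnj u) ^ (k div 2) * f ((act (cmat \<gamma>) z - u) / (act (cmat \<gamma>) z - cnj u))
    / ((act (cmat \<gamma>) z - cnj u) * j_factor (cmat \<gamma>) z) ^ k"
proof -
  have nz: "j_factor (cmat \<gamma>) z \<noteq> 0" by (rule j_factor_nz[OF assms(1,3)])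
  show ?thesis
    unfolding pterm_def slash_def act_mult[OF nz] j_factor_mult[OF nz] det_mul
      act_matrix_inv_sigma[OF assms(2)] j_factor_matrix_inv_sigma[OF assms(2)]
      det_matrix_inv_sigma[OF assms(2)] det_cmat
    using assms(1) by simp
qed

text \<open>The product |F| y^(k/2) is compatible with slashing, so only the point \<gamma>z
  matters. There the determinant and automorphy factor of the inverse of \<open>sigma\<close>
  combine with the imaginary part to (\<open>sech2\<close> / 2)^q, where q = k/2.\<close>

lemma norm_pterm:
  assumes "det \<gamma> = 1" "u \<in> \<H>" "z \<in> \<H>"
  shows "cmod (pterm (2 * q) f u \<gamma> z) * Im z ^ q =
    (sech2 (act (cmat \<gamma>) z) u / 2) ^ q * cmod (f ((act (cmat \<gamma>) z - u) / (act (cmat \<gamma>) z - cnj u)))"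
proof -
  define J where "J = cmod (j_factor (cmat \<gamma>) z)"
  define d where "d = cmod (act (cmat \<gamma>) z - cnj u)"
  define F where "F = cmod (f ((act (cmat \<gamma>) z - u) / (act (cmat \<gamma>) z - cnj u)))"
  have "cmod (u - cnj u) = 2 * Im u"
    using assms by (simp add: diff_cnj_eq norm_mult)
  then have "cmod (pterm (2 * q) f u \<gamma> z) = (2 * Im u) ^ q * F / ((d * J) ^ 2) ^ q"
    unfolding pterm_eq[OF assms] by (simp only: norm_mult norm_divide norm_power power_mult J_def d_def F_def) simp
  moreover have "sech2 (act (cmat \<gamma>) z) u / 2 = 2 * Im u * Im z / (d * J)\<^sup>2"
    by (simp add: sech2_def Im_act[OF assms(1,3)] J_def d_def power_mult_distrib mult_ac)
  ultimately show ?thesis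
    unfolding F_def[symmetric] by (simp only: power_divide power_mult_distrib) simp
qed

text \<open>The exponent l measures the growth (1 - |w|^2)^(-l) that f may have at the boundary of
  the disc. It uses up l of the q factors \<open>sech2\<close>, and at least two must remain for the
  sum over the group to be controlled. The choice l = 0 covers w^m; positive l is for
  \<open>Q_fun\<close>.\<close>

lemma pterm_bound:
  assumes "det \<gamma> = 1" "u \<in> \<H>" "z \<in> \<H>" "l + 2 \<le> q"
    and f: "\<And>w. w \<in> ball 0 1 \<Longrightarrow> cmod (f w) * (1 - (cmod w)\<^sup>2) ^ l \<le> 1"
  shows "cmod (pterm (2 * q) f u \<gamma> z) * Im z ^ q \<le> (sech2 (act (cmat \<gamma>) z) u)\<^sup>2"
proof -
  define e where "e = sech2 (act (cmat \<gamma>) z) u"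
  define w where "w = (act (cmat \<gamma>) z - u) / (act (cmat \<gamma>) z - cnj u)"
  have \<gamma>z: "act (cmat \<gamma>) z \<in> \<H>" by (rule act_in_H[OF assms(1,3)])
  have e: "0 < e" "e \<le> 1" "e = 1 - (cmod w)\<^sup>2"
    using sech2_pos[OF \<gamma>z assms(2)] sech2_le1[OF \<gamma>z assms(2)] sech2_eq[OF \<gamma>z assms(2)] by (simp_all add: e_def w_def)
  have "w \<in> ball 0 1"
    using act_inv_sigma_in_disc[OF assms(2) \<gamma>z] unfolding act_matrix_inv_sigma[OF assms(2)] w_def .
  from f[OF this] have f': "cmod (f w) * e ^ l \<le> 1" by (simp add: e)
  have "(e / 2) ^ q * cmod (f w) \<le> e ^ q * cmod (f w)"
    using e by (intro mult_right_mono power_mono) auto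
  also have "\<dots> = e ^ (q - l) * (cmod (f w) * e ^ l)"
    using assms(4) by (simp add: power_add[symmetric])
  also have "\<dots> \<le> e ^ (q - l) * 1"
    using f' e by (intro mult_left_mono) auto
  also have "\<dots> \<le> e ^ 2"
    using e assms(4) by (simp add: power_decreasing)
  finally show ?thesis unfolding norm_pterm[OF assms(1-3)] e_def w_def .
qed

lemma act_holomorphic:
  assumes "det \<gamma> = 1" shows "act (cmat \<gamma>) holomorphic_on \<H>"
  unfolding holomorphic_on_def field_differentiable_def
  using act_has_derivative[OF assms] has_field_derivative_at_within by blast

lemma pterm_holomorphic:
  assumes "det \<gamma> = 1" "u \<in> \<H>"
  shows "pterm k (\<lambda>w. w ^ m) u \<gamma> holomorphic_on \<H>"
proof -
  have "(\<lambda>z. (u - cnj u) ^ (k div 2) * ((act (cmat \<gamma>) z - u) / (act (cmat \<gamma>) z - cnj u)) ^ m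
    / ((act (cmat \<gamma>) z - cnj u) * j_factor (cmat \<gamma>) z) ^ k) holomorphic_on \<H>"
    using diff_cnj_nz[OF act_in_H[OF assms(1)] assms(2)] j_factor_nz[OF assms(1)]
    by (auto intro!: holomorphic_intros act_holomorphic assms simp: j_factor_cmat)
  then show ?thesis
    by (rule holomorphic_transform) (simp add: pterm_eq[OF assms(1) assms(2)])
qed

lemma pterm_mult:
  assumes "det \<delta> = 1" "z \<in> \<H>" "even k"
  shows "pterm k f u (\<gamma> ** \<delta>) z = slash k (pterm k f u \<gamma>) (cmat \<delta>) z"
  unfolding pterm_def cmat_mult matrix_mul_assoc
  by (rule slash_mult[OF j_factor_nz[OF assms(1,2)] assms(3)])

lemma power_disc_bound: "w \<in> ball 0 1 \<Longrightarrow> cmod (w ^ m) * (1 - (cmod w)\<^sup>2) ^ 0 \<le> 1"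
  by (simp add: norm_power power_le_one)

lemma pterm_power_bound:
  assumes "det \<gamma> = 1" "u \<in> \<H>" "z \<in> \<H>" "2 \<le> q"
  shows "cmod (pterm (2 * q) (\<lambda>w. w ^ m) u \<gamma> z) * Im z ^ q \<le> (sech2 (act (cmat \<gamma>) z) u)\<^sup>2"
  using assms(4) by (intro pterm_bound[where l = 0] assms(1-3) power_disc_bound) auto

context fuchsian
begin

lemma sech2_summable:
  assumes "u \<in> \<H>" "z \<in> \<H>"
  shows "(\<lambda>\<gamma>. (sech2 (act (cmat \<gamma>) z) u)\<^sup>2) summable_on \<Gamma>"
proof -
  obtain C where C: "\<And>T z. finite T \<Longrightarrow> T \<subseteq> \<Gamma> \<Longrightarrow> z \<in> \<H> \<Longrightarrow> (\<Sum>\<gamma>\<in>T. (sech2 (act (cmat \<gamma>) z) u)\<^sup>2) \<le> C"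
    using sech2_sum_bound[OF assms(1)] by blast
  show ?thesis
    by (rule nonneg_bdd_above_summable_on) (use C assms in \<open>auto intro!: bdd_aboveI2[where M = C]\<close>)
qed

lemma sech2_infsum_bound:
  assumes "u \<in> \<H>"
  obtains C where "C \<ge> 0" "\<And>z. z \<in> \<H> \<Longrightarrow> (\<Sum>\<^sub>\<infinity>\<gamma>\<in>\<Gamma>. (sech2 (act (cmat \<gamma>) z) u)\<^sup>2) \<le> C"
proof -
  obtain C where C: "\<And>T z. finite T \<Longrightarrow> T \<subseteq> \<Gamma> \<Longrightarrow> z \<in> \<H> \<Longrightarrow> (\<Sum>\<gamma>\<in>T. (sech2 (act (cmat \<gamma>) z) u)\<^sup>2) \<le> C"
    using sech2_sum_bound[OF assms(1)] by blast
  show ?thesis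
  proof (rule that)
    show "C \<ge> 0" using C[of "{}" u] assms by simp
    show "(\<Sum>\<^sub>\<infinity>\<gamma>\<in>\<Gamma>. (sech2 (act (cmat \<gamma>) z) u)\<^sup>2) \<le> C" if "z \<in> \<H>" for z
      using sech2_summable[OF assms that] C[OF _ _ that] by (rule infsum_le_finite_sums)
  qed
qed

lemma pterm_summable:
  assumes "u \<in> \<H>" "z \<in> \<H>" "l + 2 \<le> q"
    and f: "\<And>w. w \<in> ball 0 1 \<Longrightarrow> cmod (f w) * (1 - (cmod w)\<^sup>2) ^ l \<le> 1"
  shows "(\<lambda>\<gamma>. cmod (pterm (2 * q) f u \<gamma> z)) summable_on \<Gamma>"
proof (rule summable_on_comparison_test)
  show "(\<lambda>\<gamma>. (sech2 (act (cmat \<gamma>) z) u)\<^sup>2 * (1 / Im z ^ q)) summable_on \<Gamma>"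
    by (intro summable_on_cmult_left sech2_summable assms)
  fix \<gamma> assume "\<gamma> \<in> \<Gamma>"
  then have "cmod (pterm (2 * q) f u \<gamma> z) * Im z ^ q \<le> (sech2 (act (cmat \<gamma>) z) u)\<^sup>2"
    by (intro pterm_bound[where l = l] assms(1-3) det1 f)
  then show "cmod (pterm (2 * q) f u \<gamma> z) \<le> (sech2 (act (cmat \<gamma>) z) u)\<^sup>2 * (1 / Im z ^ q)"
    using assms(2) by (simp add: pos_le_divide_eq)
qed simp

section \<open>Poincare series: convergence, holomorphy, invariance, behaviour at the cusps\<close>

definition poincare :: "nat \<Rightarrow> nat \<Rightarrow> complex \<Rightarrow> complex \<Rightarrow> complex" where
  "poincare k m u z = (if z \<in> \<H> then \<Sum>\<^sub>\<infinity>\<gamma>\<in>\<Gamma>. pterm k (\<lambda>w. w ^ m) u \<gamma> z else 0)"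

lemma pterm_power_summable:
  assumes "u \<in> \<H>" "z \<in> \<H>" "2 \<le> q"
  shows "(\<lambda>\<gamma>. cmod (pterm (2 * q) (\<lambda>w. w ^ m) u \<gamma> z)) summable_on \<Gamma>"
  using assms(3) by (intro pterm_summable[where l = 0] assms(1,2) power_disc_bound) auto

lemma poincare_has_sum:
  assumes "u \<in> \<H>" "z \<in> \<H>" "2 \<le> q"
  shows "((\<lambda>\<gamma>. pterm (2 * q) (\<lambda>w. w ^ m) u \<gamma> z) has_sum poincare (2 * q) m u z) \<Gamma>"
  using abs_summable_summable[OF pterm_power_summable[OF assms]] assms
  by (simp add: poincare_def)

text \<open>The bound on the series of absolute values makes the unfolding legitimate; the bound on
  the sum itself gives the vanishing at the cusps.\<close>

lemma poincare_bound:
  assumes "u \<in> \<H>" "2 \<le> q"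
  obtains C where "C \<ge> 0" "\<And>z. z \<in> \<H> \<Longrightarrow> (\<Sum>\<^sub>\<infinity>\<gamma>\<in>\<Gamma>. cmod (pterm (2 * q) (\<lambda>w. w ^ m) u \<gamma> z)) * Im z ^ q \<le> C"
    "\<And>z. z \<in> \<H> \<Longrightarrow> cmod (poincare (2 * q) m u z) * Im z ^ q \<le> C"
proof -
  obtain C where C: "C \<ge> 0" "\<And>z. z \<in> \<H> \<Longrightarrow> (\<Sum>\<^sub>\<infinity>\<gamma>\<in>\<Gamma>. (sech2 (act (cmat \<gamma>) z) u)\<^sup>2) \<le> C"
    using sech2_infsum_bound[OF assms(1)] by blast
  have le: "(\<Sum>\<^sub>\<infinity>\<gamma>\<in>\<Gamma>. cmod (pterm (2 * q) (\<lambda>w. w ^ m) u \<gamma> z)) * Im z ^ q \<le> C" if z: "z \<in> \<H>" for z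
  proof -
    have "(\<Sum>\<^sub>\<infinity>\<gamma>\<in>\<Gamma>. cmod (pterm (2 * q) (\<lambda>w. w ^ m) u \<gamma> z)) * Im z ^ q
      = (\<Sum>\<^sub>\<infinity>\<gamma>\<in>\<Gamma>. cmod (pterm (2 * q) (\<lambda>w. w ^ m) u \<gamma> z) * Im z ^ q)"
      by (rule infsum_cmult_left'[symmetric])
    also have "\<dots> \<le> (\<Sum>\<^sub>\<infinity>\<gamma>\<in>\<Gamma>. (sech2 (act (cmat \<gamma>) z) u)\<^sup>2)"
      by (rule infsum_mono[OF summable_on_cmult_left[OF pterm_power_summable[OF assms(1) z assms(2)]]
            sech2_summable[OF assms(1) z] pterm_power_bound[OF det1 assms(1) z assms(2)]])
    also have "\<dots> \<le> C" by (rule C(2)[OF z])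
    finally show ?thesis .
  qed
  show ?thesis
  proof (rule that[OF C(1) le])
    fix z :: complex assume z: "z \<in> \<H>"
    have "cmod (poincare (2 * q) m u z) \<le> (\<Sum>\<^sub>\<infinity>\<gamma>\<in>\<Gamma>. cmod (pterm (2 * q) (\<lambda>w. w ^ m) u \<gamma> z))"
      using norm_infsum_bound[OF pterm_power_summable[OF assms(1) z assms(2)]] assms z
      by (simp add: poincare_def)
    then have "cmod (poincare (2 * q) m u z) * Im z ^ q \<le> (\<Sum>\<^sub>\<infinity>\<gamma>\<in>\<Gamma>. cmod (pterm (2 * q) (\<lambda>w. w ^ m) u \<gamma> z)) * Im z ^ q"
      using z by (intro mult_right_mono) auto
    with le[OF z] show "cmod (poincare (2 * q) m u z) * Im z ^ q \<le> C" by linarith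
  qed
qed

text \<open>By invariance \<gamma> can be moved to the other argument: the value at (\<gamma>w, u)
  equals the value at (\<gamma>^-1 u, w). There w stands alone and \<open>sech2_harnack'\<close>
  replaces it by the centre z, at the price of 8^2 = 64. The factor Im w^q is bounded below by (Im z
  / 2)^q.\<close>

lemma pterm_local_bound:
  assumes "u \<in> \<H>" "z \<in> \<H>" "2 \<le> q"
  obtains M where "M summable_on \<Gamma>"
    "\<And>\<gamma> w. \<gamma> \<in> \<Gamma> \<Longrightarrow> w \<in> ball z (Im z / 2) \<Longrightarrow> cmod (pterm (2 * q) (\<lambda>w. w ^ m) u \<gamma> w) \<le> M \<gamma>"
proof
  define M where "M = (\<lambda>\<gamma>. (sech2 (act (cmat \<gamma>) z) u)\<^sup>2 * (64 / (Im z / 2) ^ q))"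
  show "M summable_on \<Gamma>"
    unfolding M_def by (intro summable_on_cmult_left sech2_summable assms)
  fix \<gamma> w assume \<gamma>: "\<gamma> \<in> \<Gamma>" and w: "w \<in> ball z (Im z / 2)"
  have wH: "w \<in> \<H>" by (rule sech2_harnack(1)[OF assms(2) assms(2) w])
  have d: "det (adj2 \<gamma>) = 1" by (rule det1[OF adj2_mem[OF \<gamma>]])
  define v where "v = act (cmat (adj2 \<gamma>)) u"
  have v: "v \<in> \<H>" unfolding v_def by (rule act_in_H[OF d assms(1)])
  have eq: "sech2 (act (cmat \<gamma>) x) u = sech2 v x" if "x \<in> \<H>" for x
    using sech2_act[OF d act_in_H[OF det1[OF \<gamma>] that] assms(1)] act_adj2[OF \<gamma> that] sech2_sym
    by (simp add: v_def)
  have "cmod (pterm (2 * q) (\<lambda>w. w ^ m) u \<gamma> w) * Im w ^ q \<le> (sech2 v w)\<^sup>2"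
    using pterm_power_bound[OF det1[OF \<gamma>] assms(1) wH assms(3)] eq[OF wH] by simp
  also have "\<dots> \<le> (8 * sech2 v z)\<^sup>2"
    using sech2_harnack'[OF v assms(2) w] sech2_pos[OF v wH] by (intro power_mono) auto
  finally have 1: "cmod (pterm (2 * q) (\<lambda>w. w ^ m) u \<gamma> w) * Im w ^ q \<le> 64 * (sech2 v z)\<^sup>2"
    by (simp add: power_mult_distrib)
  have "cmod (z - w) < Im z / 2" using w by (simp add: dist_norm)
  moreover have "\<bar>Im (z - w)\<bar> \<le> cmod (z - w)" by (rule abs_Im_le_cmod)
  ultimately have "Im z / 2 \<le> Im w" by simp
  then have "(Im z / 2) ^ q \<le> Im w ^ q" using assms(2) by (intro power_mono) auto
  then have "cmod (pterm (2 * q) (\<lambda>w. w ^ m) u \<gamma> w) * (Im z / 2) ^ q \<le> cmod (pterm (2 * q) (\<lambda>w. w ^ m) u \<gamma> w) * Im w ^ q"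
    by (intro mult_left_mono) auto
  with 1 have "cmod (pterm (2 * q) (\<lambda>w. w ^ m) u \<gamma> w) * (Im z / 2) ^ q \<le> 64 * (sech2 v z)\<^sup>2" by linarith
  moreover have "(Im z / 2) ^ q > 0" using assms(2) by simp
  ultimately show "cmod (pterm (2 * q) (\<lambda>w. w ^ m) u \<gamma> w) \<le> M \<gamma>"
    unfolding M_def eq[OF assms(2)] by (simp only: pos_le_divide_eq times_divide_eq_right mult.commute)
qed

lemma poincare_holomorphic:
  assumes "u \<in> \<H>" "2 \<le> q"
  shows "poincare (2 * q) m u holomorphic_on \<H>"
proof -
  have "\<exists>f'. (poincare (2 * q) m u has_field_derivative f') (at z)" if z: "z \<in> \<H>" for z
  proof -
    have sub: "ball z (Im z / 2) \<subseteq> \<H>" using sech2_harnack(1)[OF z z] by blast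
    obtain M where M: "M summable_on \<Gamma>"
      "\<And>\<gamma> w. \<gamma> \<in> \<Gamma> \<Longrightarrow> w \<in> ball z (Im z / 2) \<Longrightarrow> cmod (pterm (2 * q) (\<lambda>w. w ^ m) u \<gamma> w) \<le> M \<gamma>"
      using pterm_local_bound[OF assms(1) z assms(2)] by blast
    have "(\<lambda>w. \<Sum>\<^sub>\<infinity>\<gamma>\<in>\<Gamma>. pterm (2 * q) (\<lambda>w. w ^ m) u \<gamma> w) holomorphic_on ball z (Im z / 2)"
      by (rule holomorphic_infsum(1)[where M = M])
        (use z M sub in \<open>auto intro!: holomorphic_on_subset[OF pterm_holomorphic[OF det1 assms(1)]]\<close>)
    then have "poincare (2 * q) m u holomorphic_on ball z (Im z / 2)"
      by (rule holomorphic_transform) (use sub in \<open>auto simp: poincare_def\<close>)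
    then show ?thesis using z by (auto simp: holomorphic_on_open)
  qed
  moreover have "open \<H>" using open_halfspace_Im_gt[of 0] by simp
  ultimately show ?thesis by (simp add: holomorphic_on_open)
qed

lemma poincare_modular:
  assumes "u \<in> \<H>" "2 \<le> q" "\<delta> \<in> \<Gamma>" "z \<in> \<H>"
  shows "slash (2 * q) (poincare (2 * q) m u) (cmat \<delta>) z = poincare (2 * q) m u z"
proof -
  have d: "det \<delta> = 1" by (rule det1[OF assms(3)])
  have dz: "act (cmat \<delta>) z \<in> \<H>" by (rule act_in_H[OF d assms(4)])
  have "slash (2 * q) (poincare (2 * q) m u) (cmat \<delta>) z =
    (\<Sum>\<^sub>\<infinity>\<gamma>\<in>\<Gamma>. pterm (2 * q) (\<lambda>w. w ^ m) u \<gamma> (act (cmat \<delta>) z)) * (1 / j_factor (cmat \<delta>) z ^ (2 * q))"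
    using dz d by (simp add: slash_def det_cmat poincare_def)
  also have "\<dots> = (\<Sum>\<^sub>\<infinity>\<gamma>\<in>\<Gamma>. pterm (2 * q) (\<lambda>w. w ^ m) u (\<gamma> ** \<delta>) z)"
    unfolding infsum_cmult_left'[symmetric] using d
    by (intro infsum_cong) (simp add: pterm_mult[OF d assms(4)] slash_def det_cmat)
  also have "\<dots> = (\<Sum>\<^sub>\<infinity>\<gamma>\<in>\<Gamma>. pterm (2 * q) (\<lambda>w. w ^ m) u \<gamma> z)"
    by (rule infsum_reindex_bij_betw[OF bij_mult_right[OF assms(3)]])
  finally show ?thesis using assms(4) by (simp add: poincare_def)
qed

text \<open>No growth analysis at the cusps is needed: a function with bounded \<open>|f| y\<^bsup>k/2\<^esup>\<close> is
  \<open>O(y\<^bsup>-k/2\<^esup>)\<close> in the coordinate of every cusp.\<close>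

lemma poincare_vanishes:
  assumes "u \<in> \<H>" "2 \<le> q"
  shows "vanishes_at_cusps \<Gamma> (2 * q) (poincare (2 * q) m u)"
  unfolding vanishes_at_cusps_def
proof (intro allI impI)
  fix A :: "real^2^2"
  assume "det A = 1 \<and> (\<exists>h. h \<noteq> 0 \<and> A ** mat2 1 h 0 1 ** matrix_inv A \<in> \<Gamma>)"
  then have A: "det A = 1" by simp
  obtain C where C: "\<And>z. z \<in> \<H> \<Longrightarrow> cmod (poincare (2 * q) m u z) * Im z ^ q \<le> C"
    using poincare_bound[OF assms] by metis
  have bound: "cmod (slash (2 * q) (poincare (2 * q) m u) (cmat A) z) \<le> C / Im z ^ q" if z: "z \<in> \<H>" for z
  proof -
    have "cmod (slash (2 * q) (poincare (2 * q) m u) (cmat A) z) * Im z ^ q =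
      cmod (poincare (2 * q) m u (act (cmat A) z)) * Im (act (cmat A) z) ^ q"
      by (simp add: slash_def det_cmat A norm_divide norm_power Im_act[OF A z] power_divide power_mult)
    also have "\<dots> \<le> C" by (rule C[OF act_in_H[OF A z]])
    finally show ?thesis using z by (simp add: pos_le_divide_eq)
  qed
  have ev: "\<forall>\<^sub>F z in filtercomap Im at_top. (0::real) < Im z"
    by (rule eventually_filtercomapI[OF eventually_gt_at_top])
  have "((\<lambda>y. C / y ^ q) \<longlongrightarrow> 0) at_top"
    using assms(2) by (intro real_tendsto_divide_at_top tendsto_const filterlim_pow_at_top filterlim_ident) auto
  then have lim: "((\<lambda>z. C / Im z ^ q) \<longlongrightarrow> 0) (filtercomap Im at_top)"
    by (rule filterlim_compose[where f = Im, OF _ filterlim_filtercomap])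
  have ev': "\<forall>\<^sub>F z in filtercomap Im at_top.
      cmod (slash (2 * q) (poincare (2 * q) m u) (cmat A) z) \<le> C / Im z ^ q"
    using ev by eventually_elim (auto intro: bound)
  show "(slash (2 * q) (poincare (2 * q) m u) (cmat A) \<longlongrightarrow> 0) (filtercomap Im at_top)"
    by (rule Lim_null_comparison[OF ev' lim])
qed

lemma poincare_cusp_form:
  assumes "u \<in> \<H>" "2 \<le> q"
  shows "poincare (2 * q) m u \<in> cusp_forms \<Gamma> (2 * q)"
  using poincare_holomorphic[OF assms] poincare_modular[OF assms] poincare_vanishes[OF assms]
  by (auto simp: cusp_forms_def poincare_def)

end

section \<open>Elliptic Taylor coefficients\<close>

text \<open>Supplies the uniqueness needed to evaluate the definite description in
  \<open>elliptic_coeff\<close>.\<close>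

lemma power_series_coeff_eq:
  fixes h :: "complex \<Rightarrow> complex"
  assumes "\<forall>w\<in>ball 0 1. (\<lambda>m. c m * w ^ m) sums h w"
  shows "c n = (deriv ^^ n) h 0 / fact n"
proof -
  define F where "F = Abs_fps c"
  \<comment> \<open>Convergence at the nonzero point 1/2 makes the radius of convergence positive,
    which is what an expansion at 0 requires.\<close>
  have "summable (\<lambda>m. c m * (1/2) ^ m)"
    using assms by (auto simp: sums_iff)
  then have "conv_radius c \<ge> norm (1/2 :: complex)"
    by (intro conv_radius_geI)
  then have "fps_conv_radius F > 0"
    unfolding fps_conv_radius_def F_def fps_nth_Abs_fps by (rule less_le_trans[rotated]) simp
  moreover have "\<forall>\<^sub>F z in nhds 0. eval_fps F z = h z"
  proof -
    have "\<forall>\<^sub>F z in nhds 0. z \<in> ball (0::complex) 1" by (rule eventually_nhds_in_open) auto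
    then show ?thesis
      by eventually_elim (use assms in \<open>simp add: eval_fps_def F_def sums_iff\<close>)
  qed
  ultimately have "h has_fps_expansion F" by (simp add: has_fps_expansion_def)
  then show ?thesis using fps_nth_fps_expansion[of h F n] by (simp add: F_def)
qed

lemma slash_sigma_eq:
  assumes "u \<in> \<H>"
  shows "slash (2 * q) f (sigma u) w = (u - cnj u) ^ q * f ((u - cnj u * w) / (1 - w)) / (1 - w) ^ (2 * q)"
  using H_diff_cnj[OF assms]
  by (simp add: slash_def det_sigma[OF assms] act_sigma[OF assms] j_factor_sigma[OF assms] power_divide
    field_simps power_mult power2_eq_square power_mult_distrib)

lemma slash_sigma_holomorphic:
  assumes "u \<in> \<H>" "f holomorphic_on \<H>"
  shows "slash (2 * q) f (sigma u) holomorphic_on ball 0 1"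
proof -
  have "(\<lambda>w. f ((u - cnj u * w) / (1 - w))) holomorphic_on ball 0 1"
  proof (rule holomorphic_on_compose_gen[OF _ assms(2), unfolded o_def])
    show "(\<lambda>w. (u - cnj u * w) / (1 - w)) holomorphic_on ball 0 1"
      using disc_ne1 by (intro holomorphic_intros) auto
    show "(\<lambda>w. (u - cnj u * w) / (1 - w)) ` ball 0 1 \<subseteq> \<H>"
      using act_sigma_in_H[OF assms(1)] unfolding act_sigma[OF assms(1)] by blast
  qed
  then show ?thesis
    unfolding slash_sigma_eq[OF assms(1), abs_def]
    using disc_ne1 by (intro holomorphic_intros) auto
qed

lemma elliptic_coeff_sums:
  assumes "u \<in> \<H>" "f holomorphic_on \<H>" "w \<in> ball 0 1"
  shows "(\<lambda>m. elliptic_coeff (2 * q) u f m * w ^ m) sums slash (2 * q) f (sigma u) w"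
    and "elliptic_coeff (2 * q) u f n = (deriv ^^ n) (slash (2 * q) f (sigma u)) 0 / fact n"
proof -
  let ?h = "slash (2 * q) f (sigma u)"
  let ?c = "\<lambda>n. (deriv ^^ n) ?h 0 / fact n"
  have sums: "\<forall>w\<in>ball 0 1. (\<lambda>m. ?c m * w ^ m) sums ?h w"
    using holomorphic_power_series[OF slash_sigma_holomorphic[OF assms(1,2)]] by fastforce
  have "elliptic_coeff (2 * q) u f = ?c"
    unfolding elliptic_coeff_def
    by (rule the_equality[where P = "\<lambda>c. \<forall>w\<in>ball 0 1. (\<lambda>m. c m * w ^ m) sums ?h w", OF sums])
      (rule ext, erule power_series_coeff_eq)
  with sums assms(3) show "(\<lambda>m. elliptic_coeff (2 * q) u f m * w ^ m) sums ?h w"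
    "elliptic_coeff (2 * q) u f n = ?c n" by auto
qed

lemma elliptic_coeff_sum:
  assumes "u \<in> \<H>" "finite T" "\<And>f. f \<in> T \<Longrightarrow> f holomorphic_on \<H>"
  shows "elliptic_coeff (2 * q) u (\<lambda>z. \<Sum>f\<in>T. c f * f z) n = (\<Sum>f\<in>T. c f * elliptic_coeff (2 * q) u f n)"
proof -
  have 0: "(0::complex) \<in> ball 0 1" by simp
  have "(\<lambda>z. \<Sum>f\<in>T. c f * f z) holomorphic_on \<H>"
    using assms by (intro holomorphic_on_sum holomorphic_on_mult holomorphic_on_const) auto
  then have "elliptic_coeff (2 * q) u (\<lambda>z. \<Sum>f\<in>T. c f * f z) n
      = (deriv ^^ n) (slash (2 * q) (\<lambda>z. \<Sum>f\<in>T. c f * f z) (sigma u)) 0 / fact n"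
    using elliptic_coeff_sums(2)[OF assms(1) _ 0] by blast
  also have "slash (2 * q) (\<lambda>z. \<Sum>f\<in>T. c f * f z) (sigma u) = (\<lambda>w. \<Sum>f\<in>T. c f * slash (2 * q) f (sigma u) w)"
    by (rule ext) (simp add: slash_def sum_distrib_left sum_divide_distrib mult_ac)
  also have "(deriv ^^ n) \<dots> 0 = (\<Sum>f\<in>T. (deriv ^^ n) (\<lambda>w. c f * slash (2 * q) f (sigma u) w) 0)"
    using assms 0
    by (intro higher_deriv_sum[where S = "ball 0 1"] holomorphic_on_mult holomorphic_on_const slash_sigma_holomorphic) auto
  also have "\<dots> = (\<Sum>f\<in>T. c f * (deriv ^^ n) (slash (2 * q) f (sigma u)) 0)"
    using assms by (intro sum.cong refl higher_deriv_cmult[where A = "ball 0 1"] slash_sigma_holomorphic) auto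
  also have "\<dots> / fact n = (\<Sum>f\<in>T. c f * elliptic_coeff (2 * q) u f n)"
    using elliptic_coeff_sums(2)[OF assms(1) assms(3) 0, of _ q n] by (simp add: sum_divide_distrib)
  finally show ?thesis .
qed

text \<open>Expanding the m-th power binomially, the j-th term is a constant times w^j (1 - R
  \<kappa> w)^(-(k+j)). Its n-th coefficient contains the binomial coefficient of k + j + (n - j) -
  1 = n + k - 1 over n - j, whose upper entry no longer depends on j. The powers \<kappa>^j and
  \<kappa>^(n-j) combine to \<kappa>^n.\<close>

lemma taylor_coeff_moebius_power:
  fixes w0 \<kappa> R :: complex
  assumes "k > 0"
  shows "(deriv ^^ n) (\<lambda>w. (w0 + \<kappa> * w / (1 - R * \<kappa> * w)) ^ m / (1 - R * \<kappa> * w) ^ k) 0 / fact n =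
    (\<Sum>j=0..n. of_nat (m choose j) * of_nat ((n + k - 1) choose (n - j)) * (w0 ^ (m - j) * R ^ (n - j))) * \<kappa> ^ n"
proof -
  let ?g = "\<lambda>w. (w0 + \<kappa> * w / (1 - R * \<kappa> * w)) ^ m / (1 - R * \<kappa> * w) ^ k"
  let ?c = "\<lambda>j. of_nat (m choose j) * \<kappa> ^ j * w0 ^ (m - j)"
  define F where "F = (\<Sum>j\<le>m. fps_const (?c j) * (fps_X ^ j * inverse ((1 - fps_const (R * \<kappa>) * fps_X) ^ (k + j))))"
  have "(\<lambda>w. \<Sum>j\<le>m. ?c j * (w ^ j * inverse ((1 - R * \<kappa> * w) ^ (k + j)))) has_fps_expansion F"
    unfolding F_def by (intro fps_expansion_intros) auto
  moreover have ev: "\<forall>\<^sub>F w in nhds 0. (\<Sum>j\<le>m. ?c j * (w ^ j * inverse ((1 - R * \<kappa> * w) ^ (k + j)))) = ?g w"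
  proof -
    have "isCont (\<lambda>w. 1 - R * \<kappa> * w) 0" by (intro continuous_intros)
    then have "((\<lambda>w. 1 - R * \<kappa> * w) \<longlongrightarrow> 1) (nhds 0)" by (simp add: continuous_at isCont_def tendsto_nhds_iff)
    then have "\<forall>\<^sub>F w in nhds 0. 1 - R * \<kappa> * w \<noteq> 0"
      by (rule tendsto_imp_eventually_ne) simp
    then show ?thesis
    proof eventually_elim
      case (elim w)
      have "?g w = (\<Sum>j\<le>m. of_nat (m choose j) * (\<kappa> * w / (1 - R * \<kappa> * w)) ^ j * w0 ^ (m - j)) / (1 - R * \<kappa> * w) ^ k"
        by (subst add.commute) (simp add: binomial_ring)
      also have "\<dots> = (\<Sum>j\<le>m. ?c j * (w ^ j * inverse ((1 - R * \<kappa> * w) ^ (k + j))))"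
        unfolding sum_divide_distrib
        by (intro sum.cong refl) (simp add: power_divide power_mult_distrib power_add divide_inverse power_inverse mult_ac)
      finally show ?case by simp
    qed
  qed
  ultimately have "?g has_fps_expansion F"
    unfolding has_fps_expansion_def
  proof (elim conjE, intro conjI)
    assume "\<forall>\<^sub>F w in nhds 0. eval_fps F w = (\<Sum>j\<le>m. ?c j * (w ^ j * inverse ((1 - R * \<kappa> * w) ^ (k + j))))"
    with ev show "\<forall>\<^sub>F w in nhds 0. eval_fps F w = ?g w" by eventually_elim (simp only:)
  qed
  then have "(deriv ^^ n) ?g 0 / fact n = fps_nth F n"
    by (simp add: fps_nth_fps_expansion)
  also have "\<dots> = (\<Sum>j\<le>m. ?c j * (if n < j then 0 else of_nat ((k + j + (n - j) - 1) choose (n - j)) * (R * \<kappa>) ^ (n - j)))"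
    using assms unfolding F_def fps_sum_nth fps_mult_left_const_nth fps_X_power_mult_nth
    by (intro sum.cong refl) (simp add: one_minus_const_fps_X_neg_power')
  also have "\<dots> = (\<Sum>j=0..n. of_nat (m choose j) * of_nat ((n + k - 1) choose (n - j)) * (w0 ^ (m - j) * R ^ (n - j)) * \<kappa> ^ n)"
  \<comment> \<open>The ranges j \<le> m and j \<le> n may differ: for j > n the coefficient of w^n
    is 0, and for j > m the binomial coefficient is 0, so the truncated difference m - j is
    harmless.\<close>
  proof (rule sum.mono_neutral_cong)
    fix j assume "j \<in> {..m} \<inter> {0..n}"
    then have "j \<le> n" by auto
    then have "\<kappa> ^ n = \<kappa> ^ j * \<kappa> ^ (n - j)" "k + j + (n - j) - 1 = n + k - 1" by (simp_all flip: power_add)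
    with \<open>j \<le> n\<close> show "?c j * (if n < j then 0 else of_nat ((k + j + (n - j) - 1) choose (n - j)) * (R * \<kappa>) ^ (n - j)) =
      of_nat (m choose j) * of_nat ((n + k - 1) choose (n - j)) * (w0 ^ (m - j) * R ^ (n - j)) * \<kappa> ^ n"
      by (simp add: power_mult_distrib mult_ac)
  qed auto
  finally show ?thesis by (simp add: sum_distrib_right)
qed

text \<open>The combination of \<open>G_series\<close> in the final formula, taken inside the sum
  over \<gamma>. It is what the n-th Taylor coefficient of a single summand amounts to.\<close>

definition Q_sum :: "nat \<Rightarrow> nat \<Rightarrow> nat \<Rightarrow> complex \<Rightarrow> complex" where
  "Q_sum k m n w = (\<Sum>j=0..n. of_nat (m choose j) * of_nat ((n + k - 1) choose (n - j)) * Q_fun (m - j) (n - j) w)"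

text \<open>
  With \<open>(n\<^sub>1, n\<^sub>2)\<close> the first row of \<open>\<sigma>\<^sub>u\<inverse> \<gamma>\<close> (whose second row is the complex conjugate),
  \<open>s = n\<^sub>1 v + n\<^sub>2\<close> and \<open>t = n\<^sub>1 cnj v + n\<^sub>2\<close>, the matrix \<open>\<sigma>\<^sub>u\<inverse> \<gamma> \<sigma>\<^sub>v\<close> is a multiple of
  \<open>(-t s; -cnj s cnj t)\<close> and the determinant relation is \<open>|s|\<^sup>2 - |t|\<^sup>2 = (u - cnj u) (v - cnj v)\<close>.
\<close>

lemma taylor_coeff_pterm:
  assumes "det \<gamma> = 1" "u \<in> \<H>" "v \<in> \<H>" "q > 0"
  shows "(deriv ^^ n) (slash (2 * q) (pterm (2 * q) (\<lambda>w. w ^ m) u \<gamma>) (sigma v)) 0 / fact n =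
    (v - cnj v) ^ (n + q) * pterm (2 * q + 2 * n) (Q_sum (2 * q) m n) u \<gamma> v"
proof -
  define a b c d where "a = complex_of_real (\<gamma>$1$1)" "b = complex_of_real (\<gamma>$1$2)"
    "c = complex_of_real (\<gamma>$2$1)" "d = complex_of_real (\<gamma>$2$2)"
  note abcd = this
  have "a * d - b * c = of_real (det \<gamma>)" by (simp add: abcd det_2)
  then have det: "a * d - b * c = 1" using assms by simp
  define n1 n2 where "n1 = a - u * c" "n2 = b - u * d"
  note n12 = this
  have cnj_n: "cnj n1 = a - cnj u * c" "cnj n2 = b - cnj u * d" by (simp_all add: n12 abcd)
  define s t U V where "s = n1 * v + n2" "t = n1 * cnj v + n2" "U = u - cnj u" "V = v - cnj v"
  note st = this
  have J: "(act (cmat \<gamma>) z - u) * j_factor (cmat \<gamma>) z = n1 * z + n2"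
    "(act (cmat \<gamma>) z - cnj u) * j_factor (cmat \<gamma>) z = cnj n1 * z + cnj n2" if "z \<in> \<H>" for z
    using j_factor_nz[OF assms(1) that] unfolding cnj_n n12
    by (simp_all add: act_cmat j_factor_cmat left_diff_distrib abcd) (simp_all add: algebra_simps)
  have V0: "V \<noteq> 0" using H_diff_cnj[OF assms(3)] by (simp add: st)
  have "cnj n1 * v + cnj n2 = (act (cmat \<gamma>) v - cnj u) * j_factor (cmat \<gamma>) v" using J[OF assms(3)] by simp
  also have "\<dots> \<noteq> 0" using diff_cnj_nz[OF act_in_H[OF assms(1,3)] assms(2)] j_factor_nz[OF assms(1,3)] by simp
  finally have ct0: "cnj t \<noteq> 0" by (simp add: st)
  then have t0: "t \<noteq> 0" by auto
  have N: "n1 * cnj n2 - cnj n1 * n2 = U"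
  proof -
    have "n1 * cnj n2 - cnj n1 * n2 = (u - cnj u) * (a * d - b * c)"
      unfolding cnj_n unfolding n12 by (simp add: algebra_simps)
    then show ?thesis using det by (simp add: st)
  qed
  have UV: "U * V = s * cnj s - t * cnj t"
  proof -
    have "s * cnj s - t * cnj t = (n1 * cnj n2 - cnj n1 * n2) * (v - cnj v)"
      by (simp add: st algebra_simps)
    then show ?thesis by (simp add: N st)
  qed
  \<comment> \<open>The map in question is w \<mapsto> (s - t w) / (cnj t - cnj s w). Its value at 0
    is \<open>w0\<close>, its derivative at 0 is \<open>\<kappa>\<close>, and 1 - R
    \<open>\<kappa>\<close> w is its denominator divided by cnj t. The formula for R through
    \<open>w0\<close> alone is the second factor of \<open>Q_fun\<close>.\<close>
  define w0 where "w0 = s / cnj t"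
  define \<kappa> where "\<kappa> = U * V / (cnj t)\<^sup>2"
  define R where "R = cnj w0 / (of_real ((cmod w0)\<^sup>2) - 1)"
  have U0: "U \<noteq> 0" using H_diff_cnj[OF assms(2)] by (simp add: st)
  have cw0: "cnj w0 = cnj s / t" by (simp add: w0_def)
  have nw: "of_real ((cmod w0)\<^sup>2) - 1 = U * V / (t * cnj t)"
    unfolding complex_norm_square cw0 using t0 ct0 by (simp add: w0_def UV field_simps)
  then have R: "R = cnj s * cnj t / (U * V)"
    using t0 ct0 U0 V0 unfolding R_def nw unfolding cw0 by simp
  have \<epsilon>: "R * \<kappa> = cnj s / cnj t"
    using ct0 U0 V0 by (simp add: R \<kappa>_def power2_eq_square)
  have w0: "w0 = (act (cmat \<gamma>) v - u) / (act (cmat \<gamma>) v - cnj u)"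
  proof -
    have "w0 = ((act (cmat \<gamma>) v - u) * j_factor (cmat \<gamma>) v) / ((act (cmat \<gamma>) v - cnj u) * j_factor (cmat \<gamma>) v)"
      unfolding J[OF assms(3)] by (simp add: w0_def st)
    then show ?thesis using j_factor_nz[OF assms(1,3)] by simp
  qed
  have g: "slash (2 * q) (pterm (2 * q) (\<lambda>w. w ^ m) u \<gamma>) (sigma v) w =
      \<kappa> ^ q * ((w0 + \<kappa> * w / (1 - R * \<kappa> * w)) ^ m / (1 - R * \<kappa> * w) ^ (2 * q))" if w: "w \<in> ball 0 1" for w
  proof -
    define z where "z = (v - cnj v * w) / (1 - w)"
    have w1: "1 - w \<noteq> 0" by (rule disc_ne1[OF w])
    have z: "z \<in> \<H>" using act_sigma_in_H[OF assms(3) w] by (simp add: act_sigma[OF assms(3)] z_def)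
    define L1 L2 where "L1 = s - t * w" "L2 = cnj t - cnj s * w"
    note L = this
    have zL: "n1 * z + n2 = L1 / (1 - w)" "cnj n1 * z + cnj n2 = L2 / (1 - w)"
      using w1 by (simp_all add: z_def L st field_simps)
    have jz: "j_factor (cmat \<gamma>) z \<noteq> 0" by (rule j_factor_nz[OF assms(1) z])
    have "(act (cmat \<gamma>) z - cnj u) * j_factor (cmat \<gamma>) z \<noteq> 0"
      using diff_cnj_nz[OF act_in_H[OF assms(1) z] assms(2)] jz by simp
    then have L0: "L2 \<noteq> 0" unfolding J[OF z] zL by auto
    have frac: "(act (cmat \<gamma>) z - u) / (act (cmat \<gamma>) z - cnj u) = L1 / L2"
    proof -
      have "(act (cmat \<gamma>) z - u) / (act (cmat \<gamma>) z - cnj u) =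
        ((act (cmat \<gamma>) z - u) * j_factor (cmat \<gamma>) z) / ((act (cmat \<gamma>) z - cnj u) * j_factor (cmat \<gamma>) z)"
        using jz by simp
      also have "\<dots> = L1 / L2" unfolding J[OF z] zL using w1 by simp
      finally show ?thesis .
    qed
    have e1: "1 - R * \<kappa> * w = L2 / cnj t" using ct0 by (simp add: \<epsilon> L field_simps)
    have e2: "w0 + \<kappa> * w / (1 - R * \<kappa> * w) = L1 / L2"
    proof -
      have "w0 * L2 * cnj t + U * V * w = L1 * cnj t"
        using ct0 unfolding UV by (simp add: w0_def L algebra_simps)
      then have "w0 + U * V * w / (cnj t * L2) = L1 / L2"
        using ct0 L0 by (simp add: field_simps)
      then show ?thesis unfolding e1 unfolding \<kappa>_def using ct0 L0 by (simp add: power2_eq_square)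
    qed
    have "slash (2 * q) (pterm (2 * q) (\<lambda>w. w ^ m) u \<gamma>) (sigma v) w =
      V ^ q * (U ^ q * (L1 / L2) ^ m / (L2 / (1 - w)) ^ (2 * q)) / (1 - w) ^ (2 * q)"
      unfolding slash_sigma_eq[OF assms(3)] z_def[symmetric] pterm_eq[OF assms(1,2) z] frac J[OF z] zL st(3,4)[symmetric]
      by simp
    also have "\<dots> = (U * V) ^ q * (L1 / L2) ^ m / L2 ^ (2 * q)"
      using w1 by (simp add: power_divide power_mult_distrib)
    also have "\<dots> = \<kappa> ^ q * ((L1 / L2) ^ m / (L2 / cnj t) ^ (2 * q))"
      using ct0 by (simp add: \<kappa>_def power_divide power_mult)
    finally show ?thesis unfolding e2 unfolding e1 .
  qed
  let ?g = "\<lambda>w. (w0 + \<kappa> * w / (1 - R * \<kappa> * w)) ^ m / (1 - R * \<kappa> * w) ^ (2 * q)"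
  have hol: "slash (2 * q) (pterm (2 * q) (\<lambda>w. w ^ m) u \<gamma>) (sigma v) holomorphic_on ball 0 1"
    by (rule slash_sigma_holomorphic[OF assms(3) pterm_holomorphic[OF assms(1,2)]])
  have \<kappa>0: "\<kappa> \<noteq> 0" using U0 V0 ct0 by (simp add: \<kappa>_def)
  \<comment> \<open>On the disc \<open>?g\<close> is a constant multiple of the slashed summand,
    from which it inherits holomorphy.\<close>
  have hol_g: "?g holomorphic_on ball 0 1"
  proof (rule holomorphic_transform)
    show "(\<lambda>w. slash (2 * q) (pterm (2 * q) (\<lambda>w. w ^ m) u \<gamma>) (sigma v) w / \<kappa> ^ q) holomorphic_on ball 0 1"
      using hol \<kappa>0 by (intro holomorphic_on_divide holomorphic_on_const) auto
  qed (use g \<kappa>0 in simp)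
  have "(deriv ^^ n) (slash (2 * q) (pterm (2 * q) (\<lambda>w. w ^ m) u \<gamma>) (sigma v)) 0 =
      (deriv ^^ n) (\<lambda>w. \<kappa> ^ q * ?g w) 0"
    by (rule higher_deriv_transform_within_open[OF hol holomorphic_on_mult[OF holomorphic_on_const hol_g] open_ball _ g])
      simp_all
  also have "\<dots> = \<kappa> ^ q * (deriv ^^ n) ?g 0"
    using hol_g by (intro higher_deriv_cmult[where A = "ball 0 1"]) auto
  finally have "(deriv ^^ n) (slash (2 * q) (pterm (2 * q) (\<lambda>w. w ^ m) u \<gamma>) (sigma v)) 0 / fact n =
      \<kappa> ^ q * ((deriv ^^ n) ?g 0 / fact n)" by simp
  \<comment> \<open>The q powers of \<open>\<kappa>\<close> come from the automorphy factor and the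
    n further ones from the Taylor coefficient. Together they carry (cnj t)^(-(2q + 2n)), the
    automorphy factor of weight 2q + 2n.\<close>
  also have "\<dots> = \<kappa> ^ (n + q) * Q_sum (2 * q) m n w0"
    unfolding taylor_coeff_moebius_power[OF mult_pos_pos[OF zero_less_numeral assms(4)]] Q_sum_def Q_fun_def R_def[symmetric] by (simp add: power_add mult_ac)
  also have "\<dots> = V ^ (n + q) * (U ^ (q + n) * Q_sum (2 * q) m n w0 / (cnj t) ^ (2 * q + 2 * n))"
  proof -
    have "\<kappa> ^ (n + q) = U ^ (n + q) * V ^ (n + q) / (cnj t) ^ (2 * (n + q))"
      by (simp only: \<kappa>_def power_divide power_mult_distrib power_mult)
    then show ?thesis by (simp add: algebra_simps)
  qed
  also have "\<dots> = V ^ (n + q) * pterm (2 * q + 2 * n) (Q_sum (2 * q) m n) u \<gamma> v"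
    unfolding pterm_eq[OF assms(1-3)] w0[symmetric] J[OF assms(3)] by (simp add: st)
  finally show ?thesis by (simp add: st)
qed

lemma has_sum_finite_sum:
  fixes f :: "'i \<Rightarrow> 'a \<Rightarrow> complex"
  assumes "finite I" "\<And>i. i \<in> I \<Longrightarrow> (f i has_sum s i) A"
  shows "((\<lambda>x. \<Sum>i\<in>I. f i x) has_sum (\<Sum>i\<in>I. s i)) A"
  using assms by (induction I rule: finite_induct) (auto intro!: has_sum_add)

section \<open>Taylor coefficients of Poincare series, term by term\<close>

context fuchsian
begin

text \<open>Near w = 0 the map \<open>sigma\<close> v stays in the ball around v on which
  \<open>pterm_local_bound\<close> applies, so that the majorant there carries over to the disc up
  to the constant \<open>B\<close>.\<close>

lemma poincare_taylor_has_sum: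
  assumes "u \<in> \<H>" "v \<in> \<H>" "2 \<le> q"
  shows "((\<lambda>\<gamma>. (deriv ^^ n) (slash (2 * q) (pterm (2 * q) (\<lambda>w. w ^ m) u \<gamma>) (sigma v)) 0) has_sum
    (deriv ^^ n) (slash (2 * q) (poincare (2 * q) m u) (sigma v)) 0) \<Gamma>"
proof -
  let ?t = "\<lambda>\<gamma>. slash (2 * q) (pterm (2 * q) (\<lambda>w. w ^ m) u \<gamma>) (sigma v)"
  let ?\<sigma> = "\<lambda>w. (v - cnj v * w) / (1 - w)"
  obtain M where M: "M summable_on \<Gamma>"
    "\<And>\<gamma> w. \<gamma> \<in> \<Gamma> \<Longrightarrow> w \<in> ball v (Im v / 2) \<Longrightarrow> cmod (pterm (2 * q) (\<lambda>w. w ^ m) u \<gamma> w) \<le> M \<gamma>"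
    using pterm_local_bound[OF assms] by blast
  have "isCont ?\<sigma> 0" by (intro continuous_intros) auto
  then have "\<exists>\<delta>>0. \<forall>w. dist w 0 < \<delta> \<longrightarrow> dist (?\<sigma> w) (?\<sigma> 0) < Im v / 2"
    by (rule mp[OF spec[OF iffD1[OF continuous_at_eps_delta]], OF _ half_gt_zero]) (use assms(2) in simp)
  then obtain \<delta> where \<delta>: "\<delta> > 0" "\<And>w. cmod w < \<delta> \<Longrightarrow> ?\<sigma> w \<in> ball v (Im v / 2)"
    by (auto simp: dist_commute)
  \<comment> \<open>The bound 1/2 keeps |1 - w| at least 1/2 in the denominator of the
    slash.\<close>
  define r where "r = min \<delta> (1/2)"
  have r: "r > 0" "r \<le> \<delta>" "r \<le> 1/2" using \<delta> by (auto simp: r_def)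
  define B where "B = cmod (v - cnj v) ^ q / (1/2) ^ (2 * q)"
  have sub: "ball 0 r \<subseteq> ball (0::complex) 1" using r by auto
  have b: "cmod (?t \<gamma> w) \<le> M \<gamma> * B" if \<gamma>: "\<gamma> \<in> \<Gamma>" and w: "w \<in> ball 0 r" for \<gamma> w
  proof -
    have "1 \<le> cmod (1 - w) + cmod w" by (metis diff_add_cancel norm_one norm_triangle_ineq)
    then have "1 / 2 \<le> cmod (1 - w)" using w r by simp
    then have p: "(1 / 2) ^ (2 * q) \<le> cmod (1 - w) ^ (2 * q)" by (intro power_mono) auto
    have "?\<sigma> w \<in> ball v (Im v / 2)" using \<delta>(2)[of w] w r by auto
    with M(2)[OF \<gamma>] have "cmod (pterm (2 * q) (\<lambda>w. w ^ m) u \<gamma> (?\<sigma> w)) \<le> M \<gamma>" by blast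
    then have "cmod (?t \<gamma> w) \<le> cmod (v - cnj v) ^ q * M \<gamma> / (1 / 2) ^ (2 * q)"
      unfolding slash_sigma_eq[OF assms(2)] norm_mult norm_divide norm_power
      using p by (intro frac_le mult_left_mono mult_nonneg_nonneg) (auto intro: order.trans[OF norm_ge_zero])
    then show ?thesis by (simp add: B_def mult_ac)
  qed
  have hol: "?t \<gamma> holomorphic_on ball 0 1" if "\<gamma> \<in> \<Gamma>" for \<gamma>
    by (rule slash_sigma_holomorphic[OF assms(2) pterm_holomorphic[OF det1[OF that] assms(1)]])
  have hs: "((\<lambda>\<gamma>. (deriv ^^ n) (?t \<gamma>) 0) has_sum (deriv ^^ n) (\<lambda>w. \<Sum>\<^sub>\<infinity>\<gamma>\<in>\<Gamma>. ?t \<gamma> w) 0) \<Gamma>"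
    and hol_sum: "(\<lambda>w. \<Sum>\<^sub>\<infinity>\<gamma>\<in>\<Gamma>. ?t \<gamma> w) holomorphic_on ball 0 r"
    using holomorphic_infsum[where X = \<Gamma> and t = ?t and z = 0 and r = r and M = "\<lambda>\<gamma>. M \<gamma> * B",
        OF r(1) holomorphic_on_subset[OF hol sub] b summable_on_cmult_left[OF M(1)]] by blast+
  have eq: "(deriv ^^ n) (\<lambda>w. \<Sum>\<^sub>\<infinity>\<gamma>\<in>\<Gamma>. ?t \<gamma> w) 0 = (deriv ^^ n) (slash (2 * q) (poincare (2 * q) m u) (sigma v)) 0"
  proof (rule higher_deriv_transform_within_open[OF hol_sum _ open_ball])
    show "slash (2 * q) (poincare (2 * q) m u) (sigma v) holomorphic_on ball 0 r"
      by (rule holomorphic_on_subset[OF slash_sigma_holomorphic[OF assms(2) poincare_holomorphic[OF assms(1,3)]] sub])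
    show "(\<Sum>\<^sub>\<infinity>\<gamma>\<in>\<Gamma>. ?t \<gamma> w) = slash (2 * q) (poincare (2 * q) m u) (sigma v) w" if "w \<in> ball 0 r" for w
    proof -
      have "?\<sigma> w \<in> \<H>"
        using act_sigma_in_H[OF assms(2), of w] that sub by (auto simp: act_sigma[OF assms(2)])
      then show ?thesis
        unfolding slash_sigma_eq[OF assms(2)] poincare_def
        by (simp add: divide_inverse infsum_cmult_right' infsum_cmult_left')
    qed
  qed (use r in auto)
  from hs show ?thesis unfolding eq .
qed

text \<open>The left-hand side is exactly |w|^(a+l); thus l is the boundary growth that
  \<open>pterm_bound\<close> asks for.\<close>

lemma Q_fun_disc_bound:
  assumes "w \<in> ball 0 1"
  shows "cmod (Q_fun a l w) * (1 - (cmod w)\<^sup>2) ^ l \<le> 1"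
proof -
  have lt: "(cmod w)\<^sup>2 < 1" "cmod w \<le> 1" using assms by (auto simp: abs_square_less_1)
  have "cmod (of_real ((cmod w)\<^sup>2) - 1 :: complex) = cmod (of_real ((cmod w)\<^sup>2 - 1) :: complex)" by simp
  also have "\<dots> = 1 - (cmod w)\<^sup>2" using lt
    by (simp only: norm_of_real abs_of_neg[OF iffD2[OF diff_less_0_iff_less lt(1)]] minus_diff_eq)
  finally have "cmod (Q_fun a l w) * (1 - (cmod w)\<^sup>2) ^ l = cmod w ^ a * cmod w ^ l"
    using lt by (simp add: Q_fun_def norm_mult norm_power norm_divide power_divide)
  also have "\<dots> \<le> 1" using lt by (intro mult_le_one power_le_one) auto
  finally show ?thesis .
qed

lemma elliptic_coeff_poincare:
  assumes "u \<in> \<H>" "v \<in> \<H>" "2 \<le> q"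
  shows "elliptic_coeff (2 * q) v (poincare (2 * q) m u) n = (v - cnj v) ^ (n + q) *
    (\<Sum>j=0..n. of_nat (m choose j) * of_nat ((n + 2 * q - 1) choose (n - j)) *
       G_series \<Gamma> (2 * q + 2 * n) v u (m - j) (n - j))"
proof -
  let ?c = "\<lambda>j. of_nat (m choose j) * of_nat ((n + 2 * q - 1) choose (n - j)) :: complex"
  have ec: "elliptic_coeff (2 * q) v (poincare (2 * q) m u) n =
      (deriv ^^ n) (slash (2 * q) (poincare (2 * q) m u) (sigma v)) 0 * (1 / fact n)"
    by (subst elliptic_coeff_sums(2)[OF assms(2) poincare_holomorphic[OF assms(1,3)], where w = 0]) simp_all
  have "((\<lambda>\<gamma>. (deriv ^^ n) (slash (2 * q) (pterm (2 * q) (\<lambda>w. w ^ m) u \<gamma>) (sigma v)) 0 * (1 / fact n)) has_sum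
    (deriv ^^ n) (slash (2 * q) (poincare (2 * q) m u) (sigma v)) 0 * (1 / fact n)) \<Gamma>"
    by (intro has_sum_cmult_left poincare_taylor_has_sum assms)
  then have "((\<lambda>\<gamma>. (v - cnj v) ^ (n + q) * pterm (2 * q + 2 * n) (Q_sum (2 * q) m n) u \<gamma> v) has_sum
    elliptic_coeff (2 * q) v (poincare (2 * q) m u) n) \<Gamma>"
    using assms(3) unfolding ec by (simp add: taylor_coeff_pterm[OF det1 assms(1,2)] cong: has_sum_cong)
  then have "elliptic_coeff (2 * q) v (poincare (2 * q) m u) n =
      (\<Sum>\<^sub>\<infinity>\<gamma>\<in>\<Gamma>. (v - cnj v) ^ (n + q) * pterm (2 * q + 2 * n) (Q_sum (2 * q) m n) u \<gamma> v)"
    by (simp add: infsumI)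
  also have "\<dots> = (v - cnj v) ^ (n + q) * (\<Sum>\<^sub>\<infinity>\<gamma>\<in>\<Gamma>. pterm (2 * q + 2 * n) (Q_sum (2 * q) m n) u \<gamma> v)"
    by (rule infsum_cmult_right')
  also have "(\<Sum>\<^sub>\<infinity>\<gamma>\<in>\<Gamma>. pterm (2 * q + 2 * n) (Q_sum (2 * q) m n) u \<gamma> v) =
    (\<Sum>j=0..n. ?c j * G_series \<Gamma> (2 * q + 2 * n) v u (m - j) (n - j))"
  proof (rule infsumI)
    have "((\<lambda>\<gamma>. \<Sum>j=0..n. ?c j * pterm (2 * q + 2 * n) (Q_fun (m - j) (n - j)) u \<gamma> v) has_sum
      (\<Sum>j=0..n. ?c j * G_series \<Gamma> (2 * q + 2 * n) v u (m - j) (n - j))) \<Gamma>"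
    proof (intro has_sum_finite_sum has_sum_cmult_right finite_atLeastAtMost)
      fix j assume "j \<in> {0..n}"
      \<comment> \<open>Half the weight is now q + n, which leaves the two spare powers required: (n
        - j) + 2 \<le> q + n.\<close>
      have "(\<lambda>\<gamma>. cmod (pterm (2 * (q + n)) (Q_fun (m - j) (n - j)) u \<gamma> v)) summable_on \<Gamma>"
        using assms(3) by (intro pterm_summable[where l = "n - j"] assms(1,2) Q_fun_disc_bound) auto
      then have "(\<lambda>\<gamma>. pterm (2 * q + 2 * n) (Q_fun (m - j) (n - j)) u \<gamma> v) summable_on \<Gamma>"
        using abs_summable_summable by (simp add: algebra_simps)
      then show "((\<lambda>\<gamma>. pterm (2 * q + 2 * n) (Q_fun (m - j) (n - j)) u \<gamma> v) has_sum
        G_series \<Gamma> (2 * q + 2 * n) v u (m - j) (n - j)) \<Gamma>"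
        unfolding G_series_def pterm_def by (rule has_sum_infsum)
    qed
    moreover have "(\<Sum>j=0..n. ?c j * pterm (2 * q + 2 * n) (Q_fun (m - j) (n - j)) u \<gamma> v) =
      pterm (2 * q + 2 * n) (Q_sum (2 * q) m n) u \<gamma> v" for \<gamma>
      unfolding pterm_def slash_def Q_sum_def by (simp add: sum_distrib_left sum_divide_distrib mult_ac)
    ultimately show "((\<lambda>\<gamma>. pterm (2 * q + 2 * n) (Q_sum (2 * q) m n) u \<gamma> v) has_sum
      (\<Sum>j=0..n. ?c j * G_series \<Gamma> (2 * q + 2 * n) v u (m - j) (n - j))) \<Gamma>" by simp
  qed
  finally show ?thesis .
qed

end

section \<open>Integration over the unit disc\<close>

lemma emeasure_disc_annulus:
  "emeasure lborel {w \<in> ball (0::complex) 1. x < (cmod w)\<^sup>2} = ennreal pi * emeasure lborel {max 0 x<..<1}"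
proof -
  consider "x < 0" | "0 \<le> x" "x < 1" | "1 \<le> x" by linarith
  then show ?thesis
  proof cases
    case 1
    then have "{w \<in> ball (0::complex) 1. x < (cmod w)\<^sup>2} = ball 0 1"
      using less_le_trans[OF 1 zero_le_power2] by auto
    with 1 show ?thesis by (simp add: emeasure_ball unit_ball_vol_2)
  next
    case 2
    have "x < (cmod w)\<^sup>2 \<longleftrightarrow> sqrt x < cmod w" for w :: complex
      by (subst real_sqrt_less_iff[symmetric]) simp
    then have eq: "{w \<in> ball (0::complex) 1. x < (cmod w)\<^sup>2} = ball 0 1 - cball 0 (sqrt x)"
      by (simp only: set_eq_iff mem_Collect_eq Diff_iff mem_cball_0 not_le simp_thms)
    have "sqrt x < 1" using 2 by simp
    then have sub: "cball (0::complex) (sqrt x) \<subseteq> ball 0 1"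
      by (intro subsetI) (metis mem_ball_0 mem_cball_0 le_less_trans)
    have "emeasure lborel (ball (0::complex) 1 - cball 0 (sqrt x)) = ennreal pi - ennreal (pi * x)"
      using 2 sub by (subst emeasure_Diff) (auto simp: emeasure_ball emeasure_cball unit_ball_vol_2)
    also have "\<dots> = ennreal (pi * (1 - x))"
      using 2 by (subst ennreal_minus) (auto simp: right_diff_distrib)
    finally show ?thesis unfolding eq using 2 by (simp add: ennreal_mult max_def)
  next
    case 3
    have "\<not> x < (cmod w)\<^sup>2" if "w \<in> ball 0 1" for w :: complex
      using 3 that abs_square_less_1[of "cmod w"] by simp
    then have eq: "{w \<in> ball (0::complex) 1. x < (cmod w)\<^sup>2} = {}" by blast
    show ?thesis unfolding eq using 3 by simp
  qed
qed

text \<open>Polar coordinates for radial functions, without angles: the part of the disc with |w|^2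
  > x has area pi (1 - x) for x between 0 and 1, which is linear in x, and half-lines determine the
  image measure.\<close>

lemma distr_disc_square:
  "distr (density lborel (\<lambda>w. indicator (ball (0::complex) 1) w)) borel (\<lambda>w. (cmod w)\<^sup>2) =
   density lborel (\<lambda>t. ennreal pi * indicator {0<..<1} t)"
proof (rule measure_eqI_lessThan)
  fix x :: real
  have "(\<lambda>w. (cmod w)\<^sup>2) -` {x<..} = {w. x < (cmod w)\<^sup>2}" by auto
  then have 1: "emeasure (distr (density lborel (\<lambda>w. indicator (ball (0::complex) 1) w)) borel (\<lambda>w. (cmod w)\<^sup>2)) {x<..}
    = (\<integral>\<^sup>+w. indicator (ball 0 1) w * indicator {w. x < (cmod w)\<^sup>2} w \<partial>lborel)"
    by (simp add: emeasure_distr emeasure_density)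
  also have "\<dots> = (\<integral>\<^sup>+w. indicator {w \<in> ball (0::complex) 1. x < (cmod w)\<^sup>2} w \<partial>lborel)"
    by (intro nn_integral_cong) (auto simp: indicator_def)
  also have "\<dots> = ennreal pi * emeasure lborel {max 0 x<..<1}"
    by (subst nn_integral_indicator, measurable) (rule emeasure_disc_annulus)
  finally have 2: "emeasure (distr (density lborel (\<lambda>w. indicator (ball (0::complex) 1) w)) borel (\<lambda>w. (cmod w)\<^sup>2)) {x<..}
    = ennreal pi * emeasure lborel {max 0 x<..<1}" .
  have "emeasure (density lborel (\<lambda>t. ennreal pi * indicator {0<..<1} t)) {x<..} =
    (\<integral>\<^sup>+t. ennreal pi * indicator {0<..<1} t * indicator {x<..} t \<partial>lborel)"
    by (simp add: emeasure_density)
  also have "\<dots> = (\<integral>\<^sup>+t. ennreal pi * indicator {max 0 x<..<1} t \<partial>lborel)"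
    by (intro nn_integral_cong) (auto simp: indicator_def)
  also have "\<dots> = ennreal pi * emeasure lborel {max 0 x<..<1}"
    by (simp add: nn_integral_cmult_indicator)
  finally show "emeasure (distr (density lborel (\<lambda>w. indicator (ball (0::complex) 1) w)) borel (\<lambda>w. (cmod w)\<^sup>2)) {x<..} =
    emeasure (density lborel (\<lambda>t. ennreal pi * indicator {0<..<1} t)) {x<..}"
    using 2 by simp
  show "emeasure (distr (density lborel (\<lambda>w. indicator (ball (0::complex) 1) w)) borel (\<lambda>w. (cmod w)\<^sup>2)) {x<..} < \<infinity>"
  proof -
    have "emeasure lborel {max 0 x<..<1} \<le> emeasure lborel {0..1::real}"
      by (intro emeasure_mono) auto
    then have "emeasure lborel {max 0 x<..<1} < \<infinity>" by (rule le_less_trans) simp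
    then show ?thesis unfolding 2 by (simp add: ennreal_mult_less_top)
  qed
qed simp_all

lemma Beta_nat: "Beta (real m + 1) (real l + 1) = fact m * fact l / fact (m + l + 1)"
proof -
  have "Beta (real m + 1) (real l + 1) = Gamma (1 + real m) * Gamma (1 + real l) / Gamma (1 + real (m + l + 1))"
    by (simp add: Beta_def add_ac)
  then show ?thesis by (simp only: Gamma_fact)
qed

text \<open>With t = |w|^2 this is pi times the Beta integral of t^m (1 - t)^l.\<close>

lemma disc_moment_has_bochner_integral:
  "has_bochner_integral lborel (\<lambda>w. indicator (ball (0::complex) 1) w * (((cmod w)\<^sup>2) ^ m * (1 - (cmod w)\<^sup>2) ^ l))
     (pi * (fact m * fact l / fact (m + l + 1)))"
proof (rule has_bochner_integral_nn_integral)
  let ?g = "\<lambda>t::real. t ^ m * (1 - t) ^ l"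
  have nn: "0 \<le> ?g t" if "t \<in> {0<..<1}" for t using that by auto
  have "((\<lambda>t. t powr (real m + 1 - 1) * (1 - t) powr (real l + 1 - 1)) has_integral Beta (real m + 1) (real l + 1)) {0<..<1}"
    using has_integral_Beta_real[of "real m + 1" "real l + 1"] by (simp add: has_integral_Icc_iff_Ioo)
  then have hi: "(?g has_integral Beta (real m + 1) (real l + 1)) {0<..<1}"
    by (rule has_integral_eq[rotated]) (auto simp: powr_realpow)
  have "(\<integral>\<^sup>+w. ennreal (indicator (ball (0::complex) 1) w * (((cmod w)\<^sup>2) ^ m * (1 - (cmod w)\<^sup>2) ^ l)) \<partial>lborel)
    = (\<integral>\<^sup>+w. indicator (ball (0::complex) 1) w * ennreal (?g ((cmod w)\<^sup>2)) \<partial>lborel)"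
    by (intro nn_integral_cong) (auto simp: indicator_def)
  also have "\<dots> = (\<integral>\<^sup>+w. ennreal (?g ((cmod w)\<^sup>2)) \<partial>density lborel (\<lambda>w. indicator (ball (0::complex) 1) w))"
    by (rule nn_integral_density[symmetric]; measurable)
  also have "\<dots> = (\<integral>\<^sup>+t. ennreal (?g t) \<partial>distr (density lborel (\<lambda>w. indicator (ball (0::complex) 1) w)) borel (\<lambda>w. (cmod w)\<^sup>2))"
    by (rule nn_integral_distr[symmetric]; measurable)
  also have "\<dots> = (\<integral>\<^sup>+t. ennreal pi * indicator {0<..<1} t * ennreal (?g t) \<partial>lborel)"
    unfolding distr_disc_square by (rule nn_integral_density; measurable)
  also have "\<dots> = (\<integral>\<^sup>+t. ennreal pi * (ennreal (?g t) * indicator {0<..<1} t) \<partial>lborel)"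
    by (simp add: mult_ac)
  also have "\<dots> = ennreal pi * (\<integral>\<^sup>+t. ennreal (?g t) * indicator {0<..<1} t \<partial>lborel)"
    by (rule nn_integral_cmult) measurable
  also have "(\<integral>\<^sup>+t. ennreal (?g t) * indicator {0<..<1} t \<partial>lborel) = ennreal (Beta (real m + 1) (real l + 1))"
    by (rule nn_integral_has_integral_lebesgue'[OF nn hi])
  finally show "(\<integral>\<^sup>+w. ennreal (indicator (ball (0::complex) 1) w * (((cmod w)\<^sup>2) ^ m * (1 - (cmod w)\<^sup>2) ^ l)) \<partial>lborel)
    = ennreal (pi * (fact m * fact l / fact (m + l + 1)))"
    by (simp only: Beta_nat ennreal_mult'[OF pi_ge_zero])
  show "AE w in lborel. 0 \<le> indicator (ball (0::complex) 1) w * (((cmod w)\<^sup>2) ^ m * (1 - (cmod w)\<^sup>2) ^ l)"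
    by (intro AE_I2) (auto simp: indicator_def abs_square_le_1)
qed auto

section \<open>Orthogonality of monomials on the disc\<close>

lemma lborel_rotate:
  assumes "cmod \<zeta> = 1"
  shows "distr lborel borel (\<lambda>z. \<zeta> * z) = (lborel :: complex measure)"
proof -
  have nz: "\<zeta> \<noteq> 0" using assms by auto
  have "distr (density lborel (\<lambda>z. indicator UNIV z * (ennreal ((cmod \<zeta>)\<^sup>2) * 1))) borel (\<lambda>z. \<zeta> * z)
     = density lborel (\<lambda>z::complex. indicator UNIV z * 1)"
    by (rule distr_holomorphic[where h = "\<lambda>z. z / \<zeta>" and \<rho> = "\<lambda>_. 1" and g' = "\<lambda>_. \<zeta>"])
      (use nz in \<open>auto intro!: derivative_eq_intros\<close>)
  then show ?thesis using assms by (simp add: density_1)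
qed

text \<open>A suitable rotation preserves the measure and reverses the sign of the integrand. If the
  integrand is not integrable, its Bochner integral is 0 by convention, in agreement with the
  claim.\<close>

lemma rotation_integral_zero:
  fixes \<rho> :: "real \<Rightarrow> real"
  assumes "j \<noteq> m" and [measurable]: "\<rho> \<in> borel_measurable borel"
  shows "(\<integral>w. of_real (\<rho> (cmod w)) * (w ^ j * cnj w ^ m) \<partial>lborel) = (0 :: complex)"
proof -
  \<comment> \<open>An argument of pi / (j - m) gives \<open>\<zeta>\<close>^j
    cnj(\<open>\<zeta>\<close>)^m = exp(i pi) = -1.\<close>
  define \<zeta> where "\<zeta> = cis (pi / (real j - real m))"
  let ?f = "\<lambda>w. of_real (\<rho> (cmod w)) * (w ^ j * cnj w ^ m) :: complex"
  have \<zeta>: "cmod \<zeta> = 1" by (simp add: \<zeta>_def)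
  have "\<zeta> ^ j * cnj \<zeta> ^ m = cis (real j * (pi / (real j - real m)) - real m * (pi / (real j - real m)))"
    by (simp only: \<zeta>_def cis_cnj cis_inverse Complex.DeMoivre cis_mult) (simp add: cis_mult Complex.DeMoivre flip: cis_cnj)
  also have "real j * (pi / (real j - real m)) - real m * (pi / (real j - real m)) = pi"
  proof -
    have "real j * (pi / (real j - real m)) - real m * (pi / (real j - real m)) = (real j - real m) * (pi / (real j - real m))"
      by (rule left_diff_distrib[symmetric])
    then show ?thesis using assms(1) by simp
  qed
  finally have z: "\<zeta> ^ j * cnj \<zeta> ^ m = -1" by simp
  have "integral\<^sup>L lborel ?f = integral\<^sup>L (distr lborel borel (\<lambda>z. \<zeta> * z)) ?f"
    by (simp only: lborel_rotate[OF \<zeta>])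
  also have "\<dots> = (\<integral>w. ?f (\<zeta> * w) \<partial>lborel)"
    by (rule integral_distr; measurable)
  also have "\<dots> = (\<integral>w. (\<zeta> ^ j * cnj \<zeta> ^ m) * ?f w \<partial>lborel)"
    using \<zeta> by (intro Bochner_Integration.integral_cong) (auto simp: norm_mult power_mult_distrib)
  also have "\<dots> = - integral\<^sup>L lborel ?f" unfolding z by simp
  finally show ?thesis by simp
qed

lemma integrable_disc_bounded:
  fixes f :: "complex \<Rightarrow> complex"
  assumes [measurable]: "f \<in> borel_measurable borel" and "r \<le> 1" "\<And>w. w \<in> ball 0 r \<Longrightarrow> cmod (f w) \<le> B"
  shows "integrable lborel (\<lambda>w. of_real (indicator (ball 0 r) w) * f w)"
proof (rule Bochner_Integration.integrable_bound)
  show "integrable lborel (\<lambda>w. B * indicator (ball (0::complex) r) w)"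
    using emeasure_lborel_ball_finite[of "0::complex" r] by (intro integrable_mult_right integrable_real_indicator) auto
  show "AE w in lborel. cmod (of_real (indicator (ball 0 r) w) * f w) \<le> norm (B * indicator (ball (0::complex) r) w)"
    using assms(3) by (intro AE_I2) (force simp: indicator_def intro: order.trans[OF _ abs_ge_self])
qed measurable

text \<open>On the whole disc the power series cannot be integrated termwise without further
  control. On a smaller disc of radius r it converges absolutely with a summable bound, and only the
  term j = m survives. As r tends to 1, dominated convergence applies to both sides of
  \<open>trunc\<close>: to the given integrand and to the moment of w^m.\<close>

lemma disc_orthogonality:
  fixes h :: "complex \<Rightarrow> complex" and c :: "nat \<Rightarrow> complex"
  assumes sums: "\<And>w. w \<in> ball 0 1 \<Longrightarrow> (\<lambda>j. c j * w ^ j) sums h w"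
    and int: "integrable lborel (\<lambda>w. of_real (indicator (ball 0 1) w) * (h w * cnj w ^ m * of_real ((1 - (cmod w)\<^sup>2) ^ l)))"
  shows "(\<integral>w. of_real (indicator (ball 0 1) w) * (h w * cnj w ^ m * of_real ((1 - (cmod w)\<^sup>2) ^ l)) \<partial>lborel)
    = c m * of_real (pi * (fact m * fact l / fact (m + l + 1)))"
proof -
  let ?F = "\<lambda>w. h w * cnj w ^ m * of_real ((1 - (cmod w)\<^sup>2) ^ l)"
  \<comment> \<open>The shift by 2 makes r(0) = 1/2, so all radii lie strictly between 0 and
    1.\<close>
  define r where "r n = 1 - 1 / (real n + 2)" for n
  have r: "0 < r n" "r n < 1" for n by (auto simp: r_def field_simps)
  define \<rho> where "\<rho> n t = indicator {..<r n} t * (1 - t\<^sup>2) ^ l" for n and t :: real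
  have [measurable]: "\<rho> n \<in> borel_measurable borel" for n unfolding \<rho>_def by measurable
  have \<rho>: "of_real (\<rho> n (cmod w)) = of_real (indicator (ball 0 (r n)) w) * (of_real ((1 - (cmod w)\<^sup>2) ^ l) :: complex)" for n w
    by (auto simp: \<rho>_def indicator_def)
  have trunc: "(\<integral>w. of_real (indicator (ball 0 (r n)) w) * ?F w \<partial>lborel) =
    c m * (\<integral>w. of_real (\<rho> n (cmod w)) * (w ^ m * cnj w ^ m) \<partial>lborel)" for n
  proof -
    let ?t = "\<lambda>j w. c j * (of_real (\<rho> n (cmod w)) * (w ^ j * cnj w ^ m))"
    have \<rho>_le: "\<bar>\<rho> n (cmod w)\<bar> \<le> indicator (ball 0 (r n)) w" for w :: complex
    proof (cases "cmod w < r n")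
      case True
      then have "(cmod w)\<^sup>2 \<le> 1" using r[of n] by (simp add: abs_square_le_1)
      then show ?thesis using True by (auto simp: \<rho>_def indicator_def abs_mult power_abs intro!: power_le_one)
    qed (auto simp: \<rho>_def)
    have nt: "cmod (?t j w) \<le> cmod (c j) * r n ^ j * indicator (ball 0 (r n)) w" for j w
    proof (cases "cmod w < r n")
      case True
      have "\<bar>\<rho> n (cmod w)\<bar> * (cmod w ^ j * cmod w ^ m) \<le> 1 * (r n ^ j * 1)"
        using True r[of n] \<rho>_le[of w]
        by (intro mult_mono power_mono power_le_one) auto
      then show ?thesis using True
        by (simp add: norm_mult norm_power mult_left_mono)
    qed (auto simp: \<rho>_def)
    have sm: "summable (\<lambda>j. cmod (c j) * r n ^ j)"
    proof -
      \<comment> \<open>A point strictly between r and 1: convergence there gives absolute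
        convergence at radius r.\<close>
      define R where "R = (r n + 1) / 2"
      have R: "r n < R" "R < 1" using r[of n] by (auto simp: R_def)
      have "of_real R \<in> ball (0::complex) 1" using R r[of n] by simp
      from sums[OF this] have "summable (\<lambda>j. c j * of_real R ^ j)" by (simp add: sums_iff)
      then have "summable (\<lambda>j. norm (c j * (of_real (r n)) ^ j))"
        by (rule powser_insidea) (use R r[of n] in auto)
      then show ?thesis using r[of n] by (simp add: norm_mult norm_power)
    qed
    have it: "integrable lborel (?t j)" for j
    proof -
      have "cmod (?t j w) \<le> cmod (c j) * r n ^ j" if "w \<in> ball 0 (r n)" for w
        using nt[of j w] that by simp
      then have "integrable lborel (\<lambda>w. of_real (indicator (ball 0 (r n)) w) * ?t j w)"
        using r[of n] by (intro integrable_disc_bounded[where B = "cmod (c j) * r n ^ j"]) auto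
      also have "(\<lambda>w. of_real (indicator (ball 0 (r n)) w) * ?t j w) = ?t j"
        by (auto simp: \<rho>_def indicator_def)
      finally show ?thesis .
    qed
    have ae: "AE w in lborel. summable (\<lambda>j. cmod (?t j w))"
    proof (intro AE_I2)
      fix w :: complex
      have "summable (\<lambda>j. cmod (c j) * r n ^ j * indicator (ball 0 (r n)) w)" using sm by (rule summable_mult2)
      then show "summable (\<lambda>j. cmod (?t j w))"
        by (rule summable_comparison_test_ev[rotated]) (use nt in auto)
    qed
    have fin: "emeasure lborel (ball (0::complex) (r n)) < \<infinity>" by (rule emeasure_lborel_ball_finite)
    have si: "summable (\<lambda>j. \<integral>w. cmod (?t j w) \<partial>lborel)"
    proof (rule summable_comparison_test')
      show "summable (\<lambda>j. cmod (c j) * r n ^ j * measure lborel (ball (0::complex) (r n)))" using sm by (rule summable_mult2)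
      fix j :: nat
      have "(\<integral>w. cmod (?t j w) \<partial>lborel) \<le> (\<integral>w. cmod (c j) * r n ^ j * indicator (ball (0::complex) (r n)) w \<partial>lborel)"
        using fin by (intro integral_mono[OF integrable_norm[OF it] _ nt] integrable_mult_right integrable_real_indicator) auto
      also have "\<dots> = cmod (c j) * r n ^ j * measure lborel (ball (0::complex) (r n))" by simp
      finally show "norm (\<integral>w. cmod (?t j w) \<partial>lborel) \<le> cmod (c j) * r n ^ j * measure lborel (ball (0::complex) (r n))"
        by simp
    qed
    have "(\<lambda>j. \<integral>w. ?t j w \<partial>lborel) sums (\<integral>w. (\<Sum>j. ?t j w) \<partial>lborel)"
      by (rule sums_integral[OF it ae si])
    also have "(\<lambda>j. \<integral>w. ?t j w \<partial>lborel) = (\<lambda>j. if j = m then c m * (\<integral>w. of_real (\<rho> n (cmod w)) * (w ^ m * cnj w ^ m) \<partial>lborel) else 0)"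
      using rotation_integral_zero[of _ m "\<rho> n"] by auto
    finally have 1: "\<dots> sums (\<integral>w. (\<Sum>j. ?t j w) \<partial>lborel)" .
    have "(\<integral>w. (\<Sum>j. ?t j w) \<partial>lborel) = c m * (\<integral>w. of_real (\<rho> n (cmod w)) * (w ^ m * cnj w ^ m) \<partial>lborel)"
      using sums_unique2[OF 1 sums_single[of m "\<lambda>_. c m * (\<integral>w. of_real (\<rho> n (cmod w)) * (w ^ m * cnj w ^ m) \<partial>lborel)"]] by simp
    moreover have "(\<Sum>j. ?t j w) = of_real (indicator (ball 0 (r n)) w) * ?F w" for w
    proof (cases "w \<in> ball 0 (r n)")
      case True
      then have "w \<in> ball 0 1" using r[of n] by auto
      have "(\<lambda>j. c j * w ^ j * (of_real (\<rho> n (cmod w)) * cnj w ^ m)) sums (h w * (of_real (\<rho> n (cmod w)) * cnj w ^ m))"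
        by (rule sums_mult2[OF sums[OF \<open>w \<in> ball 0 1\<close>]])
      then show ?thesis using True unfolding \<rho> by (simp add: sums_iff mult_ac)
    next
      case False
      then have "\<rho> n (cmod w) = 0" by (simp add: \<rho>_def)
      then show ?thesis using False by simp
    qed
    ultimately show ?thesis by simp
  qed
  have r_lim: "\<forall>\<^sub>F n in sequentially. w \<in> ball 0 (r n)" if "w \<in> ball 0 1" for w :: complex
  proof -
    have "r \<longlonglongrightarrow> 1" unfolding r_def by real_asymp
    then have "\<forall>\<^sub>F n in sequentially. cmod w < r n" by (rule order_tendstoD) (use that in simp)
    then show ?thesis by simp
  qed
  have ind_lim: "(\<lambda>n. of_real (indicator (ball 0 (r n)) w) * G w) \<longlonglongrightarrow> of_real (indicator (ball 0 1) w) * (G w :: complex)" for G and w :: complex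
  proof (cases "w \<in> ball 0 1")
    case True
    have "\<forall>\<^sub>F n in sequentially. of_real (indicator (ball 0 (r n)) w) * G w = of_real (indicator (ball 0 1) w) * G w"
      using r_lim[OF True] by eventually_elim (use True in simp)
    then show ?thesis by (rule tendsto_eventually)
  next
    case False
    then have "w \<notin> ball 0 (r n)" for n using r[of n] by auto
    with False show ?thesis by simp
  qed
  have dom: "(\<lambda>n. \<integral>w. of_real (indicator (ball 0 (r n)) w) * G w \<partial>lborel) \<longlonglongrightarrow> (\<integral>w. of_real (indicator (ball 0 1) w) * (G w :: complex) \<partial>lborel)"
    if G: "integrable lborel (\<lambda>w. of_real (indicator (ball 0 1) w) * G w)" for G :: "complex \<Rightarrow> complex"
  proof (rule integral_dominated_convergence[where w = "\<lambda>w. cmod (of_real (indicator (ball 0 1) w) * G w)"])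
    have eq: "of_real (indicator (ball 0 (r n)) w) * G w = of_real (indicator (ball 0 (r n)) w) * (of_real (indicator (ball 0 1) w) * G w)" for n w
      using r[of n] by (auto simp: indicator_def)
    show "(\<lambda>w. of_real (indicator (ball 0 (r n)) w) * G w) \<in> borel_measurable lborel" for n
      by (subst eq, rule borel_measurable_times[OF _ borel_measurable_integrable[OF G]]) measurable
    show "(\<lambda>w. of_real (indicator (ball 0 1) w) * G w) \<in> borel_measurable lborel" using G by simp
    show "AE w in lborel. (\<lambda>n. of_real (indicator (ball 0 (r n)) w) * G w) \<longlonglongrightarrow> of_real (indicator (ball 0 1) w) * G w"
    proof (rule AE_I2)
      fix w
      show "(\<lambda>n. of_real (indicator (ball 0 (r n)) w) * G w) \<longlonglongrightarrow> of_real (indicator (ball 0 1) w) * G w"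
        by (rule ind_lim[of w G])
    qed
    show "AE w in lborel. cmod (of_real (indicator (ball 0 (r n)) w) * G w) \<le> cmod (of_real (indicator (ball 0 1) w) * G w)" for n
      using r[of n] by (intro AE_I2) (auto simp: indicator_def)
  qed (use G in \<open>simp add: integrable_norm\<close>)
  define M where "M = pi * (fact m * fact l / fact (m + l + 1))"
  have "has_bochner_integral lborel (\<lambda>w. complex_of_real (indicator (ball (0::complex) 1) w * (((cmod w)\<^sup>2) ^ m * (1 - (cmod w)\<^sup>2) ^ l))) (of_real M)"
    unfolding M_def by (rule has_bochner_integral_of_real[OF disc_moment_has_bochner_integral])
  also have "(\<lambda>w. complex_of_real (indicator (ball (0::complex) 1) w * (((cmod w)\<^sup>2) ^ m * (1 - (cmod w)\<^sup>2) ^ l))) =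
    (\<lambda>w. of_real (indicator (ball 0 1) w) * (of_real ((1 - (cmod w)\<^sup>2) ^ l) * (w ^ m * cnj w ^ m)))"
  proof -
    have "complex_of_real (((cmod w)\<^sup>2) ^ m) = w ^ m * cnj w ^ m" for w
      by (subst of_real_power) (simp only: complex_norm_square power_mult_distrib)
    then show ?thesis by (intro ext) (simp only: of_real_mult mult_ac)
  qed
  finally have M: "integrable lborel (\<lambda>w. of_real (indicator (ball 0 1) w) * (of_real ((1 - (cmod w)\<^sup>2) ^ l) * (w ^ m * cnj w ^ m)))"
      "(\<integral>w. of_real (indicator (ball 0 1) w) * (of_real ((1 - (cmod w)\<^sup>2) ^ l) * (w ^ m * cnj w ^ m)) \<partial>lborel) = of_real M"
    by (auto simp: has_bochner_integral_iff)
  have "(\<lambda>n. c m * (\<integral>w. of_real (indicator (ball 0 (r n)) w) * (of_real ((1 - (cmod w)\<^sup>2) ^ l) * (w ^ m * cnj w ^ m)) \<partial>lborel)) \<longlonglongrightarrow> c m * of_real M"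
    using dom[OF M(1)] unfolding M(2) by (intro tendsto_mult_left)
  moreover have "(\<lambda>n. c m * (\<integral>w. of_real (indicator (ball 0 (r n)) w) * (of_real ((1 - (cmod w)\<^sup>2) ^ l) * (w ^ m * cnj w ^ m)) \<partial>lborel))
      \<longlonglongrightarrow> (\<integral>w. of_real (indicator (ball 0 1) w) * ?F w \<partial>lborel)"
    using dom[OF int] unfolding trunc \<rho> by (simp only: mult.assoc)
  ultimately show ?thesis unfolding M_def by (rule LIMSEQ_unique[rotated])
qed

section \<open>The pairing with a single summand, computed in the disc\<close>

lemma disc_measure_eq:
  "disc_measure = density lborel (\<lambda>w. ennreal (indicator (ball 0 1) w * (4 / (1 - (cmod w)\<^sup>2)\<^sup>2)))"
  unfolding disc_measure_def by (intro density_cong AE_I2) (auto simp: indicator_def)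

lemma holomorphic_H_measurable:
  assumes "f holomorphic_on \<H>" "\<And>z. z \<notin> \<H> \<Longrightarrow> f z = 0"
  shows "f \<in> borel_measurable borel"
proof -
  have "(\<lambda>z. if z \<in> \<H> then f z else 0) \<in> borel_measurable borel"
    by (rule borel_measurable_continuous_on_if)
      (use assms(1) H_measurable in \<open>auto intro!: holomorphic_on_imp_continuous_on\<close>)
  also have "(\<lambda>z. if z \<in> \<H> then f z else 0) = f" using assms(2) by auto
  finally show ?thesis .
qed

definition petersson_integrand :: "nat \<Rightarrow> (complex \<Rightarrow> complex) \<Rightarrow> (complex \<Rightarrow> complex) \<Rightarrow> complex \<Rightarrow> complex" where
  "petersson_integrand k f g z = f z * cnj (g z) * of_real (Im z ^ k)"

lemma pterm_one:
  assumes "u \<in> \<H>" "z \<in> \<H>"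
  shows "pterm (2 * q) f u (mat 1) z = (u - cnj u) ^ q * f ((z - u) / (z - cnj u)) / (z - cnj u) ^ (2 * q)"
  by (simp add: pterm_eq[OF det_I assms] cmat_one act_one j_factor_one)

text \<open>In the coordinate w all factors 1 - w and u - cnj u are absorbed by the slash of f or
  cancel. From y^(2q) there remain (1 - |w|^2)^(2q) and the constant 2^(-2q), as Im u = (u - cnj u)
  / (2 i).\<close>

lemma petersson_integrand_disc:
  assumes "u \<in> \<H>" "w \<in> ball 0 1"
  shows "petersson_integrand (2 * q) f (pterm (2 * q) (\<lambda>w. w ^ m) u (mat 1)) (act (sigma u) w) =
    slash (2 * q) f (sigma u) w * cnj w ^ m * of_real ((1 - (cmod w)\<^sup>2) ^ (2 * q)) / 2 ^ (2 * q)"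
proof -
  define z where "z = act (sigma u) w"
  define U where "U = u - cnj u"
  define e where "e = 1 - (cmod w)\<^sup>2"
  have z: "z \<in> \<H>" unfolding z_def by (rule act_sigma_in_H[OF assms])
  have w1: "1 - w \<noteq> 0" by (rule disc_ne1[OF assms(2)])
  have cw1: "cnj (1 - w) \<noteq> 0" using w1 by (simp only: complex_cnj_zero_iff not_False_eq_True)
  have U0: "U \<noteq> 0" unfolding U_def by (rule H_diff_cnj[OF assms(1)])
  have zeq: "z = (u - cnj u * w) / (1 - w)" by (simp add: z_def act_sigma[OF assms(1)])
  have zu: "z - cnj u = U / (1 - w)" unfolding zeq U_def using w1 by (simp add: field_simps)
  have "(z - u) / (z - cnj u) = w" using sigma_inv1[OF assms] by (simp add: z_def act_matrix_inv_sigma[OF assms(1)])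
  then have \<phi>: "pterm (2 * q) (\<lambda>w. w ^ m) u (mat 1) z = U ^ q * w ^ m / (U / (1 - w)) ^ (2 * q)"
    unfolding pterm_one[OF assms(1) z] by (simp only: zu U_def)
  have "cnj U = - U" by (simp add: U_def)
  have "complex_of_real (Im z) = of_real (Im u) * of_real e / ((1 - w) * cnj (1 - w))"
    unfolding z_def Im_act_sigma[OF assms] e_def complex_norm_square[symmetric] by simp
  moreover have "complex_of_real (Im u) = U / (2 * \<i>)" by (simp add: U_def diff_cnj_eq)
  ultimately have y: "complex_of_real (Im z) = U * of_real e / (2 * \<i> * (1 - w) * cnj (1 - w))"
    by (simp only: times_divide_eq_left divide_divide_eq_left mult.assoc)
  have sl: "slash (2 * q) f (sigma u) w = U ^ q * f z / (1 - w) ^ (2 * q)"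
    unfolding slash_sigma_eq[OF assms(1)] zeq U_def ..
  have "petersson_integrand (2 * q) f (pterm (2 * q) (\<lambda>w. w ^ m) u (mat 1)) z =
    f z * ((- U) ^ q * cnj w ^ m / (- U / cnj (1 - w)) ^ (2 * q)) * (U * of_real e / (2 * \<i> * (1 - w) * cnj (1 - w))) ^ (2 * q)"
    unfolding petersson_integrand_def \<phi> of_real_power y[symmetric] using \<open>cnj U = - U\<close> by simp
  also have "\<dots> = (U ^ q * f z / (1 - w) ^ (2 * q)) * cnj w ^ m * of_real e ^ (2 * q) / 2 ^ (2 * q)"
  proof -
    \<comment> \<open>Conjugation turns U into -U and so produces (-1)^q, which cancels the factor
      i^(2q) in the denominator of y^(2q).\<close>
    have "(- U) ^ q = (-1) ^ q * U ^ q" by (metis mult_minus1 power_mult_distrib)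
    moreover have "(- U / cnj (1 - w)) ^ (2 * q) = U ^ (2 * q) / cnj (1 - w) ^ (2 * q)"
      by (simp add: power_divide)
    moreover have "(U * of_real e / (2 * \<i> * (1 - w) * cnj (1 - w))) ^ (2 * q) =
      U ^ (2 * q) * of_real e ^ (2 * q) / (2 ^ (2 * q) * (-1) ^ q * (1 - w) ^ (2 * q) * cnj (1 - w) ^ (2 * q))"
      by (simp only: power_divide power_mult_distrib power_mult[of \<i> 2] power2_i)
    moreover have "f z * (s * V * C / (V2 / B)) * (V2 * X / (T * s * A * B)) = V * f z / A * C * X / T"
      if "s \<noteq> 0" "A \<noteq> 0" "B \<noteq> 0" "V2 \<noteq> 0" "T \<noteq> 0" for s V V2 A B C X T :: complex
      using that by (simp add: field_simps)
    ultimately show ?thesis using U0 w1 cw1 by (simp add: mult_ac)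
  qed
  finally show ?thesis unfolding z_def[symmetric] sl e_def[symmetric] by simp
qed

lemma petersson_integrand_measurable:
  assumes [measurable]: "f \<in> borel_measurable borel" "g \<in> borel_measurable borel"
  shows "petersson_integrand k f g \<in> borel_measurable borel"
  unfolding petersson_integrand_def by measurable

lemma pterm_measurable [measurable]: "pterm k (\<lambda>w. w ^ m) u \<gamma> \<in> borel_measurable borel"
  unfolding pterm_def slash_def by measurable

text \<open>The density of the disc measure contributes 4 and takes away two powers of 1 - |w|^2.
  Hence \<open>disc_orthogonality\<close> is applied with exponent 2q - 2, an exact difference since
  q \<ge> 1.\<close>

lemma petersson_half_plane:
  assumes u: "u \<in> \<H>" and q: "q \<ge> 1" and f: "f holomorphic_on \<H>" "\<And>z. z \<notin> \<H> \<Longrightarrow> f z = 0"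
    and int: "integrable hyperbolic_measure (petersson_integrand (2 * q) f (pterm (2 * q) (\<lambda>w. w ^ m) u (mat 1)))"
  shows "(\<integral>z. petersson_integrand (2 * q) f (pterm (2 * q) (\<lambda>w. w ^ m) u (mat 1)) z \<partial>hyperbolic_measure) =
    elliptic_coeff (2 * q) u f m * of_real (4 * (pi * (fact m * fact (2 * q - 2) / fact (m + (2 * q - 2) + 1))) / 2 ^ (2 * q))"
proof -
  let ?H = "petersson_integrand (2 * q) f (pterm (2 * q) (\<lambda>w. w ^ m) u (mat 1))"
  let ?G = "\<lambda>w. of_real (indicator (ball 0 1) w) * (slash (2 * q) f (sigma u) w * cnj w ^ m * of_real ((1 - (cmod w)\<^sup>2) ^ (2 * q - 2))) :: complex"
  have [measurable]: "f \<in> borel_measurable borel" by (rule holomorphic_H_measurable[OF f])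
  have H [measurable]: "?H \<in> borel_measurable borel" by (rule petersson_integrand_measurable) measurable
  let ?d = "\<lambda>w. indicator (ball 0 1) w * (4 / (1 - (cmod w)\<^sup>2)\<^sup>2) :: real"
  have eq: "?d w *\<^sub>R ?H (act (sigma u) w) = (4 / 2 ^ (2 * q)) * ?G w" for w
  proof (cases "w \<in> ball 0 1")
    case True
    define e where "e = 1 - (cmod w)\<^sup>2"
    have "(cmod w)\<^sup>2 < 1" using True by (simp add: abs_square_less_1)
    then have "e \<noteq> 0" by (simp add: e_def)
    then have "4 / e\<^sup>2 * e ^ (2 * q) = 4 * e ^ (2 * q - 2)"
      using q by (simp add: power_diff)
    then have "complex_of_real (4 / e\<^sup>2) * of_real (e ^ (2 * q)) = 4 * of_real (e ^ (2 * q - 2))"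
      by (metis of_real_mult of_real_numeral)
    moreover have "c * (X * y / T) = (4 / T) * (X * y')" if "c * y = 4 * y'" for c X y y' T :: complex
    proof -
      have "c * (X * y / T) = X / T * (c * y)" by simp
      then show ?thesis by (simp add: that)
    qed
    ultimately have "complex_of_real (4 / e\<^sup>2) * (X * of_real (e ^ (2 * q)) / 2 ^ (2 * q)) = (4 / 2 ^ (2 * q)) * (X * of_real (e ^ (2 * q - 2)))" for X
      by blast
    then show ?thesis using True unfolding petersson_integrand_disc[OF u True] scaleR_conv_of_real e_def[symmetric] by simp
  qed simp
  have "integrable (distr disc_measure borel (act (sigma u))) ?H"
    using int by (simp only: distr_disc_sigma[OF u])
  then have "integrable disc_measure (\<lambda>w. ?H (act (sigma u) w))"
    by (rule integrable_distr[rotated]) measurable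
  then have "integrable lborel (\<lambda>w. ?d w *\<^sub>R ?H (act (sigma u) w))"
    unfolding disc_measure_eq by (subst (asm) integrable_density) (auto simp: indicator_def)
  then have "integrable lborel (\<lambda>w. (2 ^ (2 * q) / 4) * (4 / 2 ^ (2 * q) * ?G w))"
    unfolding eq by (rule integrable_mult_right)
  moreover have "(2 ^ (2 * q) / 4) * (4 / 2 ^ (2 * q) * x) = x" for x :: complex by simp
  ultimately have int': "integrable lborel ?G" by (simp only:)
  have "integral\<^sup>L hyperbolic_measure ?H = integral\<^sup>L (distr disc_measure borel (act (sigma u))) ?H"
    by (simp only: distr_disc_sigma[OF u])
  also have "\<dots> = (\<integral>w. ?H (act (sigma u) w) \<partial>disc_measure)"
    by (rule integral_distr; measurable)
  also have "\<dots> = (\<integral>w. ?d w *\<^sub>R ?H (act (sigma u) w) \<partial>lborel)"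
    unfolding disc_measure_eq by (rule integral_density) (auto simp: indicator_def)
  also have "\<dots> = (4 / 2 ^ (2 * q)) * integral\<^sup>L lborel ?G"
    unfolding eq by simp
  also have "integral\<^sup>L lborel ?G = elliptic_coeff (2 * q) u f m * of_real (pi * (fact m * fact (2 * q - 2) / fact (m + (2 * q - 2) + 1)))"
    by (rule disc_orthogonality[OF elliptic_coeff_sums(1)[OF u f(1)] int'])
  also have "4 / 2 ^ (2 * q) * (elliptic_coeff (2 * q) u f m * complex_of_real X) =
      elliptic_coeff (2 * q) u f m * of_real (4 * X / 2 ^ (2 * q))" for X
    by simp
  finally show ?thesis .
qed

section \<open>Unfolding\<close>

lemma adj2_adj2: "adj2 (adj2 A) = A"
  by (simp add: adj2_def vec_eq_iff forall_2)

lemma adj2_uminus: "adj2 (- A) = - adj2 A"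
  by (simp add: adj2_def vec_eq_iff forall_2)

locale fuchsian_domain = fuchsian +
  fixes D :: "complex set"
  assumes fd: "fundamental_domain \<Gamma> D" and fin_D: "emeasure hyperbolic_measure D < \<infinity>"
    and cusp: "cusp_width_one_at_infinity \<Gamma>"
begin

lemma D_measurable [measurable]: "D \<in> sets borel"
  and D_subset: "D \<subseteq> \<H>"
  and D_cover: "z \<in> \<H> \<Longrightarrow> \<exists>\<gamma>\<in>\<Gamma>. act (cmat \<gamma>) z \<in> D"
  and D_null: "\<gamma> \<in> \<Gamma> - {mat 1, - mat 1} \<Longrightarrow> emeasure hyperbolic_measure {z \<in> D. act (cmat \<gamma>) z \<in> D} = 0"
  using fd by (auto simp: fundamental_domain_def)

lemma parabolic_mem: "s \<in> {1, -1} \<Longrightarrow> s *\<^sub>R mat2 1 (of_int b) 0 1 \<in> \<Gamma>"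
  using cusp unfolding cusp_width_one_at_infinity_def by blast

lemma uminus_mem:
  assumes "\<gamma> \<in> \<Gamma>" shows "- \<gamma> \<in> \<Gamma>"
proof -
  \<comment> \<open>The case s = -1, b = 0 of the cusp condition puts -I into \<Gamma>.\<close>
  have "(-1::real) *\<^sub>R mat2 1 (of_int 0) 0 1 \<in> \<Gamma>" by (rule parabolic_mem) simp
  moreover have "(-1::real) *\<^sub>R mat2 1 (of_int 0) 0 1 ** \<gamma> = - \<gamma>"
    by (simp add: vec_eq_iff forall_2 matrix_matrix_mult_def sum_2)
  ultimately show ?thesis using mult_mem[OF _ assms] by metis
qed

text \<open>The integral translations are in \<Gamma>. Together with countability this lets \<Gamma>
  be enumerated bijectively by the natural numbers.\<close>

lemma infinite_group: "infinite \<Gamma>"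
proof
  assume "finite \<Gamma>"
  have "range (\<lambda>b::int. 1 *\<^sub>R mat2 1 (of_int b) 0 1) \<subseteq> \<Gamma>"
    using parabolic_mem[of 1] by auto
  moreover have "inj (\<lambda>b::int. 1 *\<^sub>R mat2 1 (of_int b) 0 1 :: real^2^2)"
  proof (rule injI)
    fix a b :: int
    assume "1 *\<^sub>R mat2 1 (of_int a) 0 1 = (1 *\<^sub>R mat2 1 (of_int b) 0 1 :: real^2^2)"
    then have "(1 *\<^sub>R mat2 1 (of_int a) 0 1 :: real^2^2) $ 1 $ 2 = (1 *\<^sub>R mat2 1 (of_int b) 0 1 :: real^2^2) $ 1 $ 2" by (rule arg_cong)
    then show "a = b" by simp
  qed
  ultimately have "finite (UNIV :: int set)"
    using \<open>finite \<Gamma>\<close> finite_subset finite_imageD by metis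
  then show False by simp
qed

lemma AE_move:
  assumes "det A = 1" "Measurable.pred borel P" "AE z in hyperbolic_measure. P z"
  shows "AE z in hyperbolic_measure. P (act (cmat A) z)"
proof -
  have "AE z in distr hyperbolic_measure borel (act (cmat A)). P z"
    using assms(3) by (simp only: distr_hyperbolic_act[OF assms(1)])
  then show ?thesis
    using assms(2) by (subst (asm) AE_distr_iff) (auto simp: pred_def)
qed

text \<open>Off countably many null sets, two elements \<delta>, \<epsilon> whose translates of D
  contain z satisfy \<epsilon>^-1 \<delta> = 1 or -1. As -I lies in \<Gamma> and acts trivially,
  exactly \<delta> and -\<delta> occur. This is the source of the factor 2 in the unfolding.\<close>

lemma AE_two_translates:
  "AE z in hyperbolic_measure. finite {\<delta> \<in> \<Gamma>. act (cmat (adj2 \<delta>)) z \<in> D} \<and> card {\<delta> \<in> \<Gamma>. act (cmat (adj2 \<delta>)) z \<in> D} = 2"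
proof -
  have "AE z in hyperbolic_measure. \<forall>\<gamma>\<in>\<Gamma> - {mat 1, - mat 1}. \<forall>\<delta>\<in>\<Gamma>.
    \<not> (act (cmat (adj2 \<delta>)) z \<in> D \<and> act (cmat \<gamma>) (act (cmat (adj2 \<delta>)) z) \<in> D)"
  proof (intro AE_ball_countable'[rule_format])
    show "countable (\<Gamma> - {mat 1, - mat 1})" "countable \<Gamma>" using countable_group by auto
    fix \<gamma> \<delta> assume \<gamma>: "\<gamma> \<in> \<Gamma> - {mat 1, - mat 1}" and \<delta>: "\<delta> \<in> \<Gamma>"
    have "{z \<in> D. act (cmat \<gamma>) z \<in> D} \<in> sets hyperbolic_measure"
      using measurable_sets[OF act_measurable D_measurable, of "cmat \<gamma>"] D_measurable
      by (simp add: Collect_conj_eq vimage_def Int_def[symmetric] sets.Int)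
    then have "{z \<in> D. act (cmat \<gamma>) z \<in> D} \<in> null_sets hyperbolic_measure"
      using D_null[OF \<gamma>] by auto
    then have "AE z in hyperbolic_measure. \<not> (z \<in> D \<and> act (cmat \<gamma>) z \<in> D)"
      by (auto dest: AE_not_in)
    then show "AE z in hyperbolic_measure. \<not> (act (cmat (adj2 \<delta>)) z \<in> D \<and> act (cmat \<gamma>) (act (cmat (adj2 \<delta>)) z) \<in> D)"
      by (rule AE_move[OF det1[OF adj2_mem[OF \<delta>]], rotated]) measurable
  qed
  with AE_hyperbolic_H show ?thesis
  proof eventually_elim
    case (elim z)
    obtain \<gamma> where \<gamma>: "\<gamma> \<in> \<Gamma>" "act (cmat \<gamma>) z \<in> D" using D_cover[OF elim(1)] by blast
    define \<delta> where "\<delta> = adj2 \<gamma>"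
    have \<delta>: "\<delta> \<in> \<Gamma>" "act (cmat (adj2 \<delta>)) z \<in> D" using \<gamma> adj2_mem by (auto simp: \<delta>_def adj2_adj2)
    have "{\<delta> \<in> \<Gamma>. act (cmat (adj2 \<delta>)) z \<in> D} = {\<delta>, - \<delta>}"
    proof (intro equalityI subsetI)
      fix \<epsilon> assume "\<epsilon> \<in> {\<delta>, - \<delta>}"
      then show "\<epsilon> \<in> {\<delta> \<in> \<Gamma>. act (cmat (adj2 \<delta>)) z \<in> D}"
        using \<delta> uminus_mem by (auto simp: adj2_uminus cmat_uminus act_uminus)
    next
      fix \<epsilon> assume "\<epsilon> \<in> {\<delta> \<in> \<Gamma>. act (cmat (adj2 \<delta>)) z \<in> D}"
      then have \<epsilon>: "\<epsilon> \<in> \<Gamma>" "act (cmat (adj2 \<epsilon>)) z \<in> D" by auto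
      define \<eta> where "\<eta> = adj2 \<epsilon> ** \<delta>"
      have \<eta>: "\<eta> \<in> \<Gamma>" using \<epsilon> \<delta> adj2_mem mult_mem by (simp add: \<eta>_def)
      have "act (cmat \<eta>) (act (cmat (adj2 \<delta>)) z) = act (cmat (adj2 \<epsilon>)) z"
        using act_adj2(2)[OF \<delta>(1) elim(1)] act_in_H[OF det1[OF adj2_mem[OF \<delta>(1)]] elim(1)] det1[OF \<delta>(1)]
        by (simp add: \<eta>_def act_cmat_mult)
      with \<epsilon>(2) have "act (cmat (adj2 \<delta>)) z \<in> D \<and> act (cmat \<eta>) (act (cmat (adj2 \<delta>)) z) \<in> D"
        using \<delta>(2) by simp
      then have "\<eta> \<notin> \<Gamma> - {mat 1, - mat 1}" using elim(2) \<delta>(1) by blast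
      then have "\<eta> = mat 1 \<or> \<eta> = - mat 1" using \<eta> by blast
      moreover have "\<epsilon> ** \<eta> = \<delta>"
        using det1[OF \<epsilon>(1)] by (simp add: \<eta>_def matrix_mul_assoc adj2_mult)
      moreover have "\<epsilon> ** (- mat 1) = - \<epsilon>"
        by (simp add: vec_eq_iff forall_2 matrix_matrix_mult_def sum_2 mat_def)
      ultimately show "\<epsilon> \<in> {\<delta>, - \<delta>}" by auto
    qed
    moreover have "\<delta> \<noteq> - \<delta>"
    proof
      assume "\<delta> = - \<delta>"
      then have "\<delta> $ i $ j = (- \<delta>) $ i $ j" for i j by (rule arg_cong)
      then have "\<delta> $ i $ j = 0" for i j by (metis equal_neg_zero vector_uminus_component)
      then show False using det1[OF \<delta>(1)] by (simp add: det_2)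
    qed
    ultimately show ?case by simp
  qed
qed

text \<open>Turns sums over the group into series, to which the convergence theorems for integrals
  of series apply.\<close>

definition enum :: "nat \<Rightarrow> real^2^2" where
  "enum = from_nat_into \<Gamma>"

lemma enum_bij: "bij_betw enum UNIV \<Gamma>"
  unfolding enum_def using countable_group infinite_group by (rule bij_betw_from_nat_into)

lemma enum_mem: "enum n \<in> \<Gamma>"
  using enum_bij by (auto simp: bij_betw_def)

lemma AE_sums_two:
  "AE z in hyperbolic_measure. (\<lambda>n. indicator D (act (cmat (adj2 (enum n))) z) :: real) sums 2"
  using AE_two_translates
proof eventually_elim
  case (elim z)
  let ?S = "{\<delta> \<in> \<Gamma>. act (cmat (adj2 \<delta>)) z \<in> D}" and ?N = "{n. act (cmat (adj2 (enum n))) z \<in> D}"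
  have "bij_betw enum ?N ?S"
  proof (rule bij_betw_subset[OF enum_bij])
    show "enum ` ?N = ?S"
    proof (intro equalityI subsetI)
      fix \<delta> assume \<delta>: "\<delta> \<in> ?S"
      then obtain n where "\<delta> = enum n" using enum_bij by (auto simp: bij_betw_def)
      with \<delta> show "\<delta> \<in> enum ` ?N" by blast
    qed (auto simp: enum_mem)
  qed simp
  then have N: "finite ?N" "card ?N = 2"
    using elim by (simp_all add: bij_betw_finite bij_betw_same_card)
  have "(\<lambda>n. indicator D (act (cmat (adj2 (enum n))) z) :: real) sums (\<Sum>n\<in>?N. indicator D (act (cmat (adj2 (enum n))) z))"
    by (rule sums_finite[OF N(1)]) auto
  also have "(\<Sum>n\<in>?N. indicator D (act (cmat (adj2 (enum n))) z) :: real) = (\<Sum>n\<in>?N. 1)"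
    by (rule sum.cong) auto
  finally show ?case using N by simp
qed

text \<open>The translates of D cover the half-plane, and an inequality is enough here: it serves to
  prove that the integrand is integrable, before \<open>integral_unfold\<close> computes with
  it.\<close>

lemma nn_integral_fold:
  assumes [measurable]: "h \<in> borel_measurable borel"
  shows "(\<integral>\<^sup>+z. h z \<partial>hyperbolic_measure) \<le>
    (\<integral>\<^sup>+z. indicator D z * (\<Sum>n. h (act (cmat (enum n)) z)) \<partial>hyperbolic_measure)"
proof -
  have move: "(\<integral>\<^sup>+z. indicator D z * h (act (cmat \<gamma>) z) \<partial>hyperbolic_measure) =
      (\<integral>\<^sup>+z. indicator D (act (cmat (adj2 \<gamma>)) z) * h z \<partial>hyperbolic_measure)" if \<gamma>: "\<gamma> \<in> \<Gamma>" for \<gamma>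
  proof -
    have "(\<integral>\<^sup>+z. indicator D (act (cmat (adj2 \<gamma>)) z) * h z \<partial>hyperbolic_measure) =
      (\<integral>\<^sup>+z. indicator D (act (cmat (adj2 \<gamma>)) z) * h z \<partial>distr hyperbolic_measure borel (act (cmat \<gamma>)))"
      by (simp only: distr_hyperbolic_act[OF det1[OF \<gamma>]])
    also have "\<dots> = (\<integral>\<^sup>+z. indicator D (act (cmat (adj2 \<gamma>)) (act (cmat \<gamma>) z)) * h (act (cmat \<gamma>) z) \<partial>hyperbolic_measure)"
      by (rule nn_integral_distr; measurable)
    also have "\<dots> = (\<integral>\<^sup>+z. indicator D z * h (act (cmat \<gamma>) z) \<partial>hyperbolic_measure)"
      by (rule nn_integral_cong_AE, use AE_hyperbolic_H in eventually_elim) (simp only: act_adj2(1)[OF \<gamma>])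
    finally show ?thesis by simp
  qed
  have "(\<integral>\<^sup>+z. h z \<partial>hyperbolic_measure) \<le>
    (\<integral>\<^sup>+z. (\<Sum>n. indicator D (act (cmat (adj2 (enum n))) z) * h z) \<partial>hyperbolic_measure)"
  proof (intro nn_integral_mono_AE, use AE_hyperbolic_H in eventually_elim)
    fix z :: complex assume "z \<in> \<H>"
    then obtain \<gamma> where \<gamma>: "\<gamma> \<in> \<Gamma>" "act (cmat \<gamma>) z \<in> D" using D_cover by blast
    then obtain n where n: "enum n = adj2 \<gamma>" using enum_bij adj2_mem unfolding bij_betw_def by (metis imageE)
    have "h z = (\<Sum>i\<in>{n}. indicator D (act (cmat (adj2 (enum i))) z) * h z)"
      using \<gamma> by (simp add: n adj2_adj2)
    also have "\<dots> \<le> (\<Sum>n. indicator D (act (cmat (adj2 (enum n))) z) * h z)"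
      by (rule sum_le_suminf) auto
    finally show "h z \<le> (\<Sum>n. indicator D (act (cmat (adj2 (enum n))) z) * h z)" .
  qed
  also have "\<dots> = (\<Sum>n. \<integral>\<^sup>+z. indicator D (act (cmat (adj2 (enum n))) z) * h z \<partial>hyperbolic_measure)"
    by (rule nn_integral_suminf) measurable
  also have "\<dots> = (\<Sum>n. \<integral>\<^sup>+z. indicator D z * h (act (cmat (enum n)) z) \<partial>hyperbolic_measure)"
    by (simp only: move[OF enum_mem])
  also have "\<dots> = (\<integral>\<^sup>+z. (\<Sum>n. indicator D z * h (act (cmat (enum n)) z)) \<partial>hyperbolic_measure)"
    by (rule nn_integral_suminf[symmetric]) measurable
  also have "\<dots> = (\<integral>\<^sup>+z. indicator D z * (\<Sum>n. h (act (cmat (enum n)) z)) \<partial>hyperbolic_measure)"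
    by (simp only: ennreal_suminf_cmult)
  finally show ?thesis .
qed

text \<open>The functions \<open>?a\<close> live on D and the functions \<open>?b\<close> on its
  translates; substituting \<gamma>z for z shows that they have equal integrals, also after taking
  norms. Almost everywhere the sum of the \<open>?b\<close> is 2 H, and the sum of their norms is at
  most 2 |H|, which justifies exchanging sum and integral on both sides.\<close>

lemma integral_unfold:
  fixes H :: "complex \<Rightarrow> complex"
  assumes [measurable]: "H \<in> borel_measurable borel" and int: "integrable hyperbolic_measure H"
    and summ: "\<And>z. z \<in> D \<Longrightarrow> summable (\<lambda>n. norm (H (act (cmat (enum n)) z)))"
  shows "(\<integral>z. indicator D z *\<^sub>R (\<Sum>n. H (act (cmat (enum n)) z)) \<partial>hyperbolic_measure) =
    2 * integral\<^sup>L hyperbolic_measure H"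
proof -
  let ?\<mu> = hyperbolic_measure
  let ?a = "\<lambda>n z. indicator D z *\<^sub>R H (act (cmat (enum n)) z)"
  let ?b = "\<lambda>n z. indicator D (act (cmat (adj2 (enum n))) z) *\<^sub>R H z"
  have ae: "AE z in ?\<mu>. ?b n (act (cmat (enum n)) z) = ?a n z" for n
    using AE_hyperbolic_H by eventually_elim (simp only: act_adj2(1)[OF enum_mem])
  have dist: "distr ?\<mu> borel (act (cmat (enum n))) = ?\<mu>" for n
    by (rule distr_hyperbolic_act[OF det1[OF enum_mem]])
  have int_b: "integrable ?\<mu> (?b n)" for n
    by (rule Bochner_Integration.integrable_bound[OF int]) (measurable, auto simp: indicator_def)
  have int_a: "integrable ?\<mu> (?a n)" for n
  proof -
    have "integrable (distr ?\<mu> borel (act (cmat (enum n)))) (?b n)" unfolding dist by (rule int_b)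
    then have "integrable ?\<mu> (\<lambda>z. ?b n (act (cmat (enum n)) z))" by (rule integrable_distr[rotated]) simp
    then show ?thesis
      by (rule Bochner_Integration.integrable_cong_AE_imp) (measurable, use ae in auto)
  qed
  have move: "(\<integral>z. g (?a n z) \<partial>?\<mu>) = (\<integral>z. g (?b n z) \<partial>?\<mu>)" if [measurable]: "g \<in> borel_measurable borel"
    for n and g :: "complex \<Rightarrow> 'b::{banach, second_countable_topology}"
  proof -
    have "(\<integral>z. g (?b n z) \<partial>?\<mu>) = (\<integral>z. g (?b n z) \<partial>distr ?\<mu> borel (act (cmat (enum n))))" by (simp only: dist)
    also have "\<dots> = (\<integral>z. g (?b n (act (cmat (enum n)) z)) \<partial>?\<mu>)"
      by (rule integral_distr; measurable)
    also have "\<dots> = (\<integral>z. g (?a n z) \<partial>?\<mu>)"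
      by (rule integral_cong_AE) (measurable, use ae[of n] in eventually_elim, simp only:)
    finally show ?thesis by simp
  qed
  have sum_b: "summable (\<lambda>n. \<integral>z. norm (?b n z) \<partial>?\<mu>)"
  proof (rule summableI_nonneg_bounded)
    fix N
    have "(\<Sum>n<N. \<integral>z. norm (?b n z) \<partial>?\<mu>) = (\<integral>z. (\<Sum>n<N. norm (?b n z)) \<partial>?\<mu>)"
      by (rule Bochner_Integration.integral_sum[symmetric]) (rule integrable_norm[OF int_b])
    also have "\<dots> \<le> (\<integral>z. 2 * norm (H z) \<partial>?\<mu>)"
    proof (rule integral_mono_AE)
      show "AE z in ?\<mu>. (\<Sum>n<N. norm (?b n z)) \<le> 2 * norm (H z)"
        using AE_sums_two
      proof eventually_elim
        case (elim z)
        have "(\<Sum>n<N. indicator D (act (cmat (adj2 (enum n))) z) :: real) \<le> (\<Sum>n. indicator D (act (cmat (adj2 (enum n))) z))"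
          using elim by (intro sum_le_suminf) (auto simp: sums_iff)
        also have "\<dots> = 2" using elim by (simp add: sums_iff)
        finally show ?case
          by (simp add: sum_distrib_right[symmetric] mult_right_mono)
      qed
      show "integrable ?\<mu> (\<lambda>z. \<Sum>n<N. norm (?b n z))"
        by (intro Bochner_Integration.integrable_sum integrable_norm int_b)
      show "integrable ?\<mu> (\<lambda>z. 2 * norm (H z))"
        by (intro integrable_mult_right integrable_norm int)
    qed
    finally show "(\<Sum>n<N. \<integral>z. norm (?b n z) \<partial>?\<mu>) \<le> (\<integral>z. 2 * norm (H z) \<partial>?\<mu>)" .
  qed (simp add: integral_nonneg)
  have ae_b: "AE z in ?\<mu>. summable (\<lambda>n. norm (?b n z))"
    using AE_sums_two
  proof eventually_elim
    case (elim z)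
    then have "summable (\<lambda>n. indicator D (act (cmat (adj2 (enum n))) z) * norm (H z))"
      by (intro summable_mult2) (simp add: sums_iff)
    then show ?case by simp
  qed
  have ae_a: "AE z in ?\<mu>. summable (\<lambda>n. norm (?a n z))"
    by (rule AE_I2) (use summ in \<open>auto simp: indicator_def\<close>)
  have sum_a: "summable (\<lambda>n. \<integral>z. norm (?a n z) \<partial>?\<mu>)"
    using sum_b move[of norm] by simp
  have "(\<integral>z. indicator D z *\<^sub>R (\<Sum>n. H (act (cmat (enum n)) z)) \<partial>?\<mu>) = (\<integral>z. (\<Sum>n. ?a n z) \<partial>?\<mu>)"
  proof (rule Bochner_Integration.integral_cong[OF refl])
    fix z
    show "indicator D z *\<^sub>R (\<Sum>n. H (act (cmat (enum n)) z)) = (\<Sum>n. ?a n z)"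
      by (cases "z \<in> D") auto
  qed
  also have "\<dots> = (\<Sum>n. integral\<^sup>L ?\<mu> (?a n))"
    by (rule integral_suminf[OF int_a ae_a sum_a])
  also have "\<dots> = (\<Sum>n. integral\<^sup>L ?\<mu> (?b n))"
    using move[of "\<lambda>x. x"] by simp
  also have "\<dots> = (\<integral>z. (\<Sum>n. ?b n z) \<partial>?\<mu>)"
    by (rule integral_suminf[OF int_b ae_b sum_b, symmetric])
  also have "\<dots> = (\<integral>z. 2 * H z \<partial>?\<mu>)"
  proof (rule integral_cong_AE)
    show "AE z in ?\<mu>. (\<Sum>n. ?b n z) = 2 * H z"
      using AE_sums_two
    proof eventually_elim
      case (elim z)
      have "(\<lambda>n. ?b n z) sums (2 *\<^sub>R H z)" by (rule sums_scaleR_left[OF elim])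
      then show ?case by (simp add: sums_iff scaleR_conv_of_real)
    qed
  qed measurable
  finally show ?thesis by simp
qed

section \<open>The reproducing property of Poincare series\<close>

lemma petersson_eq: "petersson D k f g = (\<integral>z. indicator D z *\<^sub>R petersson_integrand k f g z \<partial>hyperbolic_measure)"
  by (simp add: petersson_def set_lebesgue_integral_def petersson_integrand_def)

text \<open>Under z \<mapsto> \<gamma>z, f contributes J^k, the conjugated summand cnj(J)^k, and y^k
  contributes |J|^(-2k). The sum over the group is therefore a sum of translates of one function, as
  the unfolding demands.\<close>

lemma petersson_integrand_act:
  assumes "\<gamma> \<in> \<Gamma>" "z \<in> \<H>" "u \<in> \<H>" and f: "slash (2 * q) f (cmat \<gamma>) z = f z"
  shows "petersson_integrand (2 * q) f (pterm (2 * q) g u (mat 1)) (act (cmat \<gamma>) z) =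
    petersson_integrand (2 * q) f (pterm (2 * q) g u \<gamma>) z"
proof -
  define J where "J = j_factor (cmat \<gamma>) z"
  have d: "det \<gamma> = 1" by (rule det1[OF assms(1)])
  have J0: "J \<noteq> 0" unfolding J_def by (rule j_factor_nz[OF d assms(2)])
  have f': "f (act (cmat \<gamma>) z) = f z * J ^ (2 * q)"
    using f J0 by (simp add: slash_def det_cmat d J_def field_simps)
  have "pterm (2 * q) g u (mat 1 ** \<gamma>) z = slash (2 * q) (pterm (2 * q) g u (mat 1)) (cmat \<gamma>) z"
    by (rule pterm_mult[OF d assms(2)]) simp
  then have p: "pterm (2 * q) g u (mat 1) (act (cmat \<gamma>) z) = pterm (2 * q) g u \<gamma> z * J ^ (2 * q)"
    using J0 by (simp add: slash_def det_cmat d J_def field_simps)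
  have "complex_of_real (Im (act (cmat \<gamma>) z)) = of_real (Im z) / (J * cnj J)"
    unfolding Im_act[OF d assms(2)] J_def complex_norm_square[symmetric] by simp
  then have "complex_of_real (Im (act (cmat \<gamma>) z) ^ (2 * q)) = of_real (Im z ^ (2 * q)) / (J ^ (2 * q) * cnj J ^ (2 * q))"
    by (simp only: of_real_power power_divide power_mult_distrib)
  then show ?thesis
    unfolding petersson_integrand_def f' p using J0 by simp
qed

text \<open>The 8 is the 4 of \<open>petersson_half_plane\<close> times the 2 of
  \<open>integral_unfold\<close>.\<close>

lemma petersson_poincare:
  assumes u: "u \<in> \<H>" and q: "2 \<le> q" and f: "f \<in> cusp_forms \<Gamma> (2 * q)"
    and L2: "integrable hyperbolic_measure (\<lambda>z. indicator D z *\<^sub>R petersson_integrand (2 * q) f f z)"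
  shows "petersson D (2 * q) f (poincare (2 * q) m u) = elliptic_coeff (2 * q) u f m *
    of_real (8 * (pi * (fact m * fact (2 * q - 2) / fact (m + (2 * q - 2) + 1))) / 2 ^ (2 * q))"
proof -
  let ?\<mu> = hyperbolic_measure
  let ?\<phi> = "pterm (2 * q) (\<lambda>w. w ^ m) u"
  define H where "H = petersson_integrand (2 * q) f (?\<phi> (mat 1))"
  have f': "f holomorphic_on \<H>" "\<And>z. z \<notin> \<H> \<Longrightarrow> f z = 0" "\<And>\<gamma> z. \<gamma> \<in> \<Gamma> \<Longrightarrow> z \<in> \<H> \<Longrightarrow> slash (2 * q) f (cmat \<gamma>) z = f z"
    using f unfolding cusp_forms_def by blast+
  have [measurable]: "f \<in> borel_measurable borel" by (rule holomorphic_H_measurable[OF f'(1,2)])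
  have H [measurable]: "H \<in> borel_measurable borel" unfolding H_def by (rule petersson_integrand_measurable) measurable
  obtain C where C: "C \<ge> 0" "\<And>z. z \<in> \<H> \<Longrightarrow> (\<Sum>\<^sub>\<infinity>\<gamma>\<in>\<Gamma>. cmod (?\<phi> \<gamma> z)) * Im z ^ q \<le> C"
    using poincare_bound[OF u q] by metis
  have H_act: "H (act (cmat (enum n)) z) = petersson_integrand (2 * q) f (?\<phi> (enum n)) z" if "z \<in> \<H>" for n z
    unfolding H_def by (rule petersson_integrand_act[OF enum_mem that u f'(3)[OF enum_mem that]])
  have sums_\<phi>: "(\<lambda>n. cmod (?\<phi> (enum n) z)) sums (\<Sum>\<^sub>\<infinity>\<gamma>\<in>\<Gamma>. cmod (?\<phi> \<gamma> z))" if z: "z \<in> \<H>" for z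
    by (intro has_sum_imp_sums iffD2[OF has_sum_reindex_bij_betw[OF enum_bij]] has_sum_infsum pterm_power_summable u q z)
  have sums_H: "(\<lambda>n. cmod (H (act (cmat (enum n)) z))) sums (cmod (f z) * Im z ^ q * ((\<Sum>\<^sub>\<infinity>\<gamma>\<in>\<Gamma>. cmod (?\<phi> \<gamma> z)) * Im z ^ q))" if z: "z \<in> \<H>" for z
  proof -
    have "(\<lambda>n. cmod (f z) * Im z ^ q * (cmod (?\<phi> (enum n) z) * Im z ^ q)) sums (cmod (f z) * Im z ^ q * ((\<Sum>\<^sub>\<infinity>\<gamma>\<in>\<Gamma>. cmod (?\<phi> \<gamma> z)) * Im z ^ q))"
      by (intro sums_mult sums_mult2 sums_\<phi> z)
    moreover have "cmod (H (act (cmat (enum n)) z)) = cmod (f z) * Im z ^ q * (cmod (?\<phi> (enum n) z) * Im z ^ q)" for n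
      unfolding H_act[OF z] petersson_integrand_def using z
      by (simp add: norm_mult norm_power power_mult power2_eq_square power_mult_distrib)
    ultimately show ?thesis by (simp only:)
  qed
  have "(\<integral>\<^sup>+z. ennreal (cmod (H z)) \<partial>?\<mu>) \<le> (\<integral>\<^sup>+z. indicator D z * (\<Sum>n. ennreal (cmod (H (act (cmat (enum n)) z)))) \<partial>?\<mu>)"
    by (rule nn_integral_fold) measurable
  also have "\<dots> \<le> (\<integral>\<^sup>+z. ennreal C * (indicator D z + ennreal (norm (indicator D z *\<^sub>R petersson_integrand (2 * q) f f z))) \<partial>?\<mu>)"
  proof (rule nn_integral_mono)
    fix z
    show "indicator D z * (\<Sum>n. ennreal (cmod (H (act (cmat (enum n)) z)))) \<le>
      ennreal C * (indicator D z + ennreal (norm (indicator D z *\<^sub>R petersson_integrand (2 * q) f f z)))"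
    proof (cases "z \<in> D")
      case True
      then have z: "z \<in> \<H>" using D_subset by auto
      define x where "x = cmod (f z) * Im z ^ q"
      have x0: "x \<ge> 0" using z by (simp add: x_def)
      \<comment> \<open>The bounded factor C is paired with only the first power of x = |f| y^(k/2).
        Replacing x by 1 + x^2 brings in the area of D and the squared norm of f, both
        finite.\<close>
      have "(x - 1)\<^sup>2 \<ge> 0" by simp
      then have x: "x \<le> 1 + x\<^sup>2" using x0 by (simp add: power2_diff)
      have nf: "norm (petersson_integrand (2 * q) f f z) = x\<^sup>2"
        using z by (simp add: petersson_integrand_def norm_mult norm_power x_def power_mult power2_eq_square power_mult_distrib)
      have "(\<Sum>n. ennreal (cmod (H (act (cmat (enum n)) z)))) = ennreal (\<Sum>n. cmod (H (act (cmat (enum n)) z)))"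
        using sums_H[OF z] by (intro suminf_ennreal2) (auto simp: sums_iff)
      also have "\<dots> = ennreal (x * ((\<Sum>\<^sub>\<infinity>\<gamma>\<in>\<Gamma>. cmod (?\<phi> \<gamma> z)) * Im z ^ q))"
        using sums_H[OF z] by (simp add: sums_iff x_def)
      also have "\<dots> \<le> ennreal ((1 + x\<^sup>2) * C)"
        using C z x x0 by (intro ennreal_leI mult_mono) (auto intro!: mult_nonneg_nonneg infsum_nonneg)
      also have "\<dots> = ennreal C * (1 + ennreal (x\<^sup>2))"
        using C(1) by (simp add: ennreal_mult mult.commute flip: ennreal_1 ennreal_plus)
      finally show ?thesis using True by (simp add: nf)
    qed simp
  qed
  also have "\<dots> = ennreal C * (emeasure ?\<mu> D + (\<integral>\<^sup>+z. ennreal (norm (indicator D z *\<^sub>R petersson_integrand (2 * q) f f z)) \<partial>?\<mu>))"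
  proof -
    have [measurable]: "petersson_integrand (2 * q) f f \<in> borel_measurable borel" by (rule petersson_integrand_measurable) measurable
    let ?n = "\<lambda>z. ennreal (norm (indicator D z *\<^sub>R petersson_integrand (2 * q) f f z))"
    have "(\<integral>\<^sup>+z. ennreal C * (indicator D z + ?n z) \<partial>?\<mu>) = ennreal C * (\<integral>\<^sup>+z. indicator D z + ?n z \<partial>?\<mu>)"
      by (rule nn_integral_cmult; measurable)
    also have "(\<integral>\<^sup>+z. indicator D z + ?n z \<partial>?\<mu>) = (\<integral>\<^sup>+z. indicator D z \<partial>?\<mu>) + (\<integral>\<^sup>+z. ?n z \<partial>?\<mu>)"
      by (rule nn_integral_add; measurable)
    also have "(\<integral>\<^sup>+z. indicator D z \<partial>?\<mu>) = emeasure ?\<mu> D"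
      by (rule nn_integral_indicator) simp
    finally show ?thesis .
  qed
  also have "\<dots> < \<infinity>"
    using L2 fin_D by (auto simp: ennreal_mult_less_top integrable_iff_bounded ennreal_add_eq_top less_top)
  finally have int: "integrable ?\<mu> H"
    using H by (simp add: integrable_iff_bounded)
  have "petersson D (2 * q) f (poincare (2 * q) m u) = (\<integral>z. indicator D z *\<^sub>R (\<Sum>n. H (act (cmat (enum n)) z)) \<partial>?\<mu>)"
    unfolding petersson_eq
  proof (rule Bochner_Integration.integral_cong[OF refl])
    fix z
    show "indicator D z *\<^sub>R petersson_integrand (2 * q) f (poincare (2 * q) m u) z = indicator D z *\<^sub>R (\<Sum>n. H (act (cmat (enum n)) z))"
    proof (cases "z \<in> D")
      case True
      then have z: "z \<in> \<H>" using D_subset by auto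
      have "(\<lambda>n. ?\<phi> (enum n) z) sums poincare (2 * q) m u z"
        by (intro has_sum_imp_sums iffD2[OF has_sum_reindex_bij_betw[OF enum_bij]] poincare_has_sum u q z)
      then have "(\<lambda>n. cnj (?\<phi> (enum n) z)) sums cnj (poincare (2 * q) m u z)" by (simp add: sums_cnj)
      then have "(\<lambda>n. petersson_integrand (2 * q) f (?\<phi> (enum n)) z) sums petersson_integrand (2 * q) f (poincare (2 * q) m u) z"
        unfolding petersson_integrand_def by (intro sums_mult sums_mult2)
      then show ?thesis unfolding H_act[OF z] by (simp add: sums_iff)
    qed simp
  qed
  also have "\<dots> = 2 * integral\<^sup>L ?\<mu> H"
    by (rule integral_unfold[OF H int]) (use sums_H D_subset in \<open>auto simp: sums_iff\<close>)
  also have "integral\<^sup>L ?\<mu> H = elliptic_coeff (2 * q) u f m *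
      of_real (4 * (pi * (fact m * fact (2 * q - 2) / fact (m + (2 * q - 2) + 1))) / 2 ^ (2 * q))"
    unfolding H_def using int q by (intro petersson_half_plane u f'(1,2)) (auto simp: H_def)
  finally show ?thesis by simp
qed

text \<open>Expanding the product needs each mixed integrand to be integrable, which follows from |f
  g| \<le> |f|^2 + |g|^2 and the integrability of the squares.\<close>

lemma petersson_linear:
  assumes q: "2 \<le> q" and f: "f \<in> cusp_forms \<Gamma> (2 * q)" and T: "finite T" "T \<subseteq> cusp_forms \<Gamma> (2 * q)"
    and L2: "\<And>g. g \<in> insert f T \<Longrightarrow> integrable hyperbolic_measure (\<lambda>z. indicator D z *\<^sub>R petersson_integrand (2 * q) g g z)"
  shows "petersson D (2 * q) f (\<lambda>z. \<Sum>g\<in>T. c g * g z) = (\<Sum>g\<in>T. cnj (c g) * petersson D (2 * q) f g)"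
proof -
  let ?\<mu> = hyperbolic_measure
  have meas: "g \<in> borel_measurable borel" if "g \<in> insert f T" for g
    using that f T by (intro holomorphic_H_measurable) (auto simp: cusp_forms_def)
  have int: "integrable ?\<mu> (\<lambda>z. indicator D z *\<^sub>R petersson_integrand (2 * q) f g z)" if g: "g \<in> T" for g
  proof (rule Bochner_Integration.integrable_bound)
    show "integrable ?\<mu> (\<lambda>z. norm (indicator D z *\<^sub>R petersson_integrand (2 * q) f f z) + norm (indicator D z *\<^sub>R petersson_integrand (2 * q) g g z))"
      using L2 g by (intro Bochner_Integration.integrable_add integrable_norm) auto
    show "(\<lambda>z. indicator D z *\<^sub>R petersson_integrand (2 * q) f g z) \<in> borel_measurable ?\<mu>"
      using petersson_integrand_measurable[OF meas[of f] meas[of g]] g by simp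
    show "AE z in ?\<mu>. norm (indicator D z *\<^sub>R petersson_integrand (2 * q) f g z) \<le>
      norm (norm (indicator D z *\<^sub>R petersson_integrand (2 * q) f f z) + norm (indicator D z *\<^sub>R petersson_integrand (2 * q) g g z))"
    proof (rule AE_I2)
      fix z
      have "cmod (f z) * cmod (g z) \<le> cmod (f z) * cmod (f z) + cmod (g z) * cmod (g z)"
        using sum_squares_bound[of "cmod (f z)" "cmod (g z)", unfolded power2_eq_square]
          mult_nonneg_nonneg[OF norm_ge_zero norm_ge_zero, of "f z" "g z"] by linarith
      then have "cmod (f z) * cmod (g z) * \<bar>Im z ^ (2 * q)\<bar> \<le> (cmod (f z) * cmod (f z) + cmod (g z) * cmod (g z)) * \<bar>Im z ^ (2 * q)\<bar>"
        by (intro mult_right_mono) auto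
      then have "norm (petersson_integrand (2 * q) f g z) \<le> norm (petersson_integrand (2 * q) f f z) + norm (petersson_integrand (2 * q) g g z)"
        unfolding petersson_integrand_def norm_mult norm_of_real complex_mod_cnj by (simp add: distrib_right)
      then show "norm (indicator D z *\<^sub>R petersson_integrand (2 * q) f g z) \<le>
        norm (norm (indicator D z *\<^sub>R petersson_integrand (2 * q) f f z) + norm (indicator D z *\<^sub>R petersson_integrand (2 * q) g g z))"
        by (cases "z \<in> D") auto
    qed
  qed
  have "petersson D (2 * q) f (\<lambda>z. \<Sum>g\<in>T. c g * g z) =
    (\<integral>z. (\<Sum>g\<in>T. cnj (c g) * (indicator D z *\<^sub>R petersson_integrand (2 * q) f g z)) \<partial>?\<mu>)"
    unfolding petersson_eq
    by (rule Bochner_Integration.integral_cong[OF refl])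
      (simp add: petersson_integrand_def sum_distrib_left sum_distrib_right scaleR_sum_right mult_ac)
  also have "\<dots> = (\<Sum>g\<in>T. \<integral>z. cnj (c g) * (indicator D z *\<^sub>R petersson_integrand (2 * q) f g z) \<partial>?\<mu>)"
    using int by (intro Bochner_Integration.integral_sum integrable_mult_right)
  also have "\<dots> = (\<Sum>g\<in>T. cnj (c g) * petersson D (2 * q) f g)"
    unfolding petersson_eq by (intro sum.cong refl integral_mult_right_zero)
  finally show ?thesis .
qed

lemma elliptic_coeff_sum_basis:
  assumes u: "u \<in> \<H>" and v: "v \<in> \<H>" and q: "2 \<le> q"
    and F: "orthonormal_basis D (2 * q) (cusp_forms \<Gamma> (2 * q)) F"
    and \<kappa>_def: "\<kappa> = 8 * (pi * (fact m * fact (2 * q - 2) / fact (m + (2 * q - 2) + 1))) / 2 ^ (2 * q)"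
  shows "(\<Sum>\<^sub>\<infinity>f\<in>F. cnj (elliptic_coeff (2 * q) u f m) * elliptic_coeff (2 * q) v f n) =
    elliptic_coeff (2 * q) v (poincare (2 * q) m u) n / of_real \<kappa>"
proof -
  let ?P = "poincare (2 * q) m u"
  have \<kappa>: "\<kappa> > 0" by (simp add: \<kappa>_def)
  have F_sub: "F \<subseteq> cusp_forms \<Gamma> (2 * q)"
    and F_orth: "\<And>f g. f \<in> F \<Longrightarrow> g \<in> F \<Longrightarrow> petersson D (2 * q) f g = (if f = g then 1 else 0)"
    using F by (auto simp: orthonormal_basis_def)
  \<comment> \<open>The integral of a function that is not integrable is 0 by convention, so the
    value 1 of \<langle>f, f\<rangle> implies integrability.\<close>
  have L2: "integrable hyperbolic_measure (\<lambda>z. indicator D z *\<^sub>R petersson_integrand (2 * q) f f z)" if "f \<in> F" for f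
    using F_orth[OF that that] not_integrable_integral_eq unfolding petersson_eq by fastforce
  obtain T c where T: "finite T" "T \<subseteq> F" and P: "?P = (\<lambda>z. \<Sum>f\<in>T. c f * f z)"
    using F poincare_cusp_form[OF u q, of m] unfolding orthonormal_basis_def by blast
  \<comment> \<open>Conjugate linearity in the second argument makes \<langle>f, P\<rangle> equal to
    cnj (c f), or to 0 for f outside T. As \<open>\<kappa>\<close> is real, conjugating once more
    returns c f itself, so the sum over F recombines to the coefficient of P.\<close>
  have coeff: "cnj (elliptic_coeff (2 * q) u f m) = (if f \<in> T then c f / of_real \<kappa> else 0)" if f: "f \<in> F" for f
  proof -
    have "elliptic_coeff (2 * q) u f m * of_real \<kappa> = petersson D (2 * q) f ?P"
      unfolding \<kappa>_def using f F_sub L2 by (intro petersson_poincare[symmetric] u q) auto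
    also have "\<dots> = (\<Sum>g\<in>T. cnj (c g) * petersson D (2 * q) f g)"
      unfolding P using f F_sub T L2 by (intro petersson_linear q) auto
    also have "\<dots> = (\<Sum>g\<in>T. if g = f then cnj (c g) else 0)"
      using f T F_orth by (intro sum.cong refl) auto
    also have "\<dots> = (if f \<in> T then cnj (c f) else 0)"
      using T(1) by simp
    finally have "elliptic_coeff (2 * q) u f m = (if f \<in> T then cnj (c f) else 0) / of_real \<kappa>"
      using \<kappa> by (simp add: field_simps)
    then show ?thesis by simp
  qed
  have "(\<Sum>\<^sub>\<infinity>f\<in>F. cnj (elliptic_coeff (2 * q) u f m) * elliptic_coeff (2 * q) v f n) =
    (\<Sum>\<^sub>\<infinity>f\<in>T. c f * elliptic_coeff (2 * q) v f n / of_real \<kappa>)"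
    by (rule infsum_cong_neutral) (use T coeff in auto)
  also have "\<dots> = (\<Sum>f\<in>T. c f * elliptic_coeff (2 * q) v f n) / of_real \<kappa>"
    using T(1) by (simp add: sum_divide_distrib)
  also have "(\<Sum>f\<in>T. c f * elliptic_coeff (2 * q) v f n) = elliptic_coeff (2 * q) v ?P n"
    unfolding P using T F_sub by (intro elliptic_coeff_sum[symmetric] v) (auto simp: cusp_forms_def)
  finally show ?thesis .
qed

end

theorem theorem8p3:
  fixes \<Gamma> :: "(real^2^2) set" and D :: "complex set" and k m n :: nat
    and z0 z0' :: complex and F :: "(complex \<Rightarrow> complex) set"
  assumes "subgroup \<Gamma> SL2R" and "discrete \<Gamma>" and "finitely_generated \<Gamma>"
    and "fundamental_domain \<Gamma> D" and "emeasure hyperbolic_measure D < \<infinity>"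
    and "cusp_width_one_at_infinity \<Gamma>"
    and "k \<ge> 4" and "even k"
    and "z0 \<in> \<H>" and "z0' \<in> \<H>"
    and "orthonormal_basis D k (cusp_forms \<Gamma> k) F"
  shows "(\<Sum>\<^sub>\<infinity>f\<in>F. cnj (elliptic_coeff k z0 f m) * elliptic_coeff k z0' f n) =
    2 ^ (k - 3) * fact (m + k - 1) * (z0' - cnj z0') ^ (n + k div 2)
      / (of_real pi * fact m * fact (k - 2)) *
    (\<Sum>j=0..n. of_nat (m choose j) * of_nat ((n + k - 1) choose (n - j)) *
       G_series \<Gamma> (k + 2 * n) z0' z0 (m - j) (n - j))"
proof -
  interpret fuchsian_domain \<Gamma> D
    by (intro fuchsian_domain.intro fuchsian.intro fuchsian_domain_axioms.intro assms)
  obtain q where k: "k = 2 * q" using \<open>even k\<close> by blast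
  have q: "2 \<le> q" using \<open>k \<ge> 4\<close> k by simp
  define S where "S = (\<Sum>j=0..n. of_nat (m choose j) * of_nat ((n + k - 1) choose (n - j)) *
       G_series \<Gamma> (k + 2 * n) z0' z0 (m - j) (n - j))"
  define \<kappa> where "\<kappa> = 8 * (pi * (fact m * fact (2 * q - 2) / fact (m + (2 * q - 2) + 1))) / 2 ^ (2 * q)"
  have e: "m + (2 * q - 2) + 1 = m + k - 1" "2 * q - 2 = k - 2" using q k by auto
  \<comment> \<open>Inverting \<open>\<kappa>\<close> produces 2^k / 8, which is the power 2^(k-3)
    of the statement.\<close>
  have p: "2 ^ (2 * q) = (8::real) * 2 ^ (k - 3)"
  proof -
    have "2 * q = 3 + (k - 3)" using q k by simp
    then have "2 ^ (2 * q) = (2::real) ^ (3 + (k - 3))" by (rule arg_cong)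
    then show ?thesis by (simp add: power_add)
  qed
  have "1 / \<kappa> = 2 ^ (k - 3) * fact (m + k - 1) / (pi * fact m * fact (k - 2))"
    unfolding \<kappa>_def e(1) unfolding e(2) p by (simp add: mult_ac)
  then have "1 / complex_of_real \<kappa> = of_real (2 ^ (k - 3) * fact (m + k - 1) / (pi * fact m * fact (k - 2)))"
    by (metis of_real_1 of_real_divide)
  then have \<kappa>: "1 / complex_of_real \<kappa> = 2 ^ (k - 3) * fact (m + k - 1) / (of_real pi * fact m * fact (k - 2))"
    by simp
  have "(\<Sum>\<^sub>\<infinity>f\<in>F. cnj (elliptic_coeff k z0 f m) * elliptic_coeff k z0' f n) =
    elliptic_coeff (2 * q) z0' (poincare (2 * q) m z0) n / of_real \<kappa>"
    using assms(11) unfolding k by (intro elliptic_coeff_sum_basis assms(9,10) q \<kappa>_def)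
  also have "elliptic_coeff (2 * q) z0' (poincare (2 * q) m z0) n = (z0' - cnj z0') ^ (n + q) * S"
    unfolding S_def k by (rule elliptic_coeff_poincare[OF assms(9,10) q])
  also have "(z0' - cnj z0') ^ (n + q) * S / of_real \<kappa> = 1 / of_real \<kappa> * (z0' - cnj z0') ^ (n + q) * S"
    by simp
  finally show ?thesis unfolding \<kappa> S_def[symmetric] by (simp add: k mult_ac)
qed

end
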